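(* Let $\mathrm Y^{\rm tw}_q$ denote either $\mathrm Y^{\rm tw}_q(\mathfrak o_N)$ or $\mathrm Y^{\rm tw}_q(\mathfrak{sp}_N)$ (the latter with $N=2n$). The coefficients of the Sklyanin determinant $\mathrm{sdet}\,S(u)$ belong to the center of the algebra $\mathrm Y^{\rm tw}_q$.
   Context: Fix $q\in\mathbb C$, nonzero and not a root of unity. $E_{ij}$ are the matrix units of $\mathrm{End}\,\mathbb C^N$; a matrix $M=(m_{ij})$ over an algebra is identified with $\sum m_{ij}\otimes E_{ij}$, $M^t$ is its transpose; subscripts indicate the copies of $\mathrm{End}\,\mathbb C^N$ in which an element acts. Let $$R(u,v)=(u-v)\sum_{i\ne j}E_{ii}\otimes E_{jj}+(q^{-1}u-qv)\sum_iE_{ii}\otimes E_{ii}+(q^{-1}-q)u\sum_{i>j}E_{ij}\otimes E_{ji}+(q^{-1}-q)v\sum_{i<j}E_{ij}\otimes E_{ji},$$ and let $R^t(u,v)$ be obtained from it by transposition in the first tensor factor. $\mathrm U_q(\widehat{\mathfrak{gl}}_N)$ is generated by $t_{ij}^{(r)},\bar t_{ij}^{\,(r)}$ ($1\le i,j\le N$, $r\ge0$). With $t_{ij}(u)=\sum_{r\ge0}t_{ij}^{(r)}u^{-r}$, $\bar t_{ij}(u)=\sum_{r\ge0}\bar t_{ij}^{\,(r)}u^{r}$, $T(u)=(t_{ij}(u))$, $\overline T(u)=(\bar t_{ij}(u))$, the defining relations are: $t_{ij}^{(0)}=\bar t_{ji}^{\,(0)}=0$ for $i<j$; $t_{ii}^{(0)}\bar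 t_{ii}^{\,(0)}=\bar t_{ii}^{\,(0)}t_{ii}^{(0)}=1$; $R(u,v)T_1(u)T_2(v)=T_2(v)T_1(u)R(u,v)$; $R(u,v)\overline T_1(u)\overline T_2(v)=\overline T_2(v)\overline T_1(u)R(u,v)$; $R(u,v)\overline T_1(u)T_2(v)=T_2(v)\overline T_1(u)R(u,v)$. Let $S(u)=T(u)\,G\,\overline T(u^{-1})^t=(s_{ij}(u))$, $s_{ij}(u)=\sum_{r\ge0}s^{(r)}_{ij}u^{-r}$, where $G=1$ in the orthogonal case and $G=q\sum_{k=1}^nE_{2k-1,2k}-\sum_{k=1}^nE_{2k,2k-1}$, $N=2n$, in the symplectic case. $\mathrm Y^{\rm tw}_q(\mathfrak o_N)$ is the subalgebra of $\mathrm U_q(\widehat{\mathfrak{gl}}_N)$ generated by all $s_{ij}^{(r)}$; $\mathrm Y^{\rm tw}_q(\mathfrak{sp}_{2n})$ is the subalgebra of $\mathrm U_q(\widehat{\mathfrak{gl}}_{2n})$ generated by all $s_{ij}^{(r)}$ and the inverses of the (invertible) elements $s_{2k-1,2k}^{(0)}$, $k=1,\dots,n$. Sklyanin determinant: let $P^q=\sum_iE_{ii}\otimes E_{ii}+q\sum_{i>j}E_{ij}\otimes E_{ji}+q^{-1}\sum_{i<j}E_{ij}\otimes E_{ji}$. The assignment $(i,i+1)\mapsto P^q_{i,i+1}$ defines an action $\sigma\mapsto P^q_\sigma$ of the symmetric group $\mathfrak S_N$ on $(\mathbb C^N)^{\otimes N}$; put $A^q_N=\sum_{\sigma\in\mathfrak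 S_N}\mathrm{sgn}\,\sigma\cdot P^q_\sigma$. Put $u_i=q^{-2i+2}u$ and $R^t_{ij}=R^t_{ij}(u_i^{-1},u_j)$. Then $$A^q_N\,S_1(u_1)R^t_{12}\cdots R^t_{1N}\,S_2(u_2)R^t_{23}\cdots R^t_{2N}\,S_3(u_3)\cdots R^t_{N-1,N}\,S_N(u_N)$$ $$=S_N(u_N)R^t_{N-1,N}\cdots S_3(u_3)R^t_{2N}\cdots R^t_{23}\,S_2(u_2)R^t_{1N}\cdots R^t_{12}\,S_1(u_1)\,A^q_N,$$ and both sides equal $A^q_N$ times a formal series in $u^{-1}$ (with finitely many positive powers of $u$ allowed) with coefficients in $\mathrm Y^{\rm tw}_q$; this series is $\mathrm{sdet}\,S(u)$. *)

theory Defs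
  imports
    Complex_Main
    "HOL-Library.FuncSet"
    "HOL-Combinatorics.Permutations"
    "HOL-Algebra.QuotRing"
    "HOL-Algebra.Generated_Rings"
begin

section \<open>Free algebras, Laurent series and centers\<close>

text \<open>The free unital complex algebra on a set \<open>X\<close> of letters. An element is the family of its
  coefficients, indexed by the words in \<open>X\<close>; the product extends concatenation of words.\<close>

definition free_algebra :: "'g set \<Rightarrow> ('g list \<Rightarrow> complex) ring" where
  "free_algebra X =
    \<lparr>carrier = {f. finite {w. f w \<noteq> 0} \<and> {w. f w \<noteq> 0} \<subseteq> lists X},
     mult = (\<lambda>f g w. \<Sum>k\<le>length w. f (take k w) * g (drop k w)),
     one = (\<lambda>w. of_bool (w = [])),
     zero = (\<lambda>w. 0),
     add = (\<lambda>f g w. f w + g w)\<rparr>"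

definition free_scalar :: "complex \<Rightarrow> ('g list \<Rightarrow> complex)" where
  "free_scalar c = (\<lambda>w. if w = [] then c else 0)"

definition free_gen :: "'g \<Rightarrow> ('g list \<Rightarrow> complex)" where
  "free_gen x = (\<lambda>w. of_bool (w = [x]))"

text \<open>Formal series in \<open>u\<^sup>-\<^sup>1\<close> with finitely many positive powers of \<open>u\<close>, over a ring \<open>A\<close>;
  \<open>f k\<close> is the coefficient of \<open>u\<^sup>k\<close>.\<close>

definition laurent :: "('a, 'm) ring_scheme \<Rightarrow> (int \<Rightarrow> 'a) ring" where
  "laurent A =
    \<lparr>carrier = {f. (\<forall>k. f k \<in> carrier A) \<and> (\<exists>d. \<forall>k>d. f k = \<zero>\<^bsub>A\<^esub>)},
     mult = (\<lambda>f g k. \<Oplus>\<^bsub>A\<^esub> i \<in> {i. f i \<noteq> \<zero>\<^bsub>A\<^esub> \<and> g (k - i) \<noteq> \<zero>\<^bsub>A\<^esub>}. f i \<otimes>\<^bsub>A\<^esub> g (k - i)),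
     one = (\<lambda>k. if k = 0 then \<one>\<^bsub>A\<^esub> else \<zero>\<^bsub>A\<^esub>),
     zero = (\<lambda>k. \<zero>\<^bsub>A\<^esub>),
     add = (\<lambda>f g k. f k \<oplus>\<^bsub>A\<^esub> g k)\<rparr>"

definition ring_center :: "('a, 'm) ring_scheme \<Rightarrow> 'a set" where
  "ring_center A = {z \<in> carrier A. \<forall>y \<in> carrier A. z \<otimes>\<^bsub>A\<^esub> y = y \<otimes>\<^bsub>A\<^esub> z}"


section \<open>The \<open>R\<close>-matrix and the quantum affine algebra\<close>

text \<open>An element of \<open>End \<complex>\<^sup>N \<otimes> End \<complex>\<^sup>N\<close> is given by its coefficients \<open>X i j k l\<close> at
  \<open>E\<^sub>i\<^sub>j \<otimes> E\<^sub>k\<^sub>l\<close>. Since \<open>R(u,v)\<close> is linear and homogeneous in \<open>(u,v)\<close>, it is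
  \<open>u R(1,0) + v R(0,1)\<close> as a polynomial in formal variables; this is how it is multiplied with
  formal series below.\<close>

definition Rmat :: "complex \<Rightarrow> complex \<Rightarrow> complex \<Rightarrow> nat \<Rightarrow> nat \<Rightarrow> nat \<Rightarrow> nat \<Rightarrow> complex" where
  "Rmat q u v i j k l =
     (u - v) * of_bool (i = j \<and> k = l \<and> i \<noteq> k)
   + (inverse q * u - q * v) * of_bool (i = j \<and> k = l \<and> i = k)
   + (inverse q - q) * u * of_bool (i > j \<and> k = j \<and> l = i)
   + (inverse q - q) * v * of_bool (i < j \<and> k = j \<and> l = i)"

definition Rmat_t :: "complex \<Rightarrow> complex \<Rightarrow> complex \<Rightarrow> nat \<Rightarrow> nat \<Rightarrow> nat \<Rightarrow> nat \<Rightarrow> complex" where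
  "Rmat_t q u v i j k l = Rmat q u v j i k l"

definition Pq :: "complex \<Rightarrow> nat \<Rightarrow> nat \<Rightarrow> nat \<Rightarrow> nat \<Rightarrow> complex" where
  "Pq q i j k l =
     of_bool (i = j \<and> k = l \<and> i = k)
   + q * of_bool (i > j \<and> k = j \<and> l = i)
   + inverse q * of_bool (i < j \<and> k = j \<and> l = i)"

datatype uq_gen = Tgen nat nat nat | Tbargen nat nat nat

definition uq_gens :: "nat \<Rightarrow> uq_gen set" where
  "uq_gens N = {Tgen i j r | i j r. i \<in> {1..N} \<and> j \<in> {1..N}}
             \<union> {Tbargen i j r | i j r. i \<in> {1..N} \<and> j \<in> {1..N}}"

abbreviation uq_free :: "nat \<Rightarrow> (uq_gen list \<Rightarrow> complex) ring" where
  "uq_free N \<equiv> free_algebra (uq_gens N)"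

text \<open>Coefficients of \<open>u\<^sup>a\<close> in \<open>t\<^sub>i\<^sub>j(u)\<close> (a series in \<open>u\<^sup>-\<^sup>1\<close>) and in its barred
  counterpart (a series in \<open>u\<close>), still in the free algebra.\<close>

definition t_free :: "nat \<Rightarrow> nat \<Rightarrow> int \<Rightarrow> (uq_gen list \<Rightarrow> complex)" where
  "t_free i j a = (if a \<le> 0 then free_gen (Tgen i j (nat (- a))) else (\<lambda>w. 0))"

definition tbar_free :: "nat \<Rightarrow> nat \<Rightarrow> int \<Rightarrow> (uq_gen list \<Rightarrow> complex)" where
  "tbar_free i j a = (if a \<ge> 0 then free_gen (Tbargen i j (nat a)) else (\<lambda>w. 0))"

text \<open>For matrices \<open>X(u)\<close>, \<open>Y(v)\<close> of formal series: the coefficient of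
  \<open>u\<^sup>a v\<^sup>b E\<^sub>i\<^sub>j \<otimes> E\<^sub>k\<^sub>l\<close> in \<open>R(u,v) X\<^sub>1(u) Y\<^sub>2(v) - Y\<^sub>2(v) X\<^sub>1(u) R(u,v)\<close>.\<close>

definition RXY :: "complex \<Rightarrow> nat \<Rightarrow> (nat \<Rightarrow> nat \<Rightarrow> int \<Rightarrow> (uq_gen list \<Rightarrow> complex))
    \<Rightarrow> (nat \<Rightarrow> nat \<Rightarrow> int \<Rightarrow> (uq_gen list \<Rightarrow> complex))
    \<Rightarrow> nat \<Rightarrow> nat \<Rightarrow> nat \<Rightarrow> nat \<Rightarrow> int \<Rightarrow> int \<Rightarrow> (uq_gen list \<Rightarrow> complex)" where
  "RXY q N X Y i j k l a b =
    (\<Oplus>\<^bsub>uq_free N\<^esub> m \<in> {1..N}. \<Oplus>\<^bsub>uq_free N\<^esub> p \<in> {1..N}.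
       free_scalar (Rmat q 1 0 i m k p) \<otimes>\<^bsub>uq_free N\<^esub> (X m j (a - 1) \<otimes>\<^bsub>uq_free N\<^esub> Y p l b)
       \<oplus>\<^bsub>uq_free N\<^esub>
       free_scalar (Rmat q 0 1 i m k p) \<otimes>\<^bsub>uq_free N\<^esub> (X m j a \<otimes>\<^bsub>uq_free N\<^esub> Y p l (b - 1)))"

definition YXR :: "complex \<Rightarrow> nat \<Rightarrow> (nat \<Rightarrow> nat \<Rightarrow> int \<Rightarrow> (uq_gen list \<Rightarrow> complex))
    \<Rightarrow> (nat \<Rightarrow> nat \<Rightarrow> int \<Rightarrow> (uq_gen list \<Rightarrow> complex))
    \<Rightarrow> nat \<Rightarrow> nat \<Rightarrow> nat \<Rightarrow> nat \<Rightarrow> int \<Rightarrow> int \<Rightarrow> (uq_gen list \<Rightarrow> complex)" where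
  "YXR q N X Y i j k l a b =
    (\<Oplus>\<^bsub>uq_free N\<^esub> m \<in> {1..N}. \<Oplus>\<^bsub>uq_free N\<^esub> p \<in> {1..N}.
       (Y k p b \<otimes>\<^bsub>uq_free N\<^esub> X i m (a - 1)) \<otimes>\<^bsub>uq_free N\<^esub> free_scalar (Rmat q 1 0 m j p l)
       \<oplus>\<^bsub>uq_free N\<^esub>
       (Y k p (b - 1) \<otimes>\<^bsub>uq_free N\<^esub> X i m a) \<otimes>\<^bsub>uq_free N\<^esub> free_scalar (Rmat q 0 1 m j p l))"

definition RXY_relators :: "complex \<Rightarrow> nat \<Rightarrow> (nat \<Rightarrow> nat \<Rightarrow> int \<Rightarrow> (uq_gen list \<Rightarrow> complex))
    \<Rightarrow> (nat \<Rightarrow> nat \<Rightarrow> int \<Rightarrow> (uq_gen list \<Rightarrow> complex)) \<Rightarrow> (uq_gen list \<Rightarrow> complex) set" where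
  "RXY_relators q N X Y =
    {RXY q N X Y i j k l a b \<ominus>\<^bsub>uq_free N\<^esub> YXR q N X Y i j k l a b | i j k l a b.
       i \<in> {1..N} \<and> j \<in> {1..N} \<and> k \<in> {1..N} \<and> l \<in> {1..N}}"

definition uq_relators :: "complex \<Rightarrow> nat \<Rightarrow> (uq_gen list \<Rightarrow> complex) set" where
  "uq_relators q N =
     {free_gen (Tgen i j 0) | i j. i \<in> {1..N} \<and> j \<in> {1..N} \<and> i < j}
   \<union> {free_gen (Tbargen j i 0) | i j. i \<in> {1..N} \<and> j \<in> {1..N} \<and> i < j}
   \<union> {free_gen (Tgen i i 0) \<otimes>\<^bsub>uq_free N\<^esub> free_gen (Tbargen i i 0) \<ominus>\<^bsub>uq_free N\<^esub> \<one>\<^bsub>uq_free N\<^esub>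
        | i. i \<in> {1..N}}
   \<union> {free_gen (Tbargen i i 0) \<otimes>\<^bsub>uq_free N\<^esub> free_gen (Tgen i i 0) \<ominus>\<^bsub>uq_free N\<^esub> \<one>\<^bsub>uq_free N\<^esub>
        | i. i \<in> {1..N}}
   \<union> RXY_relators q N t_free t_free
   \<union> RXY_relators q N tbar_free tbar_free
   \<union> RXY_relators q N tbar_free t_free"

definition uq_ideal :: "complex \<Rightarrow> nat \<Rightarrow> (uq_gen list \<Rightarrow> complex) set" where
  "uq_ideal q N = Idl\<^bsub>uq_free N\<^esub> (uq_relators q N)"

type_synonym uq = "(uq_gen list \<Rightarrow> complex) set"

definition Uq :: "complex \<Rightarrow> nat \<Rightarrow> uq ring" where
  "Uq q N = uq_free N Quot uq_ideal q N"

definition uq_class :: "complex \<Rightarrow> nat \<Rightarrow> (uq_gen list \<Rightarrow> complex) \<Rightarrow> uq" where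
  "uq_class q N f = uq_ideal q N +>\<^bsub>uq_free N\<^esub> f"

definition uq_scalar :: "complex \<Rightarrow> nat \<Rightarrow> complex \<Rightarrow> uq" where
  "uq_scalar q N c = uq_class q N (free_scalar c)"


section \<open>The twisted \<open>q\<close>-Yangians\<close>

datatype twist = Orthogonal | Symplectic

fun Gmat :: "twist \<Rightarrow> complex \<Rightarrow> nat \<Rightarrow> nat \<Rightarrow> complex" where
  "Gmat Orthogonal q i j = of_bool (i = j)"
| "Gmat Symplectic q i j = q * of_bool (odd i \<and> j = i + 1) - of_bool (odd j \<and> i = j + 1)"

abbreviation uq_series :: "complex \<Rightarrow> nat \<Rightarrow> (int \<Rightarrow> uq) ring" where
  "uq_series q N \<equiv> laurent (Uq q N)"

definition series_scalar :: "complex \<Rightarrow> nat \<Rightarrow> complex \<Rightarrow> (int \<Rightarrow> uq)" where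
  "series_scalar q N c = (\<lambda>k. if k = 0 then uq_scalar q N c else \<zero>\<^bsub>Uq q N\<^esub>)"

definition T_ser :: "complex \<Rightarrow> nat \<Rightarrow> nat \<Rightarrow> nat \<Rightarrow> (int \<Rightarrow> uq)" where
  "T_ser q N i j = (\<lambda>k. uq_class q N (t_free i j k))"

definition Tbar_ser :: "complex \<Rightarrow> nat \<Rightarrow> nat \<Rightarrow> nat \<Rightarrow> (int \<Rightarrow> uq)" where
  "Tbar_ser q N i j = (\<lambda>k. uq_class q N (tbar_free i j k))"

text \<open>The factor \<open>\<lambda>k. Tbar_ser q N j b (- k)\<close> is the \<open>(b,j)\<close> entry of the transpose of the
  barred matrix at \<open>u\<^sup>-\<^sup>1\<close>.\<close>

definition S_ser :: "twist \<Rightarrow> complex \<Rightarrow> nat \<Rightarrow> nat \<Rightarrow> nat \<Rightarrow> (int \<Rightarrow> uq)" where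
  "S_ser ty q N i j =
    (\<Oplus>\<^bsub>uq_series q N\<^esub> a \<in> {1..N}. \<Oplus>\<^bsub>uq_series q N\<^esub> b \<in> {1..N}.
       T_ser q N i a \<otimes>\<^bsub>uq_series q N\<^esub> series_scalar q N (Gmat ty q a b)
         \<otimes>\<^bsub>uq_series q N\<^esub> (\<lambda>k. Tbar_ser q N j b (- k)))"

definition s_coeff :: "twist \<Rightarrow> complex \<Rightarrow> nat \<Rightarrow> nat \<Rightarrow> nat \<Rightarrow> nat \<Rightarrow> uq" where
  "s_coeff ty q N i j r = S_ser ty q N i j (- int r)"

definition Ytw_gens :: "twist \<Rightarrow> complex \<Rightarrow> nat \<Rightarrow> uq set" where
  "Ytw_gens ty q N =
     {s_coeff ty q N i j r | i j r. i \<in> {1..N} \<and> j \<in> {1..N}}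
   \<union> (case ty of
        Orthogonal \<Rightarrow> {}
      | Symplectic \<Rightarrow>
          {inv\<^bsub>Uq q N\<^esub> (s_coeff ty q N (2 * k - 1) (2 * k) 0) | k. 1 \<le> k \<and> 2 * k \<le> N})"

text \<open>A complex subalgebra is a subring containing the scalars.\<close>

definition Ytw :: "twist \<Rightarrow> complex \<Rightarrow> nat \<Rightarrow> uq ring" where
  "Ytw ty q N =
    (Uq q N)\<lparr>carrier := generate_ring (Uq q N) (range (uq_scalar q N) \<union> Ytw_gens ty q N)\<rparr>"


section \<open>The Sklyanin determinant\<close>

text \<open>Operators on \<open>(\<complex>\<^sup>N)\<^sup>\<otimes>\<^sup>N\<close> with coefficients in a ring \<open>L\<close>, as matrices whose rows and columns
  are indexed by the maps \<open>{1..N} \<rightarrow> {1..N}\<close> (tensor position to basis index).\<close>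

definition tensor_idx :: "nat \<Rightarrow> (nat \<Rightarrow> nat) set" where
  "tensor_idx N = {1..N} \<rightarrow>\<^sub>E {1..N}"

type_synonym 'a tensor_op = "(nat \<Rightarrow> nat) \<Rightarrow> (nat \<Rightarrow> nat) \<Rightarrow> 'a"

definition op_mult :: "('a, 'm) ring_scheme \<Rightarrow> nat \<Rightarrow> 'a tensor_op \<Rightarrow> 'a tensor_op \<Rightarrow> 'a tensor_op" where
  "op_mult L N X Y = (\<lambda>I J. \<Oplus>\<^bsub>L\<^esub> K \<in> tensor_idx N. X I K \<otimes>\<^bsub>L\<^esub> Y K J)"

definition op_one :: "('a, 'm) ring_scheme \<Rightarrow> 'a tensor_op" where
  "op_one L = (\<lambda>I J. if I = J then \<one>\<^bsub>L\<^esub> else \<zero>\<^bsub>L\<^esub>)"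

definition op_prod :: "('a, 'm) ring_scheme \<Rightarrow> nat \<Rightarrow> 'a tensor_op list \<Rightarrow> 'a tensor_op" where
  "op_prod L N Xs = foldr (op_mult L N) Xs (op_one L)"

text \<open>\<open>M\<^sub>a\<close> and \<open>X\<^sub>a\<^sub>b\<close> (for \<open>a \<noteq> b\<close>): a one- resp. two-factor operator acting in copy \<open>a\<close>
  resp. copies \<open>a\<close>, \<open>b\<close>.\<close>

definition in_copy :: "('a, 'm) ring_scheme \<Rightarrow> nat \<Rightarrow> nat \<Rightarrow> (nat \<Rightarrow> nat \<Rightarrow> 'a) \<Rightarrow> 'a tensor_op" where
  "in_copy L N a M =
    (\<lambda>I J. if \<forall>c \<in> {1..N} - {a}. I c = J c then M (I a) (J a) else \<zero>\<^bsub>L\<^esub>)"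

definition in_copies :: "('a, 'm) ring_scheme \<Rightarrow> nat \<Rightarrow> nat \<Rightarrow> nat
    \<Rightarrow> (nat \<Rightarrow> nat \<Rightarrow> nat \<Rightarrow> nat \<Rightarrow> 'a) \<Rightarrow> 'a tensor_op" where
  "in_copies L N a b X =
    (\<lambda>I J. if \<forall>c \<in> {1..N} - {a, b}. I c = J c then X (I a) (J a) (I b) (J b) else \<zero>\<^bsub>L\<^esub>)"

text \<open>The action of the symmetric group is evaluated on some factorization of the permutation into
  adjacent transpositions; the result does not depend on which one.\<close>

definition adjacent_word :: "nat \<Rightarrow> (nat \<Rightarrow> nat) \<Rightarrow> nat list" where
  "adjacent_word N \<sigma> =
    (SOME ws. set ws \<subseteq> {1..<N} \<and>
       foldr (\<lambda>i \<tau>. Transposition.transpose i (Suc i) \<circ> \<tau>) ws id = \<sigma>)"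

definition Pq_perm :: "complex \<Rightarrow> nat \<Rightarrow> (nat \<Rightarrow> nat) \<Rightarrow> (int \<Rightarrow> uq) tensor_op" where
  "Pq_perm q N \<sigma> =
    op_prod (uq_series q N) N
      (map (\<lambda>i. in_copies (uq_series q N) N i (Suc i) (\<lambda>a b c d. series_scalar q N (Pq q a b c d)))
         (adjacent_word N \<sigma>))"

definition Aq :: "complex \<Rightarrow> nat \<Rightarrow> (int \<Rightarrow> uq) tensor_op" where
  "Aq q N = (\<lambda>I J. \<Oplus>\<^bsub>uq_series q N\<^esub> \<sigma> \<in> {\<sigma>. \<sigma> permutes {1..N}}.
     series_scalar q N (of_int (sign \<sigma>)) \<otimes>\<^bsub>uq_series q N\<^esub> Pq_perm q N \<sigma> I J)"

text \<open>\<open>u\<^sub>a = shift q a \<cdot> u\<close>.\<close>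

definition shift :: "complex \<Rightarrow> nat \<Rightarrow> complex" where
  "shift q a = q powi (- 2 * int a + 2)"

text \<open>\<open>S(u\<^sub>a)\<close>, and \<open>R\<^sup>t(u\<^sub>a\<^sup>-\<^sup>1, u\<^sub>b)\<close>, whose only powers of \<open>u\<close> are \<open>u\<^sup>-\<^sup>1\<close> (from the first
  argument) and \<open>u\<close> (from the second).\<close>

definition S_shifted :: "twist \<Rightarrow> complex \<Rightarrow> nat \<Rightarrow> nat \<Rightarrow> nat \<Rightarrow> nat \<Rightarrow> (int \<Rightarrow> uq)" where
  "S_shifted ty q N a i j =
    (\<lambda>k. uq_scalar q N (shift q a powi k) \<otimes>\<^bsub>Uq q N\<^esub> S_ser ty q N i j k)"

definition Rt_shifted :: "complex \<Rightarrow> nat \<Rightarrow> nat \<Rightarrow> nat \<Rightarrow> nat \<Rightarrow> nat \<Rightarrow> nat \<Rightarrow> nat \<Rightarrow> (int \<Rightarrow> uq)" where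
  "Rt_shifted q N a b i j k l =
    (\<lambda>m. if m = -1 then uq_scalar q N (Rmat_t q (inverse (shift q a)) 0 i j k l)
         else if m = 1 then uq_scalar q N (Rmat_t q 0 (shift q b) i j k l)
         else \<zero>\<^bsub>Uq q N\<^esub>)"

definition sdet_factors :: "twist \<Rightarrow> complex \<Rightarrow> nat \<Rightarrow> (int \<Rightarrow> uq) tensor_op list" where
  "sdet_factors ty q N =
    concat (map (\<lambda>a.
        in_copy (uq_series q N) N a (S_shifted ty q N a)
        # map (\<lambda>b. in_copies (uq_series q N) N a b (Rt_shifted q N a b)) [Suc a..<Suc N])
      [1..<Suc N])"

definition sdet :: "twist \<Rightarrow> complex \<Rightarrow> nat \<Rightarrow> (int \<Rightarrow> uq)" where
  "sdet ty q N =
    (THE f. f \<in> carrier (uq_series q N) \<and>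
       (\<forall>I \<in> tensor_idx N. \<forall>J \<in> tensor_idx N.
          op_prod (uq_series q N) N (Aq q N # sdet_factors ty q N) I J
          = Aq q N I J \<otimes>\<^bsub>uq_series q N\<^esub> f))"

end

theory Submission
  imports Defs "HOL-Computational_Algebra.Formal_Laurent_Series"
begin

text \<open>Let \<open>A\<close> be the \<open>q\<close>-antisymmetrizer and \<open>X\<close> the product of the \<open>S\<^sub>a(u\<^sub>a)\<close> and
  \<open>R\<^sup>t\<^sub>a\<^sub>b\<close> in the definition of the Sklyanin determinant. The reflection equation and the Yang--Baxter
  equation move \<open>R\<^sub>i\<^sub>,\<^sub>i\<^sub>+\<^sub>1(u\<^sub>i, u\<^sub>i\<^sub>+\<^sub>1)\<close>, a multiple of \<open>1 - P\<^sup>q\<^sub>i\<^sub>,\<^sub>i\<^sub>+\<^sub>1\<close>, through \<open>X\<close>, so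
  \<open>A X\<close> is antisymmetric on the right as well; as \<open>A\<close> has rank one, \<open>A X = A f\<close> with
  \<open>f = sdet S(u)\<close>. In an extra space \<open>0\<close> with parameter \<open>v\<close>, let \<open>Z\<close> and \<open>Z\<^sup>t\<close> be the ordered
  products of the \<open>R\<^sub>a\<^sub>0(u\<^sub>a, v)\<close> and of the \<open>R\<^sup>t\<^sub>a\<^sub>0(u\<^sub>a\<^sup>-\<^sup>1, v)\<close>. The reflection equation gives
  \<open>Z X Z\<^sup>t S\<^sub>0(v) = S\<^sub>0(v) Z\<^sup>t X Z\<close>, and \<open>A Z\<close>, \<open>A Z\<^sup>t\<close> are scalar multiples of \<open>A\<close>; hence \<open>f\<close>
  commutes with \<open>S(v)\<close> whenever these scalars do not vanish. Specializing \<open>v = z u\<close> with \<open>z\<close> a complex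
  number keeps everything inside series in one variable; comparing coefficients for all but finitely
  many \<open>z\<close> separates the coefficients of \<open>f\<close> and \<open>S\<close>.\<close>

section \<open>R-matrix identities\<close>

text \<open>Dividing by the scalars of \<open>A Z\<close> and \<open>A Z^t\<close> requires them to
  be invertible, while the quantum affine algebra may have zero divisors. After v = z u they lie in
  the field of complex Laurent series in u^-1, embedded centrally in the coefficient ring, so being
  nonzero is enough. The product \<open>X\<close> does not touch space 0, hence \<open>f\<close> is
  the same for every z; only S(z u) varies, and its coefficients are monomials in 1/z. The operators
  P^q_sigma are plain permutations conjugated by a diagonal operator q^inversions, which makes the
  rank of the antisymmetrizer and the independence of reduced words visible. The scalars are
  computed on special vectors: in the support of an antisymmetric vector exactly one position has
  the same index as space 0, and antisymmetry allows this position to be prescribed; there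
  \<open>A\<close> kills almost all exchange terms. That the coefficients of \<open>f\<close> lie in
  the twisted q-Yangian follows because \<open>f\<close> is itself a matrix entry of
  \<open>A X\<close>.\<close>

definition rdiag :: "'k::field \<Rightarrow> 'k \<Rightarrow> 'k \<Rightarrow> nat \<Rightarrow> nat \<Rightarrow> 'k" where
  "rdiag q x y i k = (if i = k then x / q - q * y else x - y)"

definition rexch :: "'k::field \<Rightarrow> 'k \<Rightarrow> 'k \<Rightarrow> nat \<Rightarrow> nat \<Rightarrow> 'k" where
  "rexch q x y i k = (if i = k then 0 else (1 / q - q) * (if i > k then x else y))"

text \<open>Each row (i, k) has at most two entries, one fixing and one exchanging the indices;
  \<open>rexch\<close> vanishes at i = k so that they never overlap. The field is arbitrary because
  the parameters will be Laurent series.\<close>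

definition Rm :: "'k::field \<Rightarrow> 'k \<Rightarrow> 'k \<Rightarrow> nat \<Rightarrow> nat \<Rightarrow> nat \<Rightarrow> nat \<Rightarrow> 'k" where
  "Rm q x y i j k l = rdiag q x y i k * (of_bool (j = i) * of_bool (l = k))
     + rexch q x y i k * (of_bool (j = k) * of_bool (l = i))"

definition Rt :: "'k::field \<Rightarrow> 'k \<Rightarrow> 'k \<Rightarrow> nat \<Rightarrow> nat \<Rightarrow> nat \<Rightarrow> nat \<Rightarrow> 'k" where
  "Rt q x y i j k l = Rm q x y j i k l"

lemma sum_of_bool_mult:
  fixes f :: "nat \<Rightarrow> 'b::semiring_1"
  assumes "finite V" "a \<in> V"
  shows "(\<Sum>m\<in>V. of_bool (m = a) * f m) = f a" "(\<Sum>m\<in>V. of_bool (a = m) * f m) = f a"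
    "(\<Sum>m\<in>V. f m * of_bool (m = a)) = f a" "(\<Sum>m\<in>V. f m * of_bool (a = m)) = f a"
  using assms by (auto simp: of_bool_def if_distrib if_distribR cong: if_cong)

lemma Rm_sum_row2:
  assumes "finite V" "i \<in> V" "k \<in> V"
  shows "(\<Sum>m\<in>V. \<Sum>p\<in>V. Rm q x y i m k p * w m p) = rdiag q x y i k * w i k + rexch q x y i k * w k i"
proof -
  have "(\<Sum>m\<in>V. \<Sum>p\<in>V. Rm q x y i m k p * w m p)
    = (\<Sum>m\<in>V. of_bool (m = i) * (\<Sum>p\<in>V. of_bool (p = k) * (rdiag q x y i k * w m p)))
    + (\<Sum>m\<in>V. of_bool (m = k) * (\<Sum>p\<in>V. of_bool (p = i) * (rexch q x y i k * w m p)))"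
    unfolding Rm_def sum_distrib_left sum.distrib[symmetric] by (intro sum.cong refl) (simp add: algebra_simps)
  also have "\<dots> = rdiag q x y i k * w i k + rexch q x y i k * w k i"
    using assms by (simp only: sum_of_bool_mult)
  finally show ?thesis .
qed

lemma Rm_sum_col2:
  assumes "finite V" "j \<in> V" "l \<in> V"
  shows "(\<Sum>m\<in>V. \<Sum>p\<in>V. w m p * Rm q x y m j p l) = rdiag q x y j l * w j l + rexch q x y l j * w l j"
proof -
  have "(\<Sum>m\<in>V. \<Sum>p\<in>V. w m p * Rm q x y m j p l)
    = (\<Sum>m\<in>V. of_bool (j = m) * (\<Sum>p\<in>V. of_bool (l = p) * (rdiag q x y m p * w m p)))
    + (\<Sum>m\<in>V. of_bool (l = m) * (\<Sum>p\<in>V. of_bool (j = p) * (rexch q x y m p * w m p)))"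
    unfolding Rm_def sum_distrib_left sum.distrib[symmetric] by (intro sum.cong refl) (simp add: algebra_simps)
  also have "\<dots> = rdiag q x y j l * w j l + rexch q x y l j * w l j"
    using assms by (simp only: sum_of_bool_mult)
  finally show ?thesis .
qed

lemma Rm_sum_last:
  assumes "finite V" "m \<in> V" "s \<in> V"
  shows "(\<Sum>r\<in>V. Rm q x y m j s r * g r)
    = of_bool (j = m) * (rdiag q x y m s * g s) + of_bool (j = s) * (rexch q x y m s * g m)"
proof -
  have "(\<Sum>r\<in>V. Rm q x y m j s r * g r)
    = (\<Sum>r\<in>V. of_bool (r = s) * (of_bool (j = m) * (rdiag q x y m s * g r)))
    + (\<Sum>r\<in>V. of_bool (r = m) * (of_bool (j = s) * (rexch q x y m s * g r)))"
    unfolding Rm_def sum.distrib[symmetric] by (intro sum.cong refl) (simp add: algebra_simps)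
  also have "\<dots> = of_bool (j = m) * (rdiag q x y m s * g s) + of_bool (j = s) * (rexch q x y m s * g m)"
    using assms by (simp only: sum_of_bool_mult)
  finally show ?thesis .
qed

lemma Rm_sum_second:
  assumes "finite V" "i \<in> V" "r \<in> V"
  shows "(\<Sum>m\<in>V. Rm q x y i m r t * g m)
    = of_bool (t = r) * (rdiag q x y i r * g i) + of_bool (t = i) * (rexch q x y i r * g r)"
proof -
  have "(\<Sum>m\<in>V. Rm q x y i m r t * g m)
    = (\<Sum>m\<in>V. of_bool (m = i) * (of_bool (t = r) * (rdiag q x y i r * g m)))
    + (\<Sum>m\<in>V. of_bool (m = r) * (of_bool (t = i) * (rexch q x y i r * g m)))"
    unfolding Rm_def sum.distrib[symmetric] by (intro sum.cong refl) (simp add: algebra_simps)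
  also have "\<dots> = of_bool (t = r) * (rdiag q x y i r * g i) + of_bool (t = i) * (rexch q x y i r * g r)"
    using assms by (simp only: sum_of_bool_mult)
  finally show ?thesis .
qed

text \<open>Both sides of the Yang-Baxter equation applied to a vector \<open>w\<close>, read off at
  the multi-index (i, k, s): each factor contributes its fixing and its exchanging term. Only the
  relative order of the three indices matters, so finitely many polynomial identities
  remain.\<close>

lemma yang_baxter_action:
  fixes w :: "nat \<Rightarrow> nat \<Rightarrow> nat \<Rightarrow> 'k::field"
  assumes "q \<noteq> 0"
  shows "rdiag q x y i k * (rdiag q x z i s * (rdiag q y z k s * w i k s + rexch q y z k s * w i s k)
             + rexch q x z i s * (rdiag q y z k i * w s k i + rexch q y z k i * w s i k))
       + rexch q x y i k * (rdiag q x z k s * (rdiag q y z i s * w k i s + rexch q y z i s * w k s i)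
             + rexch q x z k s * (rdiag q y z i k * w s i k + rexch q y z i k * w s k i))
     = rdiag q y z k s * (rdiag q x z i s * (rdiag q x y i k * w i k s + rexch q x y i k * w k i s)
             + rexch q x z i s * (rdiag q x y s k * w s k i + rexch q x y s k * w k s i))
       + rexch q y z k s * (rdiag q x z i k * (rdiag q x y i s * w i s k + rexch q x y i s * w s i k)
             + rexch q x z i k * (rdiag q x y k s * w k s i + rexch q x y k s * w s k i))"
proof -
  \<comment> \<open>With h = 1/q - q, the rules x/q = h x + q x and q^2 = 1 - h q remove all
    divisions and all higher powers of q, leaving normal forms that can be compared
    directly.\<close>
  obtain h where h: "1 / q - q = h" by simp
  have h': "x / q = h * x + q * x" for x by (simp add: h[symmetric] algebra_simps)
  have qq: "q * q = 1 - h * q" using assms by (auto simp: field_simps h[symmetric])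
  then have qq': "q * (q * a) = a - h * (q * a)" for a by (simp only: mult.assoc[symmetric]) (simp add: algebra_simps)
  show ?thesis
    unfolding rdiag_def rexch_def h h'
    by (cases rule: linorder_cases[of i k]; cases rule: linorder_cases[of k s];
        cases rule: linorder_cases[of i s]) (simp_all add: algebra_simps qq qq')
qed

lemma Rm_yang_baxter:
  assumes q: "q \<noteq> 0" and V: "finite V" "i \<in> V" "k \<in> V" "s \<in> V"
  shows "(\<Sum>m\<in>V. \<Sum>p\<in>V. \<Sum>r\<in>V. Rm q x y i m k p * Rm q x z m j s r * Rm q y z p l r t)
       = (\<Sum>m\<in>V. \<Sum>p\<in>V. \<Sum>r\<in>V. Rm q y z k p s r * Rm q x z i m r t * Rm q x y m j p l)"
proof -
  let ?h = "\<lambda>m p. of_bool (j = m) * (rdiag q x z m s * Rm q y z p l s t)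
                 + of_bool (j = s) * (rexch q x z m s * Rm q y z p l m t)"
  let ?g = "\<lambda>p r. of_bool (t = r) * (rdiag q x z i r * Rm q x y i j p l)
                 + of_bool (t = i) * (rexch q x z i r * Rm q x y r j p l)"
  have "(\<Sum>m\<in>V. \<Sum>p\<in>V. \<Sum>r\<in>V. Rm q x y i m k p * Rm q x z m j s r * Rm q y z p l r t)
      = (\<Sum>m\<in>V. \<Sum>p\<in>V. Rm q x y i m k p * ?h m p)"
  proof (intro sum.cong refl)
    fix m p assume "m \<in> V"
    then have "?h m p = (\<Sum>r\<in>V. Rm q x z m j s r * Rm q y z p l r t)"
      by (intro Rm_sum_last[symmetric] V)
    then show "(\<Sum>r\<in>V. Rm q x y i m k p * Rm q x z m j s r * Rm q y z p l r t) = Rm q x y i m k p * ?h m p"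
      by (simp only: sum_distrib_left mult.assoc)
  qed
  also have "\<dots> = rdiag q x y i k * ?h i k + rexch q x y i k * ?h k i"
    by (rule Rm_sum_row2) fact+
  also have "\<dots> = rdiag q y z k s * ?g k s + rexch q y z k s * ?g s k"
    \<comment> \<open>The entry in column (j, l, t) is the action on the corresponding basis
      vector.\<close>
    using yang_baxter_action[OF q, of x y i k z s "\<lambda>a b c. of_bool (j = a) * of_bool (l = b) * of_bool (t = c)"]
    unfolding Rm_def by (simp only: algebra_simps)
  also have "\<dots> = (\<Sum>p\<in>V. \<Sum>r\<in>V. Rm q y z k p s r * ?g p r)"
    by (rule Rm_sum_row2[symmetric]) fact+
  also have "\<dots> = (\<Sum>p\<in>V. \<Sum>r\<in>V. \<Sum>m\<in>V. Rm q y z k p s r * Rm q x z i m r t * Rm q x y m j p l)"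
  proof (intro sum.cong refl)
    fix p r assume "r \<in> V"
    then have "?g p r = (\<Sum>m\<in>V. Rm q x z i m r t * Rm q x y m j p l)"
      by (intro Rm_sum_second[symmetric] V)
    then show "Rm q y z k p s r * ?g p r = (\<Sum>m\<in>V. Rm q y z k p s r * Rm q x z i m r t * Rm q x y m j p l)"
      by (simp only: sum_distrib_left mult.assoc)
  qed
  also have "\<dots> = (\<Sum>p\<in>V. \<Sum>m\<in>V. \<Sum>r\<in>V. Rm q y z k p s r * Rm q x z i m r t * Rm q x y m j p l)"
    by (intro sum.cong refl sum.swap)
  also have "\<dots> = (\<Sum>m\<in>V. \<Sum>p\<in>V. \<Sum>r\<in>V. Rm q y z k p s r * Rm q x z i m r t * Rm q x y m j p l)"
    by (rule sum.swap)
  finally show ?thesis .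
qed

text \<open>Transposing in both tensor factors amounts to exchanging the factors. For
  \<open>Rt\<close>, transposed in one factor only, this becomes symmetry under the
  exchange.\<close>

lemma Rm_flip: "Rm q x y b a d c = Rm q x y c d a b"
  by (auto simp: Rm_def rdiag_def)

lemma Rt_flip: "Rt q x y i j k l = Rt q x y k l i j"
  unfolding Rt_def by (rule Rm_flip)

lemma Rm_inverse_args:
  assumes "x \<noteq> 0" "y \<noteq> 0"
  shows "Rm q x y i j k l = (x * y) * Rm q (1 / y) (1 / x) i j k l"
proof -
  have "rdiag q x y i k = (x * y) * rdiag q (1 / y) (1 / x) i k"
       "rexch q x y i k = (x * y) * rexch q (1 / y) (1 / x) i k"
    using assms by (simp_all add: rdiag_def rexch_def right_diff_distrib)
  then show ?thesis by (simp add: Rm_def algebra_simps)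
qed

text \<open>Homogeneity of degree one. Together with \<open>Rt_flip\<close> it makes R^t_ab(u_a^-1,
  u_b) and R^t_ba(u_b^-1, u_a) proportional, so the order of the two spaces is free up to a
  scalar.\<close>

lemma Rt_inverse_args:
  assumes "x \<noteq> 0" "y \<noteq> 0"
  shows "Rt q (1 / x) y i j k l = (y / x) * Rt q (1 / y) x i j k l"
  using Rm_inverse_args[of "1/x" y q j i k l] assms unfolding Rt_def by simp

text \<open>Transposing the Yang--Baxter equation in the first two spaces and exchanging these spaces.\<close>

lemma Rt_yang_baxter:
  assumes "q \<noteq> 0" "x \<noteq> 0" "y \<noteq> 0" "finite V" "i \<in> V" "k \<in> V" "s \<in> V" "j \<in> V" "l \<in> V" "t \<in> V"
  shows "(\<Sum>m\<in>V. \<Sum>p\<in>V. \<Sum>r\<in>V. Rm q x y i m k p * Rt q (1/x) z m j s r * Rt q (1/y) z p l r t)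
       = (\<Sum>m\<in>V. \<Sum>p\<in>V. \<Sum>r\<in>V. Rt q (1/y) z k p s r * Rt q (1/x) z i m r t * Rm q x y m j p l)"
proof -
  let ?x = "1/y" and ?y = "1/x"
  have "(\<Sum>m\<in>V. \<Sum>p\<in>V. \<Sum>r\<in>V. Rm q x y i m k p * Rt q ?y z m j s r * Rt q ?x z p l r t)
    = (x * y) * (\<Sum>m\<in>V. \<Sum>p\<in>V. \<Sum>r\<in>V. Rm q ?x ?y p k m i * Rm q ?x z l p r t * Rm q ?y z j m s r)"
    unfolding sum_distrib_left Rt_def
  proof (intro sum.cong refl, goal_cases)
    case (1 m p r)
    show ?case unfolding Rm_inverse_args[OF assms(2,3), of q i m k p] Rm_flip[of q ?x ?y i m k p] by (simp only: mult_ac)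
  qed
  also have "(\<Sum>m\<in>V. \<Sum>p\<in>V. \<Sum>r\<in>V. Rm q ?x ?y p k m i * Rm q ?x z l p r t * Rm q ?y z j m s r)
    = (\<Sum>p\<in>V. \<Sum>m\<in>V. \<Sum>r\<in>V. Rm q ?y z j m s r * Rm q ?x z l p r t * Rm q ?x ?y p k m i)"
    by (subst sum.swap) (simp only: mult_ac)
  also have "\<dots> = (\<Sum>p\<in>V. \<Sum>m\<in>V. \<Sum>r\<in>V. Rm q ?x ?y l p j m * Rm q ?x z p k s r * Rm q ?y z m i r t)"
    by (rule Rm_yang_baxter[symmetric]) fact+
  also have "\<dots> = (\<Sum>m\<in>V. \<Sum>p\<in>V. \<Sum>r\<in>V. Rt q ?x z k p s r * Rt q ?y z i m r t * Rm q ?x ?y m j p l)"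
    unfolding Rt_def by (subst sum.swap) (simp only: mult_ac Rm_flip[of q ?x ?y l])
  also have "(x * y) * \<dots> = (\<Sum>m\<in>V. \<Sum>p\<in>V. \<Sum>r\<in>V. Rt q (1/y) z k p s r * Rt q (1/x) z i m r t * Rm q x y m j p l)"
    unfolding sum_distrib_left
  proof (intro sum.cong refl, goal_cases)
    case (1 m p r)
    show ?case unfolding Rm_inverse_args[OF assms(2,3), of q m j p l] by (simp only: mult_ac)
  qed
  finally show ?thesis .
qed


section \<open>The matrix G and its constant reflection equation\<close>

fun gpart :: "twist \<Rightarrow> nat \<Rightarrow> nat" where
  "gpart Orthogonal i = i"
| "gpart Symplectic i = (if odd i then i + 1 else i - 1)"

fun gcoef :: "twist \<Rightarrow> 'k::field \<Rightarrow> nat \<Rightarrow> 'k" where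
  "gcoef Orthogonal q i = 1"
| "gcoef Symplectic q i = (if odd i then q else - 1)"

text \<open>\<open>G\<close> as a monomial matrix over an arbitrary field: \<open>gpart\<close> is
  the identity or the involution exchanging 2k-1 and 2k, so every sum against G collapses to one
  term.\<close>

definition Gm :: "twist \<Rightarrow> 'k::field \<Rightarrow> nat \<Rightarrow> nat \<Rightarrow> 'k" where
  "Gm ty q i j = gcoef ty q i * of_bool (j = gpart ty i)"

lemma gpart_gpart: "i \<ge> 1 \<Longrightarrow> gpart ty (gpart ty i) = i"
  by (cases ty) auto

lemma gpart_range:
  assumes "ty = Symplectic \<longrightarrow> even N" "i \<in> {1..N}"
  shows "gpart ty i \<in> {1..N}"
proof (cases "ty = Symplectic \<and> odd i")
  case True
  with assms have "i \<noteq> N" by auto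
  with True assms show ?thesis by auto
qed (use assms in \<open>cases ty; auto\<close>)

text \<open>The index pattern k = p i, l = p j of \<open>Gm_reflection\<close> in the symplectic
  case, where fixing and exchanging terms both contribute. For i \<noteq> m the coefficient
  \<open>e i m\<close>, which sends the basis vector (m, m) to (i, i), depends only on the order of
  i and m.\<close>

lemma symplectic_pair_identity:
  fixes q u v x y :: "'k::field"
  defines "e \<equiv> \<lambda>i m. Rt q x y i m i m"
    and "p \<equiv> gpart Symplectic" and "g \<equiv> gcoef Symplectic q"
  assumes q: "q \<noteq> 0" and ij: "i \<ge> 1" "j \<ge> 1"
  shows "(u - v) * (g i * g j * e (p i) j) + rexch q u v i (p i) * (g (p i) * g j * e i j)
       = (u - v) * (g (p i) * g (p j) * e i (p j)) + rexch q u v (p j) j * (g (p i) * g j * e i j)"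
proof -
  have e: "e i m = (if i = m then x / q - q * y else (1 / q - q) * (if m > i then x else y))" for i m
    by (auto simp: e_def Rt_def Rm_def rdiag_def rexch_def)
  have rep: "\<exists>r. i = 2 * r + 1 \<or> i = 2 * r + 2" if "i \<ge> 1" for i :: nat
    using that by presburger
  obtain r where r: "i = 2 * r + 1 \<or> i = 2 * r + 2" using rep[OF ij(1)] by blast
  obtain s where s: "j = 2 * s + 1 \<or> j = 2 * s + 2" using rep[OF ij(2)] by blast
  \<comment> \<open>Either the pairs {i, p i} and {j, p j} coincide, or one lies entirely below the
    other; in the latter case \<open>e\<close> cannot tell the members of a pair apart.\<close>
  have "j = i \<or> j = p i \<or> (j < i \<and> j < p i \<and> p j < i \<and> p j < p i)
      \<or> (i < j \<and> p i < j \<and> i < p j \<and> p i < p j)"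
  proof -
    have pr: "i + p i = 4 * r + 3" and ps: "j + p j = 4 * s + 3" using r s by (auto simp: p_def)
    consider "r < s" | "r = s" | "s < r" by linarith
    then show ?thesis
    proof cases
      case 1
      then have "i < j \<and> p i < j \<and> i < p j \<and> p i < p j" using r s pr ps by auto
      then show ?thesis by blast
    next
      case 2
      then have "j = i \<or> j = p i" using r s pr by auto
      then show ?thesis by blast
    next
      case 3
      then have "j < i \<and> j < p i \<and> p j < i \<and> p j < p i" using r s pr ps by auto
      then show ?thesis by blast
    qed
  qed
  then consider "j = i" | "j = p i" | "j < i" "j < p i" "p j < i" "p j < p i"
      | "i < j" "p i < j" "i < p j" "p i < p j" by blast
  then show ?thesis
  proof cases
    case 1
    then show ?thesis using ij q
      by (cases "odd i") (auto simp: e p_def g_def rexch_def field_simps)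
  next
    case 2
    then show ?thesis using ij q
      by (cases "odd i") (auto simp: e p_def g_def rexch_def field_simps)
  next
    case 3
    then have "e (p i) j = e i j" "e i (p j) = e i j" by (auto simp: e)
    with ij q show ?thesis
      by (cases "odd i"; cases "odd j") (auto simp: p_def g_def rexch_def field_simps)
  next
    case 4
    then have "e (p i) j = e i j" "e i (p j) = e i j" by (auto simp: e)
    with ij q show ?thesis
      by (cases "odd i"; cases "odd j") (auto simp: p_def g_def rexch_def field_simps)
  qed
qed

text \<open>The reflection equation with G in place of S; the arguments (u, v) of R and (x, y) of
  R^t are unrelated here. After the sums collapse, each side has two terms and the claim is a
  comparison of index patterns.\<close>

lemma Gm_reflection:
  fixes q u v x y :: "'k::field"
  assumes q: "q \<noteq> 0" and N: "ty = Symplectic \<longrightarrow> even N"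
    and V: "i \<in> {1..N}" "j \<in> {1..N}" "k \<in> {1..N}" "l \<in> {1..N}"
  shows "(\<Sum>m=1..N. \<Sum>p=1..N. Rm q u v i m k p *
            (\<Sum>a=1..N. \<Sum>b=1..N. Gm ty q m a * Rt q x y a j p b * Gm ty q b l))
       = (\<Sum>m=1..N. \<Sum>p=1..N. (\<Sum>a=1..N. \<Sum>b=1..N. Gm ty q k b * Rt q x y i a b p * Gm ty q a m)
            * Rm q u v m j p l)"
proof -
  let ?p = "gpart ty" and ?g = "gcoef ty q"
  have pV: "?p a \<in> {1..N}" if "a \<in> {1..N}" for a using gpart_range[OF N that] .
  have pp: "?p (?p a) = a" if "a \<in> {1..N}" for a using gpart_gpart that by auto
  have G1: "Gm ty q a b = of_bool (b = ?p a) * ?g a" for a b by (simp add: Gm_def)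
  \<comment> \<open>By the involution, prescribing the column of an entry of G also fixes its
    row.\<close>
  have G2: "Gm ty q a b = of_bool (a = ?p b) * ?g a" if "a \<in> {1..N}" "b \<in> {1..N}" for a b
    using that pp by (auto simp: Gm_def)
  have A: "(\<Sum>a=1..N. \<Sum>b=1..N. Gm ty q m a * Rt q x y a j p b * Gm ty q b l)
      = ?g m * ?g (?p l) * Rt q x y (?p m) j p (?p l)" if "m \<in> {1..N}" for m p
  proof -
    have "(\<Sum>a=1..N. \<Sum>b=1..N. Gm ty q m a * Rt q x y a j p b * Gm ty q b l)
      = (\<Sum>a=1..N. of_bool (a = ?p m) * (\<Sum>b=1..N. of_bool (b = ?p l) * (?g m * ?g b * Rt q x y a j p b)))"
      unfolding sum_distrib_left using V by (intro sum.cong refl) (simp add: G1[of m] G2[of _ l])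
    also have "\<dots> = ?g m * ?g (?p l) * Rt q x y (?p m) j p (?p l)"
      using pV[OF that] pV[OF V(4)] by (simp only: sum_of_bool_mult finite_atLeastAtMost)
    finally show ?thesis .
  qed
  have B: "(\<Sum>a=1..N. \<Sum>b=1..N. Gm ty q k b * Rt q x y i a b p * Gm ty q a m)
      = ?g k * ?g (?p m) * Rt q x y i (?p m) (?p k) p" if "m \<in> {1..N}" for m p
  proof -
    have "(\<Sum>a=1..N. \<Sum>b=1..N. Gm ty q k b * Rt q x y i a b p * Gm ty q a m)
      = (\<Sum>a=1..N. of_bool (a = ?p m) * (\<Sum>b=1..N. of_bool (b = ?p k) * (?g k * ?g a * Rt q x y i a b p)))"
      unfolding sum_distrib_left using that by (intro sum.cong refl) (simp add: G1[of k] G2[of _ m])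
    also have "\<dots> = ?g k * ?g (?p m) * Rt q x y i (?p m) (?p k) p"
      using pV[OF that] pV[OF V(3)] by (simp only: sum_of_bool_mult finite_atLeastAtMost)
    finally show ?thesis .
  qed
  have "(\<Sum>m=1..N. \<Sum>p=1..N. Rm q u v i m k p *
            (\<Sum>a=1..N. \<Sum>b=1..N. Gm ty q m a * Rt q x y a j p b * Gm ty q b l))
      = (\<Sum>m=1..N. \<Sum>p=1..N. Rm q u v i m k p * (?g m * ?g (?p l) * Rt q x y (?p m) j p (?p l)))"
    by (intro sum.cong refl) (simp only: A)
  also have "\<dots> = rdiag q u v i k * (?g i * ?g (?p l) * Rt q x y (?p i) j k (?p l))
       + rexch q u v i k * (?g k * ?g (?p l) * Rt q x y (?p k) j i (?p l))"
    by (rule Rm_sum_row2) (use V in auto)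
  also have "\<dots> = rdiag q u v j l * (?g k * ?g (?p j) * Rt q x y i (?p j) (?p k) l)
       + rexch q u v l j * (?g k * ?g (?p l) * Rt q x y i (?p l) (?p k) j)"
  proof (cases ty)
    case Orthogonal
    then show ?thesis
      by (cases "i = k"; cases "j = l"; cases "i = j"; cases "k = l"; cases "i = l"; cases "j = k")
        (simp_all add: Rt_def Rm_def rdiag_def rexch_def)
  next
    case Symplectic
    \<comment> \<open>Keeps \<open>gpart\<close> and \<open>gcoef\<close> folded, so that most cases
      are decided by the involution alone; they are unfolded explicitly where parity
      matters.\<close>
    note [simp del] = gpart.simps gcoef.simps
    show ?thesis
    proof (cases "k = ?p i")
      case True
      then have ki: "?p k = i" "i \<noteq> k" using pp[OF V(1)] V by (auto simp: Symplectic gpart.simps)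
      show ?thesis
      proof (cases "l = ?p j")
        case lj: True
        then have jl: "?p l = j" "j \<noteq> l" using pp[OF V(2)] V by (auto simp: Symplectic gpart.simps)
        show ?thesis
          using symplectic_pair_identity[OF q, of i j u v x y] V ki jl lj True
          by (simp add: Symplectic rdiag_def ac_simps)
      next
        case False
        then have "l \<noteq> ?p j" "?p l \<noteq> j" using pp V by metis+
        then show ?thesis using True ki by (auto simp: Rt_def Rm_def)
      qed
    next
      case False
      then have ik: "?p k \<noteq> i" "?p i \<noteq> k" using pp V by metis+
      have inj: "?p a = ?p b \<longleftrightarrow> a = b" if "a \<in> {1..N}" "b \<in> {1..N}" for a b using pp that by metis
      \<comment> \<open>Distinct pairs are ordered as blocks, so \<open>gpart\<close> preserves the
        order between them, and exchange coefficients depend only on this order.\<close>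
      have lt: "?p k < ?p i \<longleftrightarrow> k < i"
        using False ik V unfolding Symplectic gpart.simps by (auto split: if_splits, presburger+)
      have e: "?p l = k \<longleftrightarrow> l = ?p k" "?p j = i \<longleftrightarrow> j = ?p i" "?p l = i \<longleftrightarrow> l = ?p i" "i = ?p j \<longleftrightarrow> j = ?p i"
        "?p l = j \<longleftrightarrow> l = ?p j"  using pp V by metis+
      show ?thesis
      proof (cases "j = ?p i \<and> l = ?p k")
        case True
        show ?thesis
        proof (cases "i = k")
          case True
          then show ?thesis using \<open>j = ?p i \<and> l = ?p k\<close> ik pp V
            by (simp add: Rt_def Rm_def rdiag_def rexch_def)
        next
          case False
          then show ?thesis using \<open>j = ?p i \<and> l = ?p k\<close> ik pp V inj
            by (simp add: Rt_def Rm_def rdiag_def rexch_def)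
        qed
      next
        case n1: False
        show ?thesis
        proof (cases "j = ?p k \<and> l = ?p i")
          case True
          then show ?thesis using ik pp V inj n1 lt False
            by (simp add: Rt_def Rm_def rdiag_def rexch_def)
        next
          case n2: False
          have "Rt q x y (?p i) j k (?p l) = 0" "Rt q x y i (?p j) (?p k) l = 0"
            "Rt q x y (?p k) j i (?p l) = 0" "Rt q x y i (?p l) (?p k) j = 0"
            using n1 n2 ik e by (auto simp: Rt_def Rm_def)
          then show ?thesis by simp
        qed
      qed
    qed
  qed
  also have "\<dots> = (\<Sum>m=1..N. \<Sum>p=1..N. (?g k * ?g (?p m) * Rt q x y i (?p m) (?p k) p) * Rm q u v m j p l)"
    by (rule Rm_sum_col2[symmetric]) (use V in auto)
  also have "\<dots> = (\<Sum>m=1..N. \<Sum>p=1..N. (\<Sum>a=1..N. \<Sum>b=1..N. Gm ty q k b * Rt q x y i a b p * Gm ty q a m)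
            * Rm q u v m j p l)"
    by (intro sum.cong refl) (simp only: B)
  finally show ?thesis .
qed

section \<open>Operators on tensor products\<close>

definition grd :: "nat \<Rightarrow> (nat \<Rightarrow> nat) \<Rightarrow> bool" where
  "grd N I \<longleftrightarrow> (\<forall>c\<le>N. I c \<in> {1..N})"

text \<open>Operators on tensor products of \<open>\<complex>\<^sup>N\<close> are modelled as maps on vectors, which are functions of
  multi-indices \<open>I\<close> (space \<open>c\<close> carries the basis index \<open>I c\<close>), so that products are compositions. The spaces
  are \<open>0, \<dots>, N\<close>, where \<open>0\<close> is auxiliary; every operator vanishes at multi-indices that leave the range
  \<open>{1..N}\<close>.\<close>

definition op1 :: "nat \<Rightarrow> nat \<Rightarrow> (nat \<Rightarrow> nat \<Rightarrow> 'a::ring_1) \<Rightarrow> ((nat \<Rightarrow> nat) \<Rightarrow> 'a) \<Rightarrow> (nat \<Rightarrow> nat) \<Rightarrow> 'a" where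
  "op1 N a M v I = (if grd N I then \<Sum>j=1..N. M (I a) j * v (I(a := j)) else 0)"

definition op2 :: "nat \<Rightarrow> nat \<Rightarrow> nat \<Rightarrow> (nat \<Rightarrow> nat \<Rightarrow> nat \<Rightarrow> nat \<Rightarrow> 'a::ring_1)
    \<Rightarrow> ((nat \<Rightarrow> nat) \<Rightarrow> 'a) \<Rightarrow> (nat \<Rightarrow> nat) \<Rightarrow> 'a" where
  "op2 N a b X v I = (if grd N I then \<Sum>j=1..N. \<Sum>l=1..N. X (I a) j (I b) l * v (I(a := j, b := l)) else 0)"

lemma grd_upd: "grd N I \<Longrightarrow> j \<in> {1..N} \<Longrightarrow> grd N (I(a := j))"
  by (simp add: grd_def)

lemma grdD: "grd N I \<Longrightarrow> a \<le> N \<Longrightarrow> I a \<in> {1..N}"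
  by (simp add: grd_def)

lemma op2_cong:
  assumes "a \<le> N" "b \<le> N" "\<And>i j k l. i \<in> {1..N} \<Longrightarrow> j \<in> {1..N} \<Longrightarrow> k \<in> {1..N} \<Longrightarrow> l \<in> {1..N} \<Longrightarrow> X i j k l = X' i j k l"
  shows "op2 N a b X v = op2 N a b X' v"
proof
  fix I show "op2 N a b X v I = op2 N a b X' v I"
    unfolding op2_def using assms grdD[of N I a] grdD[of N I b] by (auto intro!: sum.cong)
qed

lemma op1_op1_same:
  "op1 N a M (op1 N a M' v) = op1 N a (\<lambda>i j. \<Sum>m=1..N. M i m * M' m j) v"
proof
  fix I
  have "(\<Sum>m=1..N. M (I a) m * (\<Sum>j=1..N. M' m j * v (I(a := j))))
     = (\<Sum>j=1..N. (\<Sum>m=1..N. M (I a) m * M' m j) * v (I(a := j)))"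
    unfolding sum_distrib_left sum_distrib_right mult.assoc by (rule sum.swap)
  then show "op1 N a M (op1 N a M' v) I = op1 N a (\<lambda>i j. \<Sum>m=1..N. M i m * M' m j) v I"
    by (cases "grd N I") (simp_all add: op1_def grd_upd cong: sum.cong_simp)
qed

lemma op2_op2_same:
  assumes "a \<noteq> b"
  shows "op2 N a b X (op2 N a b Y v) = op2 N a b (\<lambda>i j k l. \<Sum>m=1..N. \<Sum>p=1..N. X i m k p * Y m j p l) v"
proof
  fix I
  have "(\<Sum>m=1..N. \<Sum>p=1..N. X (I a) m (I b) p * (\<Sum>j=1..N. \<Sum>l=1..N. Y m j p l * v (I(a := j, b := l))))
     = (\<Sum>j=1..N. \<Sum>l=1..N. (\<Sum>m=1..N. \<Sum>p=1..N. X (I a) m (I b) p * Y m j p l) * v (I(a := j, b := l)))"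
    unfolding sum_distrib_left sum_distrib_right mult.assoc sum.cartesian_product
    by (rule sum.reindex_bij_witness[of _ "\<lambda>(j,l,m,p). (m,p,j,l)" "\<lambda>(m,p,j,l). (j,l,m,p)"]) (auto simp: mult.assoc)
  then show "op2 N a b X (op2 N a b Y v) I = op2 N a b (\<lambda>i j k l. \<Sum>m=1..N. \<Sum>p=1..N. X i m k p * Y m j p l) v I"
    using assms by (cases "grd N I") (simp_all add: op2_def grd_upd fun_upd_twist[of b a] cong: sum.cong_simp)
qed

lemma op1_op1_pair:
  assumes "a \<noteq> b"
  shows "op1 N a M (op1 N b M' v) = op2 N a b (\<lambda>i j k l. M i j * M' k l) v"
    and "op1 N b M' (op1 N a M v) = op2 N a b (\<lambda>i j k l. M' k l * M i j) v"
proof -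
  show "op1 N a M (op1 N b M' v) = op2 N a b (\<lambda>i j k l. M i j * M' k l) v"
    using assms by (intro ext, subst (1) op1_def, subst op2_def) (simp add: op1_def grd_upd sum_distrib_left mult.assoc cong: sum.cong_simp if_cong)
  show "op1 N b M' (op1 N a M v) = op2 N a b (\<lambda>i j k l. M' k l * M i j) v"
  proof
    fix I
    have "(\<Sum>l=1..N. \<Sum>j=1..N. M' (I b) l * (M (I a) j * v (I(a := j, b := l))))
      = (\<Sum>j=1..N. \<Sum>l=1..N. M' (I b) l * (M (I a) j * v (I(a := j, b := l))))"
      by (rule sum.swap)
    then show "op1 N b M' (op1 N a M v) I = op2 N a b (\<lambda>i j k l. M' k l * M i j) v I"
      using assms by (cases "grd N I") (simp_all add: op1_def op2_def grd_upd sum_distrib_left mult.assoc fun_upd_twist[of b a] cong: sum.cong_simp)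
  qed
qed

lemma op2_op1_fst:
  assumes "a \<noteq> b" "b \<le> N"
  shows "op2 N a b X (op1 N a M v) = op2 N a b (\<lambda>i j k l. \<Sum>m=1..N. X i m k l * M m j) v"
proof
  fix I
  have "(\<Sum>m=1..N. \<Sum>l=1..N. \<Sum>j=1..N. X (I a) m (I b) l * (M m j * v (I(a := j, b := l))))
     = (\<Sum>j=1..N. \<Sum>l=1..N. \<Sum>m=1..N. X (I a) m (I b) l * (M m j * v (I(a := j, b := l))))"
    unfolding sum.cartesian_product
    by (rule sum.reindex_bij_witness[of _ "\<lambda>(j,l,m). (m,l,j)" "\<lambda>(m,l,j). (j,l,m)"]) auto
  then show "op2 N a b X (op1 N a M v) I = op2 N a b (\<lambda>i j k l. \<Sum>m=1..N. X i m k l * M m j) v I"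
    using assms by (cases "grd N I") (simp_all add: op1_def op2_def grd_upd sum_distrib_left sum_distrib_right mult.assoc fun_upd_twist[of b a] cong: sum.cong_simp)
qed

lemma op2_op1_snd:
  assumes "a \<noteq> b"
  shows "op2 N a b X (op1 N b M v) = op2 N a b (\<lambda>i j k l. \<Sum>p=1..N. X i j k p * M p l) v"
proof
  fix I
  have "(\<Sum>j=1..N. \<Sum>p=1..N. \<Sum>l=1..N. X (I a) j (I b) p * (M p l * v (I(a := j, b := l))))
     = (\<Sum>j=1..N. \<Sum>l=1..N. \<Sum>p=1..N. X (I a) j (I b) p * (M p l * v (I(a := j, b := l))))"
    by (intro sum.cong refl sum.swap)
  then show "op2 N a b X (op1 N b M v) I = op2 N a b (\<lambda>i j k l. \<Sum>p=1..N. X i j k p * M p l) v I"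
    using assms by (cases "grd N I") (simp_all add: op1_def op2_def grd_upd sum_distrib_left sum_distrib_right mult.assoc cong: sum.cong_simp)
qed

lemma op1_fst_op2:
  assumes "a \<noteq> b"
  shows "op1 N a M (op2 N a b X v) = op2 N a b (\<lambda>i j k l. \<Sum>m=1..N. M i m * X m j k l) v"
proof
  fix I
  have "(\<Sum>m=1..N. \<Sum>j=1..N. \<Sum>l=1..N. M (I a) m * (X m j (I b) l * v (I(a := j, b := l))))
     = (\<Sum>j=1..N. \<Sum>l=1..N. \<Sum>m=1..N. M (I a) m * (X m j (I b) l * v (I(a := j, b := l))))"
    unfolding sum.cartesian_product
    by (rule sum.reindex_bij_witness[of _ "\<lambda>(j,l,m). (m,j,l)" "\<lambda>(m,j,l). (j,l,m)"]) auto
  then show "op1 N a M (op2 N a b X v) I = op2 N a b (\<lambda>i j k l. \<Sum>m=1..N. M i m * X m j k l) v I"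
    using assms by (cases "grd N I") (simp_all add: op1_def op2_def grd_upd sum_distrib_left sum_distrib_right mult.assoc fun_upd_twist[of b a] cong: sum.cong_simp)
qed

lemma op1_snd_op2:
  assumes "a \<noteq> b"
  shows "op1 N b M (op2 N a b X v) = op2 N a b (\<lambda>i j k l. \<Sum>p=1..N. M k p * X i j p l) v"
proof
  fix I
  have "(\<Sum>p=1..N. \<Sum>j=1..N. \<Sum>l=1..N. M (I b) p * (X (I a) j p l * v (I(a := j, b := l))))
     = (\<Sum>j=1..N. \<Sum>l=1..N. \<Sum>p=1..N. M (I b) p * (X (I a) j p l * v (I(a := j, b := l))))"
    unfolding sum.cartesian_product
    by (rule sum.reindex_bij_witness[of _ "\<lambda>(j,l,m). (m,j,l)" "\<lambda>(m,j,l). (j,l,m)"]) auto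
  then show "op1 N b M (op2 N a b X v) I = op2 N a b (\<lambda>i j k l. \<Sum>p=1..N. M k p * X i j p l) v I"
    using assms by (cases "grd N I") (simp_all add: op1_def op2_def grd_upd sum_distrib_left sum_distrib_right mult.assoc fun_upd_twist[of b a] cong: sum.cong_simp)
qed

lemma op1_op1_commute:
  assumes "a \<noteq> b" "\<And>i j k l. M i j * M' k l = M' k l * M i j"
  shows "op1 N a M (op1 N b M' v) = op1 N b M' (op1 N a M v)"
  unfolding op1_op1_pair[OF assms(1)] assms(2) ..

lemma op1_op2_commute:
  assumes "c \<noteq> a" "c \<noteq> b" "\<And>i j i' j' k' l'. M i j * X i' j' k' l' = X i' j' k' l' * M i j"
  shows "op1 N c M (op2 N a b X v) = op2 N a b X (op1 N c M v)"
proof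
  fix I
  have "(\<Sum>t=1..N. \<Sum>j=1..N. \<Sum>l=1..N. M (I c) t * (X (I a) j (I b) l * v (I(c := t, a := j, b := l))))
     = (\<Sum>j=1..N. \<Sum>l=1..N. \<Sum>t=1..N. X (I a) j (I b) l * (M (I c) t * v (I(c := t, a := j, b := l))))"
    unfolding sum.cartesian_product
    by (rule sum.reindex_bij_witness[of _ "\<lambda>(j,l,m). (m,j,l)" "\<lambda>(m,j,l). (j,l,m)"])
      (auto simp: mult.assoc[symmetric] assms(3))
  moreover have "I(a := j, b := l, c := t) = I(c := t, a := j, b := l)" for j l t
    using assms(1,2) by auto
  ultimately show "op1 N c M (op2 N a b X v) I = op2 N a b X (op1 N c M v) I"
    using assms(1,2) by (cases "grd N I") (simp_all add: op1_def op2_def grd_upd sum_distrib_left cong: sum.cong_simp)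
qed

lemma op2_op2_commute:
  assumes "c \<noteq> a" "c \<noteq> b" "d \<noteq> a" "d \<noteq> b"
    and "\<And>i j k l i' j' k' l'. Y i j k l * X i' j' k' l' = X i' j' k' l' * Y i j k l"
  shows "op2 N c d Y (op2 N a b X v) = op2 N a b X (op2 N c d Y v)"
proof
  fix I
  have "(\<Sum>s=1..N. \<Sum>t=1..N. \<Sum>j=1..N. \<Sum>l=1..N. Y (I c) s (I d) t * (X (I a) j (I b) l * v (I(c := s, d := t, a := j, b := l))))
     = (\<Sum>j=1..N. \<Sum>l=1..N. \<Sum>s=1..N. \<Sum>t=1..N. X (I a) j (I b) l * (Y (I c) s (I d) t * v (I(c := s, d := t, a := j, b := l))))"
    unfolding sum.cartesian_product
    by (rule sum.reindex_bij_witness[of _ "\<lambda>(j,l,s,t). (s,t,j,l)" "\<lambda>(s,t,j,l). (j,l,s,t)"])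
      (auto simp: mult.assoc[symmetric] assms(5))
  moreover have "I(a := j, b := l, c := s, d := t) = I(c := s, d := t, a := j, b := l)" for j l s t
    using assms(1-4) by auto
  ultimately show "op2 N c d Y (op2 N a b X v) I = op2 N a b X (op2 N c d Y v) I"
    using assms(1-4) by (cases "grd N I") (simp_all add: op2_def grd_upd sum_distrib_left cong: sum.cong_simp)
qed

text \<open>Lifts an entrywise identity of Yang-Baxter type to any three spaces of the tensor
  product; \<open>Rm_yang_baxter\<close> and \<open>Rt_yang_baxter\<close> both have this
  shape.\<close>

lemma op2_triple:
  assumes "a \<noteq> b" "a \<noteq> c" "b \<noteq> c" "a \<le> N" "b \<le> N" "c \<le> N"
    and eq: "\<And>i j k l s t. i \<in> {1..N} \<Longrightarrow> j \<in> {1..N} \<Longrightarrow> k \<in> {1..N} \<Longrightarrow> l \<in> {1..N} \<Longrightarrow> s \<in> {1..N} \<Longrightarrow> t \<in> {1..N} \<Longrightarrow>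
        (\<Sum>m=1..N. \<Sum>p=1..N. \<Sum>r=1..N. X i m k p * Y m j s r * Z p l r t)
      = (\<Sum>m=1..N. \<Sum>p=1..N. \<Sum>r=1..N. Z k p s r * Y i m r t * X m j p l)"
  shows "op2 N a b X (op2 N a c Y (op2 N b c Z v)) = op2 N b c Z (op2 N a c Y (op2 N a b X v))"
proof
  fix I
  let ?V = "{1..N}"
  show "op2 N a b X (op2 N a c Y (op2 N b c Z v)) I = op2 N b c Z (op2 N a c Y (op2 N a b X v)) I"
  proof (cases "grd N I")
    case True
    have eqs: "I(b := l, c := r, a := j, c := t) = I(a := j, b := l, c := t)"
       "I(a := j, b := l, c := r, b := p, c := t) = I(a := j, b := p, c := t)"
       "I(a := m, b := p, c := r, a := j, b := l) = I(a := j, b := l, c := r)"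
       "I(a := m, b := p, a := j, c := r) = I(a := j, b := p, c := r)"
       "I(c := t, a := j, b := l) = I(a := j, b := l, c := t)"
       "I(b := p, c := r, a := m, c := t) = I(a := m, b := p, c := t)" for j l t r p m
      using assms(1-3) by auto
    have "op2 N a b X (op2 N a c Y (op2 N b c Z v)) I
      = (\<Sum>m\<in>?V. \<Sum>p\<in>?V. \<Sum>j\<in>?V. \<Sum>r\<in>?V. \<Sum>l\<in>?V. \<Sum>t\<in>?V. X (I a) m (I b) p * (Y m j (I c) r * (Z p l r t * v (I(a := j, b := l, c := t)))))"
      using True assms(1-3) by (simp add: op2_def grd_upd sum_distrib_left eqs cong: sum.cong_simp)
    also have "\<dots> = (\<Sum>j\<in>?V. \<Sum>l\<in>?V. \<Sum>t\<in>?V. (\<Sum>m\<in>?V. \<Sum>p\<in>?V. \<Sum>r\<in>?V. X (I a) m (I b) p * Y m j (I c) r * Z p l r t) * v (I(a := j, b := l, c := t)))"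
      unfolding sum.cartesian_product sum_distrib_right
      by (rule sum.reindex_bij_witness[of _ "\<lambda>(j,l,t,m,p,r). (m,p,j,r,l,t)" "\<lambda>(m,p,j,r,l,t). (j,l,t,m,p,r)"])
        (auto simp: mult.assoc)
    also have "\<dots> = (\<Sum>j\<in>?V. \<Sum>l\<in>?V. \<Sum>t\<in>?V. (\<Sum>m\<in>?V. \<Sum>p\<in>?V. \<Sum>r\<in>?V. Z (I b) p (I c) r * Y (I a) m r t * X m j p l) * v (I(a := j, b := l, c := t)))"
      using grdD[OF True] assms(4-6) by (intro sum.cong refl) (subst eq; simp)
    also have "\<dots> = (\<Sum>p\<in>?V. \<Sum>r\<in>?V. \<Sum>m\<in>?V. \<Sum>t\<in>?V. \<Sum>j\<in>?V. \<Sum>l\<in>?V. Z (I b) p (I c) r * (Y (I a) m r t * (X m j p l * v (I(a := j, b := l, c := t)))))"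
      unfolding sum.cartesian_product sum_distrib_right
      by (rule sum.reindex_bij_witness[of _ "\<lambda>(p,r,m,t,j,l). (j,l,t,m,p,r)" "\<lambda>(j,l,t,m,p,r). (p,r,m,t,j,l)"])
        (auto simp: mult.assoc)
    also have "\<dots> = op2 N b c Z (op2 N a c Y (op2 N a b X v)) I"
      using True assms(1-3) by (simp add: op2_def grd_upd sum_distrib_left eqs cong: sum.cong_simp)
    finally show ?thesis .
  qed (simp add: op2_def)
qed

section \<open>Permutations, adjacent words and inversions\<close>

lemma adjacent_factorization:
  assumes "\<sigma> permutes {1..N::nat}"
  shows "\<exists>ws. set ws \<subseteq> {1..<N} \<and> apply_adj_transps ws = \<sigma>"
  using assms finite_atLeastAtMost
proof (induction rule: permutes_induct)
  case id
  show ?case by (intro exI[of _ "[]"]) simp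
next
  case (swap a b p)
  have app: "apply_adj_transps (xs @ ys) = apply_adj_transps xs \<circ> apply_adj_transps ys" for xs ys
    by (induction xs) (simp_all add: o_assoc)
  have main: "\<exists>ws. set ws \<subseteq> {1..<N} \<and> apply_adj_transps ws = Transposition.transpose a b \<circ> p"
    if ab: "a \<in> {1..N}" "b \<in> {1..N}" "a < b" for a b
  proof -
    obtain ws where ws: "set ws \<subseteq> {1..<N}" "apply_adj_transps ws = p" using swap by blast
    have "set (adj_transp_seq a b @ ws) \<subseteq> {1..<N}"
      using ws ab by (auto simp: set_adj_transp_seq)
    moreover have "apply_adj_transps (adj_transp_seq a b @ ws) = Transposition.transpose a b \<circ> p"
      by (simp add: app adj_transp_seq_correct[OF \<open>a < b\<close>] ws)
    ultimately show ?thesis by blast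
  qed
  show ?case
  proof (cases "a < b")
    case True
    then show ?thesis using main swap(1,2) by blast
  next
    case False
    then have "b < a" using swap(3) by simp
    then show ?thesis using main[of b a] swap(1,2) by (simp only: transpose_commute[of b a])
  qed
qed

text \<open>The exponent that makes P^q a conjugate of the plain flip: exchanging two distinct
  neighbouring entries changes this number by one, matching the factor q or 1/q in P^q.\<close>

definition inversions :: "nat \<Rightarrow> (nat \<Rightarrow> nat) \<Rightarrow> int" where
  "inversions N J = (\<Sum>(p, r) \<in> {(p, r). 1 \<le> p \<and> p < r \<and> r \<le> N}. of_bool (J p > J r))"

text \<open>An adjacent transposition permutes all other pairs of positions among themselves without
  reversing any of them, so only the pair (i, i+1) changes its contribution.\<close>

lemma inversions_swap:
  assumes i: "1 \<le> i" "i < N"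
  shows "inversions N J - inversions N (J \<circ> Transposition.transpose i (Suc i))
    = (if J i > J (Suc i) then 1 else if J i < J (Suc i) then -1 else 0)"
proof -
  let ?s = "Transposition.transpose i (Suc i)"
  define D where "D = {(p, r). 1 \<le> p \<and> p < r \<and> r \<le> N \<and> (p, r) \<noteq> (i, Suc i)}"
  have D: "{(p, r). 1 \<le> p \<and> p < r \<and> r \<le> N} = insert (i, Suc i) D"
    using i by (auto simp: D_def)
  have fin: "finite D"
    by (rule finite_subset[of _ "{0..N} \<times> {0..N}"]) (auto simp: D_def)
  have nin: "(i, Suc i) \<notin> D" by (simp add: D_def)
  have sD: "(?s p, ?s r) \<in> D" if "(p, r) \<in> D" for p r
    using that i by (auto simp: D_def Transposition.transpose_def split: if_splits)
  have "(\<Sum>(p, r) \<in> D. of_bool ((J \<circ> ?s) p > (J \<circ> ?s) r)) = (\<Sum>(p, r) \<in> D. of_bool (J p > J r) :: int)"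
    by (rule sum.reindex_bij_witness[of _ "\<lambda>(p, r). (?s p, ?s r)" "\<lambda>(p, r). (?s p, ?s r)"])
      (auto intro: sD)
  then show ?thesis
    unfolding inversions_def D using fin nin by simp
qed

lemma inversions_cong:
  assumes "\<And>c. c \<in> {1..N} \<Longrightarrow> I c = J c"
  shows "inversions N I = inversions N J"
  unfolding inversions_def by (intro sum.cong refl) (auto simp: assms)

section \<open>Central scalars and right-linear operators\<close>

locale scalar_embedding =
  fixes \<iota> :: "'k::field_char_0 \<Rightarrow> 'a::ring_1"
  assumes \<iota>_add: "\<iota> (c + d) = \<iota> c + \<iota> d"
    and \<iota>_mult: "\<iota> (c * d) = \<iota> c * \<iota> d"
    and \<iota>_one: "\<iota> 1 = 1"
    and \<iota>_central: "\<iota> c * x = x * \<iota> c"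
begin

lemma \<iota>_zero: "\<iota> 0 = 0"
  using \<iota>_add[of 0 0] by simp

lemma \<iota>_minus: "\<iota> (- c) = - \<iota> c"
  using \<iota>_add[of c "- c"] \<iota>_zero minus_unique[of "\<iota> c" "\<iota> (- c)"] by simp

lemma \<iota>_sum: "\<iota> (sum f A) = (\<Sum>x\<in>A. \<iota> (f x))"
  by (induction A rule: infinite_finite_induct) (simp_all add: \<iota>_zero \<iota>_add)

lemma \<iota>_of_nat: "\<iota> (of_nat n) = of_nat n"
  by (induction n) (simp_all add: \<iota>_zero \<iota>_add \<iota>_one)

text \<open>The coefficient ring may have zero divisors; cancellation works because the scalar is
  inverted in the field before it is embedded.\<close>

lemma \<iota>_cancel:
  assumes "\<iota> c * x = \<iota> c * y" "c \<noteq> 0"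
  shows "x = y"
proof -
  have "\<iota> (1 / c) * (\<iota> c * x) = \<iota> (1 / c) * (\<iota> c * y)" using assms by simp
  with assms(2) show ?thesis by (simp add: mult.assoc[symmetric] \<iota>_mult[symmetric] \<iota>_one)
qed

lemma \<iota>_left_commute: "x * (\<iota> c * y) = \<iota> c * (x * y)"
  by (metis \<iota>_central mult.assoc)

lemma \<iota>_\<iota>: "\<iota> c * (\<iota> d * x) = \<iota> (c * d) * x"
  by (simp add: \<iota>_mult mult.assoc)

end

text \<open>Stands in for the identity operator: operators vanish off the grid, so a product that is
  the identity on the grid equals the cutoff and not the identity map.\<close>

definition cutoff :: "nat \<Rightarrow> ((nat \<Rightarrow> nat) \<Rightarrow> 'a::ring_1) \<Rightarrow> (nat \<Rightarrow> nat) \<Rightarrow> 'a" where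
  "cutoff N v = (\<lambda>I. if grd N I then v I else 0)"

text \<open>Matrix coefficients multiply from the left in a noncommutative ring, hence operators are
  linear for scalars on the right. Commuting with \<open>cutoff\<close> says that values off the
  grid never influence values on it.\<close>

definition oper :: "nat \<Rightarrow> (((nat \<Rightarrow> nat) \<Rightarrow> 'a::ring_1) \<Rightarrow> (nat \<Rightarrow> nat) \<Rightarrow> 'a) \<Rightarrow> bool" where
  "oper N f \<longleftrightarrow> (\<forall>v w. f (\<lambda>I. v I + w I) = (\<lambda>I. f v I + f w I))
     \<and> (\<forall>v c. f (\<lambda>I. v I * c) = (\<lambda>I. f v I * c)) \<and> (\<forall>v. f (cutoff N v) = cutoff N (f v))"

lemma oper_add: "oper N f \<Longrightarrow> f (\<lambda>I. v I + w I) = (\<lambda>I. f v I + f w I)"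
  and oper_scale: "oper N f \<Longrightarrow> f (\<lambda>I. v I * c) = (\<lambda>I. f v I * c)"
  and oper_cutoff: "oper N f \<Longrightarrow> f (cutoff N v) = cutoff N (f v)"
  by (auto simp: oper_def)

lemma oper_zero: "oper N f \<Longrightarrow> f (\<lambda>I. 0) = (\<lambda>I. 0)"
  using oper_scale[of N f "\<lambda>I. 0" 0] by simp

lemma oper_uminus: "oper N f \<Longrightarrow> f (\<lambda>I. - v I) = (\<lambda>I. - f v I)"
  using oper_scale[of N f v "-1"] by simp

lemma oper_diff: "oper N f \<Longrightarrow> f (\<lambda>I. v I - w I) = (\<lambda>I. f v I - f w I)"
  using oper_add[of N f v "\<lambda>I. - w I"] oper_uminus[of N f w] by simp

lemma oper_sum:
  assumes "oper N f"
  shows "f (\<lambda>I. \<Sum>x\<in>X. v x I) = (\<lambda>I. \<Sum>x\<in>X. f (v x) I)"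
proof (induction X rule: infinite_finite_induct)
  case (insert x F)
  then show ?case using oper_add[OF assms, of "v x" "\<lambda>I. \<Sum>x\<in>F. v x I"] by simp
qed (simp_all add: oper_zero[OF assms])

lemma (in scalar_embedding) oper_\<iota>:
  assumes "oper N f"
  shows "f (\<lambda>I. \<iota> c * v I) = (\<lambda>I. \<iota> c * f v I)"
  using oper_scale[OF assms, of v "\<iota> c"] by (simp add: \<iota>_central)

lemma oper_comp: "oper N f \<Longrightarrow> oper N g \<Longrightarrow> oper N (\<lambda>v. f (g v))"
  by (simp add: oper_def)

lemma oper_id: "oper N (\<lambda>v. v)"
  by (simp add: oper_def)

lemma oper_op1: "oper N (op1 N a M)"
  unfolding oper_def cutoff_def
  by (auto simp: fun_eq_iff op1_def distrib_left sum.distrib sum_distrib_right mult.assoc grd_upd intro!: sum.cong)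

lemma oper_op2: "oper N (op2 N a b X)"
  unfolding oper_def cutoff_def
  by (auto simp: fun_eq_iff op2_def distrib_left sum.distrib sum_distrib_right mult.assoc grd_upd intro!: sum.cong)

text \<open>\<open>lop N f\<close>: the operator \<open>f\<close> acts in the spaces \<open>1, \<dots>, N\<close> only.\<close>

definition off :: "nat \<Rightarrow> ((nat \<Rightarrow> nat) \<Rightarrow> 'a) \<Rightarrow> bool" where
  "off N g \<longleftrightarrow> (\<forall>I J. (\<forall>c. c \<notin> {1..N} \<longrightarrow> I c = J c) \<longrightarrow> g I = g J)"

definition ov :: "nat \<Rightarrow> (nat \<Rightarrow> nat) \<Rightarrow> (nat \<Rightarrow> nat) \<Rightarrow> nat \<Rightarrow> nat" where
  "ov N K I = (\<lambda>c. if c \<in> {1..N} then I c else K c)"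

definition lop :: "nat \<Rightarrow> (((nat \<Rightarrow> nat) \<Rightarrow> 'a::ring_1) \<Rightarrow> (nat \<Rightarrow> nat) \<Rightarrow> 'a) \<Rightarrow> bool" where
  "lop N f \<longleftrightarrow> oper N f \<and> (\<forall>v g. off N g \<longrightarrow> f (\<lambda>I. v I * g I) = (\<lambda>I. f v I * g I))
     \<and> (\<forall>v K I. K 0 \<in> {1..N} \<longrightarrow> grd N I \<longrightarrow> f (\<lambda>J. v (ov N K J)) I = f v (ov N K I))"

lemma lop_oper: "lop N f \<Longrightarrow> oper N f"
  and lop_off: "lop N f \<Longrightarrow> off N g \<Longrightarrow> f (\<lambda>I. v I * g I) = (\<lambda>I. f v I * g I)"
  and lop_ov: "lop N f \<Longrightarrow> K 0 \<in> {1..N} \<Longrightarrow> grd N I \<Longrightarrow> f (\<lambda>J. v (ov N K J)) I = f v (ov N K I)"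
  by (auto simp: lop_def)

lemma grd_ov: "K 0 \<in> {1..N} \<Longrightarrow> grd N I \<Longrightarrow> grd N (ov N K I)"
  unfolding grd_def
proof (intro allI impI)
  fix c assume "K 0 \<in> {1..N}" "\<forall>c\<le>N. I c \<in> {1..N}" "c \<le> N"
  then show "ov N K I c \<in> {1..N}" by (cases "c = 0") (auto simp: ov_def)
qed

lemma lop_comp:
  assumes f: "lop N f" and g: "lop N g"
  shows "lop N (\<lambda>v. f (g v))"
proof -
  have "f (g (\<lambda>J. v (ov N K J))) I = f (g v) (ov N K I)" if K: "K 0 \<in> {1..N}" and I: "grd N I" for v K I
  proof -
    \<comment> \<open>The invariance of \<open>g\<close> is available only on the grid, so a cutoff
      is slipped under \<open>f\<close> before it is used.\<close>
    have "f (g (\<lambda>J. v (ov N K J))) I = cutoff N (f (g (\<lambda>J. v (ov N K J)))) I"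
      using I by (simp add: cutoff_def)
    also have "\<dots> = f (cutoff N (g (\<lambda>J. v (ov N K J)))) I"
      by (simp only: oper_cutoff[OF lop_oper[OF f]])
    also have "cutoff N (g (\<lambda>J. v (ov N K J))) = cutoff N (\<lambda>J. g v (ov N K J))"
      using lop_ov[where K = K, OF g K] by (auto simp: cutoff_def)
    also have "f (\<dots>) I = cutoff N (f (\<lambda>J. g v (ov N K J))) I"
      by (simp only: oper_cutoff[OF lop_oper[OF f]])
    also have "\<dots> = f (\<lambda>J. g v (ov N K J)) I"
      using I by (simp add: cutoff_def)
    also have "\<dots> = f (g v) (ov N K I)"
      by (rule lop_ov[where K = K, OF f K I])
    finally show ?thesis .
  qed
  then show ?thesis
    unfolding lop_def using oper_comp[OF lop_oper[OF f] lop_oper[OF g]] lop_off[OF f] lop_off[OF g] by simp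
qed

lemma lop_id: "lop N (\<lambda>v. v)"
  by (simp add: lop_def oper_id)

lemma off_upd: "off N g \<Longrightarrow> a \<in> {1..N} \<Longrightarrow> g (I(a := j)) = g I"
  unfolding off_def by auto

lemma ov_upd: "a \<in> {1..N} \<Longrightarrow> ov N K (I(a := j)) = (ov N K I)(a := j)"
  by (auto simp: ov_def)

lemma ov_in: "a \<in> {1..N} \<Longrightarrow> ov N K I a = I a"
  by (auto simp: ov_def)

lemma lop_op1:
  fixes M :: "nat \<Rightarrow> nat \<Rightarrow> 'a::ring_1"
  assumes a: "a \<in> {1..N}"
  shows "lop N (op1 N a M)"
  unfolding lop_def
proof (intro conjI allI impI)
  fix v g :: "(nat \<Rightarrow> nat) \<Rightarrow> 'a" assume "off N g"
  then have "g (I(a := j)) = g I" for I j using a by (rule off_upd)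
  then show "op1 N a M (\<lambda>I. v I * g I) = (\<lambda>I. op1 N a M v I * g I)"
    by (auto simp: op1_def fun_eq_iff sum_distrib_right mult.assoc)
next
  fix v :: "(nat \<Rightarrow> nat) \<Rightarrow> 'a" and K I assume "K (0::nat) \<in> {1..N}" "grd N I"
  then show "op1 N a M (\<lambda>J. v (ov N K J)) I = op1 N a M v (ov N K I)"
    by (simp add: op1_def ov_upd[OF a] ov_in[OF a] grd_ov)
qed (rule oper_op1)

lemma lop_op2:
  fixes X :: "nat \<Rightarrow> nat \<Rightarrow> nat \<Rightarrow> nat \<Rightarrow> 'a::ring_1"
  assumes a: "a \<in> {1..N}" and b: "b \<in> {1..N}"
  shows "lop N (op2 N a b X)"
  unfolding lop_def
proof (intro conjI allI impI)
  fix v g :: "(nat \<Rightarrow> nat) \<Rightarrow> 'a" assume "off N g"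
  then have "g (I(a := j, b := l)) = g I" for I j l
    using off_upd[of N g a I j] off_upd[of N g b "I(a := j)" l] a b by simp
  then show "op2 N a b X (\<lambda>I. v I * g I) = (\<lambda>I. op2 N a b X v I * g I)"
    by (auto simp: op2_def fun_eq_iff sum_distrib_right mult.assoc)
next
  fix v :: "(nat \<Rightarrow> nat) \<Rightarrow> 'a" and K I assume "K (0::nat) \<in> {1..N}" "grd N I"
  then show "op2 N a b X (\<lambda>J. v (ov N K J)) I = op2 N a b X v (ov N K I)"
    by (simp add: op2_def ov_upd[OF a] ov_in[OF a] ov_upd[OF b] ov_in[OF b] grd_ov)
qed (rule oper_op2)

section \<open>The q-antisymmetrizer\<close>

definition Pcoef :: "'k::field \<Rightarrow> nat \<Rightarrow> nat \<Rightarrow> 'k" where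
  "Pcoef q i k = (if i = k then 1 else if i > k then q else inverse q)"

definition Pm :: "'k::field \<Rightarrow> nat \<Rightarrow> nat \<Rightarrow> nat \<Rightarrow> nat \<Rightarrow> 'k" where
  "Pm q i j k l = Pcoef q i k * of_bool (j = k) * of_bool (l = i)"

abbreviation adj :: "nat \<Rightarrow> nat \<Rightarrow> nat" where
  "adj i \<equiv> Transposition.transpose i (Suc i)"

text \<open>The sorted word 1, ..., N with the outer coordinates of \<open>I\<close> kept. On the
  grid, \<open>I\<close> is recovered from it by composing with \<open>word_perm\<close>.\<close>

definition base :: "nat \<Rightarrow> (nat \<Rightarrow> nat) \<Rightarrow> nat \<Rightarrow> nat" where
  "base N I = ov N I id"

definition word_perm :: "nat \<Rightarrow> (nat \<Rightarrow> nat) \<Rightarrow> nat \<Rightarrow> nat" where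
  "word_perm N I = (\<lambda>c. if c \<in> {1..N} then I c else c)"

lemma permutes_grd:
  assumes "\<sigma> permutes {1..N}" "grd N I"
  shows "grd N (I \<circ> \<sigma>)"
  unfolding grd_def
proof (intro allI impI)
  fix c assume "c \<le> N"
  have "\<sigma> c \<le> N"
    using assms(1) \<open>c \<le> N\<close> permutes_in_image[OF assms(1), of c] permutes_not_in[OF assms(1), of c]
    by (cases "c \<in> {1..N}") auto
  then show "(I \<circ> \<sigma>) c \<in> {1..N}" using assms(2) by (simp add: grd_def)
qed

lemma permutes_off:
  assumes "\<sigma> permutes {1..N}" "off N g"
  shows "g (I \<circ> \<sigma>) = g I"
  using assms permutes_not_in[OF assms(1)] unfolding off_def by simp

lemma permutes_ov:
  assumes "\<sigma> permutes {1..N}"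
  shows "ov N K I \<circ> \<sigma> = ov N K (I \<circ> \<sigma>)"
  using permutes_in_image[OF assms] permutes_not_in[OF assms] by (auto simp: ov_def fun_eq_iff)

lemma inversions_ov: "inversions N (ov N K I) = inversions N I"
  by (rule inversions_cong) (simp add: ov_def)

lemma permutes_adj: "1 \<le> i \<Longrightarrow> i < N \<Longrightarrow> adj i permutes {1..N}"
  by (rule permutes_swap_id) auto

lemma sign_comp_permutes:
  assumes "\<sigma> permutes {1..N::nat}" "\<tau> permutes {1..N}"
  shows "sign (\<sigma> \<circ> \<tau>) = sign \<sigma> * sign \<tau>"
  using assms by (intro sign_compose permutes_imp_permutation[of "{1..N}"]) auto

lemma base_grd:
  assumes "grd N I"
  shows "grd N (base N I)"
  unfolding grd_def
proof (intro allI impI)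
  fix c assume "c \<le> N"
  then show "base N I c \<in> {1..N}"
    using grdD[OF assms, of c] by (cases "c \<in> {1..N}") (auto simp: base_def ov_def)
qed

lemma word_perm_permutes:
  assumes "grd N I" "inj_on I {1..N}"
  shows "word_perm N I permutes {1..N}"
proof -
  have "I ` {1..N} \<subseteq> {1..N}" using grdD[OF assms(1)] by (intro image_subsetI) simp
  with assms(2) have "bij_betw I {1..N} {1..N}"
    by (simp add: bij_betw_def endo_inj_surj)
  then have "bij_betw (word_perm N I) {1..N} {1..N}"
    by (rule bij_betw_cong[THEN iffD1, rotated]) (simp add: word_perm_def)
  then show ?thesis by (rule bij_imp_permutes) (auto simp: word_perm_def)
qed

lemma base_word_perm:
  assumes "grd N I"
  shows "base N I \<circ> word_perm N I = I"
proof
  fix c show "(base N I \<circ> word_perm N I) c = I c"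
    using grdD[OF assms, of c] by (cases "c \<in> {1..N}") (auto simp: base_def ov_def word_perm_def)
qed

locale antisymmetrizer = scalar_embedding \<iota> for \<iota> :: "'k::field_char_0 \<Rightarrow> 'a::ring_1" +
  fixes N :: nat and q :: 'k
  assumes q0: "q \<noteq> 0" and N1: "N \<ge> 1"
begin

text \<open>Closed form of P^q_sigma: the plain permutation of positions conjugated by the diagonal
  operator q^inversions. Multiplicativity in \<open>\<sigma>\<close> is then immediate.\<close>

definition Pp :: "(nat \<Rightarrow> nat) \<Rightarrow> ((nat \<Rightarrow> nat) \<Rightarrow> 'a) \<Rightarrow> (nat \<Rightarrow> nat) \<Rightarrow> 'a" where
  "Pp \<sigma> v I = (if grd N I then \<iota> (q powi (inversions N I - inversions N (I \<circ> \<sigma>))) * v (I \<circ> \<sigma>) else 0)"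

definition A :: "((nat \<Rightarrow> nat) \<Rightarrow> 'a) \<Rightarrow> (nat \<Rightarrow> nat) \<Rightarrow> 'a" where
  "A v I = (\<Sum>\<sigma> | \<sigma> permutes {1..N}. \<iota> (of_int (sign \<sigma>)) * Pp \<sigma> v I)"

definition P :: "nat \<Rightarrow> ((nat \<Rightarrow> nat) \<Rightarrow> 'a) \<Rightarrow> (nat \<Rightarrow> nat) \<Rightarrow> 'a" where
  "P i = op2 N i (Suc i) (\<lambda>a b c d. \<iota> (Pm q a b c d))"

lemma Pp_comp:
  assumes "\<sigma> permutes {1..N}"
  shows "Pp \<sigma> (Pp \<tau> v) = Pp (\<sigma> \<circ> \<tau>) v"
  by (auto simp: Pp_def fun_eq_iff permutes_grd[OF assms] \<iota>_\<iota> power_int_add[OF disjI1[OF q0], symmetric] o_assoc)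

lemma P_eq_Pp:
  assumes "1 \<le> i" "i < N"
  shows "P i v = Pp (adj i) v"
proof
  fix I
  show "P i v I = Pp (adj i) v I"
  proof (cases "grd N I")
    case True
    have V: "I i \<in> {1..N}" "I (Suc i) \<in> {1..N}" using grdD[OF True] assms by auto
    have *: "\<iota> (c * of_bool x * of_bool y) * w = of_bool x * (of_bool y * (\<iota> c * w))" for c x y w
      by (cases x; cases y) (simp_all add: \<iota>_zero)
    have "P i v I = (\<Sum>j=1..N. of_bool (j = I (Suc i)) * (\<Sum>l=1..N. of_bool (l = I i) *
        (\<iota> (Pcoef q (I i) (I (Suc i))) * v (I(i := j, Suc i := l)))))"
      unfolding P_def op2_def Pm_def sum_distrib_left using True by (simp only: if_True * )
    also have "\<dots> = \<iota> (Pcoef q (I i) (I (Suc i))) * v (I(i := I (Suc i), Suc i := I i))"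
      by (simp only: sum_of_bool_mult finite_atLeastAtMost V)
    also have "I(i := I (Suc i), Suc i := I i) = I \<circ> adj i"
      by (auto simp: fun_eq_iff Transposition.transpose_def)
    also have "Pcoef q (I i) (I (Suc i)) = q powi (inversions N I - inversions N (I \<circ> adj i))"
      using inversions_swap[OF assms, of I] by (simp add: Pcoef_def power_int_minus)
    finally show ?thesis using True by (simp only: Pp_def if_True)
  qed (simp add: P_def op2_def Pp_def)
qed

lemma A_Pp:
  assumes \<tau>: "\<tau> permutes {1..N}"
  shows "A (Pp \<tau> v) = (\<lambda>I. \<iota> (of_int (sign \<tau>)) * A v I)"
proof
  fix I
  have "A (Pp \<tau> v) I = (\<Sum>\<sigma> | \<sigma> permutes {1..N}. \<iota> (of_int (sign \<sigma>)) * Pp (\<sigma> \<circ> \<tau>) v I)"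
    unfolding A_def by (intro sum.cong refl) (simp add: Pp_comp)
  also have "\<dots> = (\<Sum>\<sigma> | \<sigma> permutes {1..N}. \<iota> (of_int (sign \<tau>)) * (\<iota> (of_int (sign \<sigma>)) * Pp \<sigma> v I))"
  proof (rule sum.reindex_bij_witness[of _ "\<lambda>\<sigma>. \<sigma> \<circ> inv_into UNIV \<tau>" "\<lambda>\<sigma>. \<sigma> \<circ> \<tau>"])
    fix \<sigma> assume "\<sigma> \<in> {\<sigma>. \<sigma> permutes {1..N}}"
    then have \<sigma>: "\<sigma> permutes {1..N}" by simp
    show "\<iota> (of_int (sign \<tau>)) * (\<iota> (of_int (sign (\<sigma> \<circ> \<tau>))) * Pp (\<sigma> \<circ> \<tau>) v I) = \<iota> (of_int (sign \<sigma>)) * Pp (\<sigma> \<circ> \<tau>) v I"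
      by (simp add: sign_comp_permutes[OF \<sigma> \<tau>] \<iota>_\<iota> mult.commute[of "sign \<sigma>"] flip: of_int_mult)
  qed (use \<tau> in \<open>auto simp: permutes_inv_o o_assoc[symmetric] intro: permutes_compose permutes_inv\<close>)
  finally show "A (Pp \<tau> v) I = \<iota> (of_int (sign \<tau>)) * A v I"
    unfolding A_def by (simp add: sum_distrib_left)
qed

lemma A_P:
  assumes "1 \<le> i" "i < N"
  shows "A (P i v) = (\<lambda>I. - A v I)"
  unfolding P_eq_Pp[OF assms] A_Pp[OF permutes_adj[OF assms]] by (simp add: sign_swap_id \<iota>_minus \<iota>_one)

lemma Pp_not_grd: "\<not> grd N I \<Longrightarrow> Pp \<sigma> v I = 0"
  by (simp add: Pp_def)

lemma A_not_grd: "\<not> grd N I \<Longrightarrow> A v I = 0"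
  by (simp add: A_def Pp_not_grd)

lemma lop_Pp:
  assumes "\<sigma> permutes {1..N}"
  shows "lop N (Pp \<sigma>)"
  unfolding lop_def oper_def cutoff_def
proof (intro conjI allI impI)
  fix v g :: "(nat \<Rightarrow> nat) \<Rightarrow> 'a" assume "off N g"
  then have "g (I \<circ> \<sigma>) = g I" for I using permutes_off[OF assms] by blast
  then show "Pp \<sigma> (\<lambda>I. v I * g I) = (\<lambda>I. Pp \<sigma> v I * g I)"
    by (auto simp: Pp_def fun_eq_iff mult.assoc)
next
  fix v :: "(nat \<Rightarrow> nat) \<Rightarrow> 'a" and K I assume "K (0::nat) \<in> {1..N}" "grd N I"
  then show "Pp \<sigma> (\<lambda>J. v (ov N K J)) I = Pp \<sigma> v (ov N K I)"
    by (simp add: Pp_def permutes_ov[OF assms] grd_ov inversions_ov)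
qed (auto simp: fun_eq_iff Pp_def distrib_left mult.assoc permutes_grd[OF assms])

lemma lop_A: "lop N A"
proof -
  have L: "lop N (Pp \<sigma>)" if "\<sigma> \<in> {\<sigma>. \<sigma> permutes {1..N}}" for \<sigma> using lop_Pp that by simp
  have O: "oper N (Pp \<sigma>)" if "\<sigma> \<in> {\<sigma>. \<sigma> permutes {1..N}}" for \<sigma> using L[OF that] lop_oper by blast
  show ?thesis
    unfolding lop_def oper_def
  proof (intro conjI allI impI)
    fix v w :: "(nat \<Rightarrow> nat) \<Rightarrow> 'a"
    show "A (\<lambda>I. v I + w I) = (\<lambda>I. A v I + A w I)"
      unfolding A_def sum.distrib[symmetric] distrib_left[symmetric]
      by (intro ext sum.cong refl) (simp add: oper_add[OF O])
  next
    fix v :: "(nat \<Rightarrow> nat) \<Rightarrow> 'a" and c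
    show "A (\<lambda>I. v I * c) = (\<lambda>I. A v I * c)"
      unfolding A_def sum_distrib_right
      by (intro ext sum.cong refl) (simp add: oper_scale[OF O] mult.assoc)
  next
    fix v :: "(nat \<Rightarrow> nat) \<Rightarrow> 'a"
    show "A (cutoff N v) = cutoff N (A v)"
      by (intro ext) (auto simp: A_def Pp_def cutoff_def permutes_grd intro!: sum.cong)
  next
    fix v g :: "(nat \<Rightarrow> nat) \<Rightarrow> 'a" assume g: "off N g"
    show "A (\<lambda>I. v I * g I) = (\<lambda>I. A v I * g I)"
      unfolding A_def sum_distrib_right
      by (intro ext sum.cong refl) (simp add: lop_off[OF L g] mult.assoc)
  next
    fix v :: "(nat \<Rightarrow> nat) \<Rightarrow> 'a" and K I assume K: "K (0::nat) \<in> {1..N}" "grd N I"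
    show "A (\<lambda>J. v (ov N K J)) I = A v (ov N K I)"
      unfolding A_def by (intro sum.cong refl) (simp add: lop_ov[where K = K, OF L K])
  qed
qed

lemma oper_A: "oper N A"
  using lop_A lop_oper by blast

lemma A_cutoff: "A (cutoff N v) = A v"
  using oper_cutoff[OF oper_A, of v] by (auto simp: cutoff_def fun_eq_iff A_not_grd)

text \<open>Factoring sigma into adjacent transpositions gives B P^q_sigma = sgn(sigma) B, so each
  of the N! summands of \<open>A\<close> contributes B itself.\<close>

lemma antisym_A:
  assumes B: "oper N B" and cut: "\<And>v. B (cutoff N v) = B v"
    and anti: "\<And>i v. 1 \<le> i \<Longrightarrow> i < N \<Longrightarrow> B (P i v) = (\<lambda>I. - B v I)"
  shows "B (A v) = (\<lambda>I. \<iota> (of_nat (fact N)) * B v I)"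
proof -
  have word: "B (Pp (apply_adj_transps ws) v) = (\<lambda>I. \<iota> (of_int (sign (apply_adj_transps ws))) * B v I)"
    if "set ws \<subseteq> {1..<N}" for ws v
    using that
  proof (induction ws)
    case Nil
    \<comment> \<open>The empty word acts as the cutoff, which is where the hypothesis
      \<open>cut\<close> enters.\<close>
    have "Pp id v = cutoff N v" for v by (auto simp: Pp_def cutoff_def \<iota>_one)
    with cut show ?case by (simp only: apply_adj_transps_Nil sign_id of_int_1 \<iota>_one mult_1_left)
  next
    case (Cons i ws)
    then have i: "1 \<le> i" "i < N" and ws: "set ws \<subseteq> {1..<N}" by auto
    have p: "apply_adj_transps ws permutes {1..N}"
      using ws by (intro permutes_apply_adj_transps) auto
    have "B (Pp (apply_adj_transps (i # ws)) v) = B (P i (Pp (apply_adj_transps ws) v))"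
      by (simp add: P_eq_Pp[OF i] Pp_comp[OF permutes_adj[OF i]])
    also have "\<dots> = (\<lambda>I. - (\<iota> (of_int (sign (apply_adj_transps ws))) * B v I))"
      unfolding anti[OF i] Cons.IH[OF ws] ..
    also have "\<dots> = (\<lambda>I. \<iota> (of_int (sign (apply_adj_transps (i # ws)))) * B v I)"
      using sign_comp_permutes[OF permutes_adj[OF i] p] by (simp add: sign_swap_id \<iota>_minus)
    finally show ?case .
  qed
  have BP: "B (Pp \<sigma> v) = (\<lambda>I. \<iota> (of_int (sign \<sigma>)) * B v I)" if "\<sigma> permutes {1..N}" for \<sigma>
    using adjacent_factorization[OF that] word by blast
  have "B (A v) = B (\<lambda>I. \<Sum>\<sigma> | \<sigma> permutes {1..N}. \<iota> (of_int (sign \<sigma>)) * Pp \<sigma> v I)"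
    by (simp add: A_def[abs_def])
  also have "\<dots> = (\<lambda>I. \<Sum>\<sigma> | \<sigma> permutes {1..N}. \<iota> (of_int (sign \<sigma>)) * B (Pp \<sigma> v) I)"
    by (simp add: oper_sum[OF B] oper_\<iota>[OF B])
  also have "\<dots> = (\<lambda>I. \<Sum>\<sigma> | \<sigma> permutes {1..N}. B v I)"
    by (intro ext sum.cong refl) (simp add: BP \<iota>_\<iota> \<iota>_one flip: of_int_mult)
  also have "\<dots> = (\<lambda>I. \<iota> (of_nat (fact N)) * B v I)"
    unfolding sum_constant \<iota>_of_nat using card_permutations[of "{1..N}" N] by simp
  finally show ?thesis .
qed

text \<open>The q-analogue of the Levi-Civita symbol, normalized to 1 at the sorted word; for fixed
  outer coordinates it spans the image of \<open>A\<close>.\<close>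

definition eps :: "(nat \<Rightarrow> nat) \<Rightarrow> 'k" where
  "eps I = (if grd N I \<and> inj_on I {1..N}
     then of_int (sign (word_perm N I)) * q powi (inversions N I - inversions N (base N I)) else 0)"

text \<open>A transposition of two equal entries fixes \<open>I\<close>, and composing with it flips
  the sign of every summand. So the value equals its own negative, and 2 is invertible.\<close>

lemma A_not_inj:
  assumes "\<not> inj_on I {1..N}"
  shows "A v I = 0"
proof (cases "grd N I")
  case True
  obtain p r where pr: "p \<in> {1..N}" "r \<in> {1..N}" "p \<noteq> r" "I p = I r"
    using assms by (auto simp: inj_on_def)
  let ?t = "Transposition.transpose p r"
  have t: "?t permutes {1..N}" using pr by (intro permutes_swap_id)
  have It: "I \<circ> ?t = I" using pr by (auto simp: fun_eq_iff Transposition.transpose_def)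
  have "A v I = (\<Sum>\<sigma> | \<sigma> permutes {1..N}. - (\<iota> (of_int (sign \<sigma>)) * Pp \<sigma> v I))"
    unfolding A_def
  proof (rule sum.reindex_bij_witness[of _ "\<lambda>\<sigma>. ?t \<circ> \<sigma>" "\<lambda>\<sigma>. ?t \<circ> \<sigma>"])
    fix \<sigma> assume "\<sigma> \<in> {\<sigma>. \<sigma> permutes {1..N}}"
    then have \<sigma>: "\<sigma> permutes {1..N}" by simp
    have "Pp (?t \<circ> \<sigma>) v I = Pp \<sigma> v I" by (simp add: Pp_def o_assoc It)
    then show "- (\<iota> (of_int (sign (?t \<circ> \<sigma>))) * Pp (?t \<circ> \<sigma>) v I) = \<iota> (of_int (sign \<sigma>)) * Pp \<sigma> v I"
      using pr by (simp add: sign_comp_permutes[OF t \<sigma>] sign_swap_id \<iota>_minus)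
  qed (use t in \<open>auto simp: o_assoc intro: permutes_compose\<close>)
  then have "A v I = - A v I" unfolding A_def sum_negf .
  then have "\<iota> 2 * A v I = \<iota> 2 * 0"
    using \<iota>_of_nat[of 2] by (simp add: mult_2 eq_neg_iff_add_eq_0)
  then show ?thesis by (rule \<iota>_cancel) simp
qed (simp add: A_not_grd)

text \<open>On the grid with distinct entries, \<open>I\<close> is the sorted word composed with a
  permutation tau; reindexing the sum by tau only produces sgn(tau) and a power of q.\<close>

lemma A_rank_one: "A v I = \<iota> (eps I) * A v (base N I)"
proof (cases "grd N I \<and> inj_on I {1..N}")
  case True
  then have I: "grd N I" "inj_on I {1..N}" by auto
  define \<tau> where "\<tau> = word_perm N I"
  have \<tau>: "\<tau> permutes {1..N}" unfolding \<tau>_def by (rule word_perm_permutes[OF I])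
  have b: "base N I \<circ> \<tau> = I" unfolding \<tau>_def by (rule base_word_perm[OF I(1)])
  have bg: "grd N (base N I)" by (rule base_grd[OF I(1)])
  have "A v (base N I) = (\<Sum>\<sigma> | \<sigma> permutes {1..N}. \<iota> (of_int (sign \<tau>) * q powi (inversions N (base N I) - inversions N I)) * (\<iota> (of_int (sign \<sigma>)) * Pp \<sigma> v I))"
    unfolding A_def
  proof (rule sum.reindex_bij_witness[of _ "\<lambda>\<sigma>. \<tau> \<circ> \<sigma>" "\<lambda>\<sigma>. inv_into UNIV \<tau> \<circ> \<sigma>"])
    fix \<sigma> assume "\<sigma> \<in> {\<sigma>. \<sigma> permutes {1..N}}"
    then have "inv_into UNIV \<tau> \<circ> \<sigma> permutes {1..N}" using \<tau> by (auto intro: permutes_compose permutes_inv)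
    then have s: "sign \<sigma> = sign \<tau> * sign (inv_into UNIV \<tau> \<circ> \<sigma>)"
      using sign_comp_permutes[OF \<tau>, of "inv_into UNIV \<tau> \<circ> \<sigma>"] \<tau> by (simp add: o_assoc permutes_inv_o)
    have "I \<circ> (inv_into UNIV \<tau> \<circ> \<sigma>) = base N I \<circ> \<sigma>"
      using b \<tau> by (metis o_assoc permutes_inv_o(1) comp_id)
    then show "\<iota> (of_int (sign \<tau>) * q powi (inversions N (base N I) - inversions N I)) *
        (\<iota> (of_int (sign (inv_into UNIV \<tau> \<circ> \<sigma>))) * Pp (inv_into UNIV \<tau> \<circ> \<sigma>) v I) = \<iota> (of_int (sign \<sigma>)) * Pp \<sigma> v (base N I)"
      unfolding s using bg I(1) by (simp add: Pp_def \<iota>_\<iota> mult_ac power_int_add[OF disjI1[OF q0], symmetric])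
  qed (use \<tau> in \<open>auto simp: o_assoc permutes_inv_o intro: permutes_compose permutes_inv\<close>)
  then have *: "A v (base N I) = \<iota> (of_int (sign \<tau>) * q powi (inversions N (base N I) - inversions N I)) * A v I"
    by (simp add: A_def sum_distrib_left)
  have "eps I = of_int (sign \<tau>) * q powi (inversions N I - inversions N (base N I))"
    using True by (simp add: eps_def \<tau>_def)
  then have "eps I * (of_int (sign \<tau>) * q powi (inversions N (base N I) - inversions N I))
    = of_int (sign \<tau> * sign \<tau>) * q powi (inversions N I - inversions N (base N I) + (inversions N (base N I) - inversions N I))"
    unfolding power_int_add[OF disjI1[OF q0]] of_int_mult by (simp only: mult_ac)
  then have "eps I * (of_int (sign \<tau>) * q powi (inversions N (base N I) - inversions N I)) = 1"
    unfolding sign_idempotent by simp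
  then show ?thesis by (simp only: * \<iota>_\<iota> \<iota>_one mult_1_left)
next
  case False
  then show ?thesis using A_not_inj A_not_grd by (auto simp: eps_def \<iota>_zero)
qed

lemma A_cong:
  assumes "\<And>J. grd N J \<Longrightarrow> inj_on J {1..N} \<Longrightarrow> v J = w J"
  shows "A v = A w"
proof
  fix I
  show "A v I = A w I"
  proof (cases "grd N I \<and> inj_on I {1..N}")
    case True
    have "v (I \<circ> \<sigma>) = w (I \<circ> \<sigma>)" if \<sigma>: "\<sigma> permutes {1..N}" for \<sigma>
    proof (rule assms)
      show "grd N (I \<circ> \<sigma>)" using True \<sigma> by (auto intro: permutes_grd)
      show "inj_on (I \<circ> \<sigma>) {1..N}"
        using True by (intro comp_inj_on permutes_inj_on[OF \<sigma>]) (simp only: permutes_image[OF \<sigma>])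
    qed
    then show ?thesis by (auto simp: A_def Pp_def intro!: sum.cong)
  next
    case False
    then show ?thesis using A_not_inj A_not_grd by auto
  qed
qed

lemma base_off: "off N (\<lambda>I. A v (base N I))"
  unfolding off_def base_def ov_def by (intro allI impI) (rule arg_cong[where f = "A v"], auto)

lemma base_ov: "ov N K (base N I) = base N K"
  by (auto simp: base_def ov_def)

lemma eps_ov:
  assumes "grd N J" "K 0 \<in> {1..N}"
  shows "eps (ov N K J) = eps J"
proof -
  have "inj_on (ov N K J) {1..N} = inj_on J {1..N}"
    by (rule inj_on_cong) (simp add: ov_def)
  moreover have "word_perm N (ov N K J) = word_perm N J"
    by (auto simp: word_perm_def ov_def)
  moreover have "inversions N (base N (ov N K J)) = inversions N (base N J)"
    by (rule inversions_cong) (simp add: base_def ov_def)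
  ultimately show ?thesis
    using assms grd_ov[of K N J] by (simp add: eps_def inversions_ov)
qed

text \<open>A v is \<open>eps\<close> times a function of the outer coordinates. The local operator
  B = A X treats this function as a constant, so B(A v) is B \<open>eps\<close> times it; and B
  \<open>eps\<close>, lying in the image of \<open>A\<close>, is again a multiple of
  \<open>eps\<close>. Since B A = N! B, this determines B.\<close>

lemma local_scalar:
  assumes X: "lop N X"
    and anti: "\<And>i v. 1 \<le> i \<Longrightarrow> i < N \<Longrightarrow> A (X (P i v)) = (\<lambda>I. - A (X v) I)"
  shows "\<exists>f. \<forall>v. A (X v) = (\<lambda>I. f * A v I)"
proof -
  let ?B = "\<lambda>v. A (X v)" and ?e = "\<lambda>J. \<iota> (eps J)"
  have B: "lop N ?B" by (rule lop_comp[OF lop_A X])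
  have cut: "?B (cutoff N v) = ?B v" for v
    by (simp add: oper_cutoff[OF lop_oper[OF X]] A_cutoff)
  \<comment> \<open>An arbitrary fixed choice of outer coordinates: locality shows that the factor
    \<open>h\<close> computed there is the same for all \<open>I\<close>.\<close>
  define K :: "nat \<Rightarrow> nat" where "K = (\<lambda>c. 1)"
  have K: "K 0 \<in> {1..N}" using N1 by (simp add: K_def)
  define h where "h = ?B ?e (base N K)"
  have h: "?B ?e (base N I) = h" if I: "grd N I" for I
  proof -
    have "?B ?e = ?B (\<lambda>J. ?e (ov N K J))"
    proof -
      have "cutoff N ?e = cutoff N (\<lambda>J. ?e (ov N K J))"
        using eps_ov[where K = K, OF _ K] by (auto simp: cutoff_def)
      then show ?thesis using cut[of ?e] cut[of "\<lambda>J. ?e (ov N K J)"] by simp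
    qed
    then have "?B ?e (base N I) = ?B ?e (ov N K (base N I))"
      using lop_ov[where K = K, OF B K base_grd[OF I], of ?e] by simp
    then show ?thesis by (simp add: h_def base_ov)
  qed
  have "\<iota> (of_nat (fact N)) * ?B v I = h * A v I" for v I
  proof (cases "grd N I")
    case True
    have "\<iota> (of_nat (fact N)) * ?B v I = ?B (A v) I"
      using antisym_A[OF lop_oper[OF B] cut anti] by simp
    also have "A v = (\<lambda>J. ?e J * A v (base N J))"
      by (rule ext) (rule A_rank_one)
    also have "?B (\<lambda>J. ?e J * A v (base N J)) I = ?B ?e I * A v (base N I)"
      by (simp only: lop_off[OF B base_off])
    also have "?B ?e I = ?e I * h"
      using A_rank_one[of "X ?e" I] h[OF True] by simp
    also have "?e I * h * A v (base N I) = h * A v I"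
      unfolding A_rank_one[of v I] mult.assoc by (rule \<iota>_left_commute[symmetric])
    finally show ?thesis .
  qed (simp add: A_not_grd)
  then have e: "\<iota> (of_nat (fact N)) * ?B v I = h * A v I" for v I .
  have "?B v I = (\<iota> (1 / of_nat (fact N)) * h) * A v I" for v I
    by (rule \<iota>_cancel[of "of_nat (fact N)"], unfold e)
      (simp_all add: mult.assoc[symmetric] \<iota>_mult[symmetric] \<iota>_one)
  then show ?thesis by auto
qed

end

lemma (in scalar_embedding) sum_\<iota>_of_bool2:
  fixes V :: "nat set"
  assumes "finite V" "a \<in> V" "b \<in> V"
  shows "(\<Sum>m\<in>V. \<Sum>p\<in>V. \<iota> (c * (of_bool (m = a) * of_bool (p = b))) * w m p) = \<iota> c * w a b"
proof -
  have *: "\<iota> (c * (of_bool x * of_bool y)) * z = of_bool x * (of_bool y * (\<iota> c * z))" for x y z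
    by (cases x; cases y) (simp_all add: \<iota>_zero)
  have "(\<Sum>m\<in>V. \<Sum>p\<in>V. \<iota> (c * (of_bool (m = a) * of_bool (p = b))) * w m p)
     = (\<Sum>m\<in>V. of_bool (m = a) * (\<Sum>p\<in>V. of_bool (p = b) * (\<iota> c * w m p)))"
    unfolding sum_distrib_left * ..
  also have "\<dots> = \<iota> c * w a b"
    by (simp only: sum_of_bool_mult assms)
  finally show ?thesis .
qed

lemma (in scalar_embedding) sum_\<iota>_Rm:
  assumes "finite V" "i \<in> V" "k \<in> V"
  shows "(\<Sum>m\<in>V. \<Sum>p\<in>V. \<iota> (Rm q x y i m k p) * w m p) = \<iota> (rdiag q x y i k) * w i k + \<iota> (rexch q x y i k) * w k i"
  unfolding Rm_def \<iota>_add distrib_right sum.distrib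
  by (simp only: sum_\<iota>_of_bool2 assms)

text \<open>Unlike R, its partial transpose couples a diagonal index (k, k) to all diagonal indices
  (j, j), whence the remaining sum.\<close>

lemma (in scalar_embedding) sum_\<iota>_Rt:
  assumes "finite V" "i \<in> V" "k \<in> V"
  shows "(\<Sum>m\<in>V. \<Sum>p\<in>V. \<iota> (Rt q x y i m k p) * w m p)
    = \<iota> (rdiag q x y i k) * w i k + (if i = k then \<Sum>j\<in>V. \<iota> (rexch q x y j k) * w j j else 0)"
proof -
  have "(\<Sum>m\<in>V. \<Sum>p\<in>V. \<iota> (Rt q x y i m k p) * w m p)
     = (\<Sum>m\<in>V. \<Sum>p\<in>V. \<iota> (rdiag q x y i k * (of_bool (m = i) * of_bool (p = k))) * w m p)
     + (\<Sum>m\<in>V. \<Sum>p\<in>V. of_bool (p = m) * (of_bool (i = k) * (\<iota> (rexch q x y m k) * w m p)))"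
    unfolding sum.distrib[symmetric] Rt_def Rm_def
    by (intro sum.cong refl) (auto simp: \<iota>_zero \<iota>_add distrib_right)
  also have "(\<Sum>m\<in>V. \<Sum>p\<in>V. of_bool (p = m) * (of_bool (i = k) * (\<iota> (rexch q x y m k) * w m p)))
     = (\<Sum>m\<in>V. of_bool (i = k) * (\<iota> (rexch q x y m k) * w m m))"
    using assms(1) by (intro sum.cong refl sum_of_bool_mult)
  finally show ?thesis by (simp add: sum_\<iota>_of_bool2 assms)
qed

lemma (in antisymmetrizer) Pp_A:
  assumes \<tau>: "\<tau> permutes {1..N}"
  shows "Pp \<tau> (A v) = (\<lambda>I. \<iota> (of_int (sign \<tau>)) * A v I)"
proof
  fix I
  have "Pp \<tau> (A v) I = (\<Sum>\<sigma> | \<sigma> permutes {1..N}. \<iota> (of_int (sign \<sigma>)) * Pp (\<tau> \<circ> \<sigma>) v I)"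
  proof -
    have o: "oper N (Pp \<tau>)" using lop_Pp[OF \<tau>] lop_oper by blast
    show ?thesis
      unfolding A_def[abs_def] by (simp add: oper_sum[OF o] oper_\<iota>[OF o] Pp_comp[OF \<tau>])
  qed
  also have "\<dots> = (\<Sum>\<sigma> | \<sigma> permutes {1..N}. \<iota> (of_int (sign \<tau>)) * (\<iota> (of_int (sign \<sigma>)) * Pp \<sigma> v I))"
  proof (rule sum.reindex_bij_witness[of _ "\<lambda>\<sigma>. inv_into UNIV \<tau> \<circ> \<sigma>" "\<lambda>\<sigma>. \<tau> \<circ> \<sigma>"])
    fix \<sigma> assume "\<sigma> \<in> {\<sigma>. \<sigma> permutes {1..N}}"
    then have \<sigma>: "\<sigma> permutes {1..N}" by simp
    show "\<iota> (of_int (sign \<tau>)) * (\<iota> (of_int (sign (\<tau> \<circ> \<sigma>))) * Pp (\<tau> \<circ> \<sigma>) v I) = \<iota> (of_int (sign \<sigma>)) * Pp (\<tau> \<circ> \<sigma>) v I"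
      by (simp add: sign_comp_permutes[OF \<tau> \<sigma>] \<iota>_\<iota> flip: of_int_mult)
  qed (use \<tau> in \<open>auto simp: permutes_inv_o o_assoc intro: permutes_compose permutes_inv\<close>)
  finally show "Pp \<tau> (A v) I = \<iota> (of_int (sign \<tau>)) * A v I"
    unfolding A_def by (simp add: sum_distrib_left)
qed

section \<open>Alternating operators and reduction to special vectors\<close>

context antisymmetrizer
begin

definition alternating :: "(((nat \<Rightarrow> nat) \<Rightarrow> 'a) \<Rightarrow> (nat \<Rightarrow> nat) \<Rightarrow> 'a) \<Rightarrow> bool" where
  "alternating B \<longleftrightarrow> oper N B \<and> (\<forall>v. B (cutoff N v) = B v)
     \<and> (\<forall>i v. 1 \<le> i \<longrightarrow> i < N \<longrightarrow> B (P i v) = (\<lambda>I. - B v I))"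

lemma alternating_A: "alternating A"
  unfolding alternating_def using oper_A A_cutoff A_P by blast

lemma alternating_mult_A:
  assumes "alternating B"
  shows "B (A v) = (\<lambda>I. \<iota> (of_nat (fact N)) * B v I)"
  by (rule antisym_A) (use assms in \<open>simp_all add: alternating_def\<close>)

lemma alternating_Pp:
  assumes "alternating B" "\<sigma> permutes {1..N}"
  shows "B (Pp \<sigma> v) = (\<lambda>I. \<iota> (of_int (sign \<sigma>)) * B v I)"
proof
  fix I
  have "\<iota> (of_nat (fact N)) * B (Pp \<sigma> v) I = B (A (Pp \<sigma> v)) I"
    by (simp add: alternating_mult_A[OF assms(1)])
  also have "\<dots> = \<iota> (of_int (sign \<sigma>)) * B (A v) I"
    using oper_\<iota>[of N B] assms(1) unfolding A_Pp[OF assms(2)] alternating_def by simp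
  also have "\<dots> = \<iota> (of_nat (fact N)) * (\<iota> (of_int (sign \<sigma>)) * B v I)"
    unfolding alternating_mult_A[OF assms(1)] by (rule \<iota>_left_commute)
  finally show "B (Pp \<sigma> v) I = \<iota> (of_int (sign \<sigma>)) * B v I"
    by (rule \<iota>_cancel) simp
qed

text \<open>An antisymmetric operator only sees the part of an antisymmetric vector on which the basis
  vector of the extra space \<open>0\<close> agrees with that of a prescribed space \<open>p\<close>.\<close>

lemma alternating_localize:
  assumes B: "alternating B" and p: "p \<in> {1..N}"
  shows "\<iota> (of_nat (fact N)) * B v I = \<iota> (of_nat N) * B (\<lambda>J. A v J * of_bool (J p = J 0)) I"
proof -
  have oB: "oper N B" using B by (simp add: alternating_def)
  let ?w = "\<lambda>p J. A v J * of_bool (J p = J 0)"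
  have eq: "B (?w r) I = B (?w p) I" if r: "r \<in> {1..N}" for r
  proof -
    \<comment> \<open>Up to its sign, this transposition turns the part of A v localized at p into
      the part localized at r, and B absorbs it with the same sign.\<close>
    let ?t = "Transposition.transpose p r"
    have t: "?t permutes {1..N}" using p r by (intro permutes_swap_id)
    have "Pp ?t (?w p) = (\<lambda>J. \<iota> (of_int (sign ?t)) * ?w r J)"
    proof
      fix J
      have "Pp ?t (?w p) J = Pp ?t (A v) J * of_bool (J r = J 0)"
        using p r by (auto simp: Pp_def mult.assoc Transposition.transpose_def)
      then show "Pp ?t (?w p) J = \<iota> (of_int (sign ?t)) * ?w r J"
        by (simp add: Pp_A[OF t] mult.assoc)
    qed
    then have "\<iota> (of_int (sign ?t)) * B (?w r) I = \<iota> (of_int (sign ?t)) * B (?w p) I"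
      using fun_cong[OF alternating_Pp[OF B t, of "?w p"], of I]
      by (simp only: oper_\<iota>[OF oB])
    then show ?thesis by (rule \<iota>_cancel) (simp add: sign_def)
  qed
  \<comment> \<open>Where A v can be nonzero, J takes each value in 1..N once on the spaces 1..N, so
    exactly one position agrees with J 0.\<close>
  have "A v = (\<lambda>J. \<Sum>r=1..N. ?w r J)"
  proof
    fix J
    show "A v J = (\<Sum>r=1..N. ?w r J)"
    proof (cases "grd N J \<and> inj_on J {1..N}")
      case True
      then have "J ` {1..N} \<subseteq> {1..N}"
        using grdD[of N J] by (intro image_subsetI) simp
      with True have "J ` {1..N} = {1..N}"
        by (intro endo_inj_surj) simp_all
      moreover have "J 0 \<in> {1..N}" using True grdD[of N J 0] by simp
      ultimately obtain m where m: "m \<in> {1..N}" "J m = J 0" by (metis imageE)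
      have "(\<Sum>r=1..N. ?w r J) = (\<Sum>r=1..N. A v J * of_bool (r = m))"
      proof (intro sum.cong refl)
        fix r assume "r \<in> {1..N}"
        then have "J r = J m \<longleftrightarrow> r = m" using True m(1) by (intro inj_on_eq_iff) auto
        with m(2) show "?w r J = A v J * of_bool (r = m)" by simp
      qed
      also have "\<dots> = A v J"
        by (rule sum_of_bool_mult) (use m in auto)
      finally show ?thesis ..
    next
      case False
      then show ?thesis using A_not_inj A_not_grd by auto
    qed
  qed
  then have "B (A v) = B (\<lambda>J. \<Sum>r=1..N. ?w r J)" by (rule arg_cong)
  then have "B (A v) I = (\<Sum>r=1..N. B (?w r) I)"
    by (simp only: oper_sum[OF oB])
  also have "\<dots> = \<iota> (of_nat N) * B (?w p) I"
    by (simp add: eq \<iota>_of_nat)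
  finally show ?thesis by (simp add: alternating_mult_A[OF B])
qed

text \<open>Localization is applied twice, to A Z and to \<open>A\<close> itself; the factors N and
  N! appear in both and cancel. The scalar may thus be computed on vectors supported where spaces p
  and 0 agree.\<close>

lemma alternating_scalar:
  assumes Z: "alternating (\<lambda>v. A (Z v))" and p: "p \<in> {1..N}"
    and c: "\<And>w. (\<And>J. w J \<noteq> 0 \<Longrightarrow> grd N J \<and> inj_on J {1..N} \<and> J p = J 0) \<Longrightarrow> A (Z w) = (\<lambda>I. \<iota> c * A w I)"
  shows "A (Z v) = (\<lambda>I. \<iota> c * A v I)"
proof
  fix I
  let ?w = "\<lambda>J. A v J * of_bool (J p = J 0)"
  have "A (Z ?w) = (\<lambda>I. \<iota> c * A ?w I)"
  proof (rule c)
    fix J assume "?w J \<noteq> 0"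
    then have "A v J \<noteq> 0" "J p = J 0" by (cases "J p = J 0"; simp)+
    then show "grd N J \<and> inj_on J {1..N} \<and> J p = J 0"
      using A_not_inj[of J v] A_not_grd[of J v] by blast
  qed
  then have "\<iota> (of_nat (fact N)) * A (Z v) I = \<iota> (of_nat N) * (\<iota> c * A ?w I)"
    using alternating_localize[OF Z p, of v I] by simp
  also have "\<dots> = \<iota> c * (\<iota> (of_nat N) * A ?w I)"
    by (rule \<iota>_left_commute)
  also have "\<dots> = \<iota> (of_nat (fact N)) * (\<iota> c * A v I)"
    unfolding alternating_localize[OF alternating_A p, symmetric] by (rule \<iota>_left_commute)
  finally show "A (Z v) I = \<iota> c * A v I"
    by (rule \<iota>_cancel) simp
qed

text \<open>An injective word has trivial stabilizer, so only the identity contributes. The entry 1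
  is what later allows a factor standing next to \<open>A\<close> to be read off.\<close>

lemma A_delta:
  assumes "grd N K" "inj_on K {1..N}"
  shows "A (\<lambda>J. of_bool (J = K)) K = 1"
proof -
  have *: "K \<circ> \<sigma> = K \<longleftrightarrow> \<sigma> = id" if \<sigma>: "\<sigma> permutes {1..N}" for \<sigma>
  proof
    assume "K \<circ> \<sigma> = K"
    have "\<sigma> c = c" for c
      using inj_on_eq_iff[OF assms(2), of "\<sigma> c" c] permutes_in_image[OF \<sigma>, of c]
        permutes_not_in[OF \<sigma>, of c] fun_cong[OF \<open>K \<circ> \<sigma> = K\<close>, of c]
      by (cases "c \<in> {1..N}") auto
    then show "\<sigma> = id" by auto
  qed simp
  have "A (\<lambda>J. of_bool (J = K)) K = (\<Sum>\<sigma> | \<sigma> permutes {1..N}. of_bool (\<sigma> = id))"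
    unfolding A_def using assms(1) by (intro sum.cong refl) (auto simp: Pp_def * \<iota>_one)
  also have "\<dots> = (\<Sum>\<sigma> | \<sigma> permutes {1..N}. if \<sigma> = id then 1 else 0)"
    by (intro sum.cong) auto
  also have "\<dots> = 1"
    by (subst sum.delta) (auto simp: finite_permutations permutes_id)
  finally show ?thesis .
qed

lemma A_op1_commute: "A (op1 N 0 M v) = op1 N 0 M (A v)"
proof -
  have P: "Pp \<sigma> (op1 N 0 M v) = op1 N 0 M (Pp \<sigma> v)" if \<sigma>: "\<sigma> permutes {1..N}" for \<sigma>
  proof
    fix I :: "nat \<Rightarrow> nat"
    have \<sigma>0: "\<sigma> 0 = 0" using permutes_not_in[OF \<sigma>, of 0] by simp
    then have z: "\<sigma> c = 0 \<longleftrightarrow> c = 0" for c using injD[OF permutes_inj[OF \<sigma>], of c 0] by auto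
    have upd: "I(0 := j) \<circ> \<sigma> = (I \<circ> \<sigma>)(0 := j)" for j
      by (auto simp: fun_eq_iff z)
    have inv: "inversions N (J(0 := j)) = inversions N J" for J j
      by (rule inversions_cong) auto
    show "Pp \<sigma> (op1 N 0 M v) I = op1 N 0 M (Pp \<sigma> v) I"
      using permutes_grd[OF \<sigma>, of I]
      by (cases "grd N I") (simp_all add: Pp_def op1_def \<sigma>0 upd inv grd_upd sum_distrib_left \<iota>_left_commute[of "M _ _"] cong: sum.cong_simp)
  qed
  have "op1 N 0 M (A v) = (\<lambda>I. \<Sum>\<sigma> | \<sigma> permutes {1..N}. \<iota> (of_int (sign \<sigma>)) * op1 N 0 M (Pp \<sigma> v) I)"
    unfolding A_def[abs_def] by (simp add: oper_sum[OF oper_op1] oper_\<iota>[OF oper_op1])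
  also have "\<dots> = A (op1 N 0 M v)"
    unfolding A_def[abs_def] by (intro ext sum.cong refl) (simp add: P)
  finally show ?thesis ..
qed

end

section \<open>Reflection algebras\<close>

text \<open>The ordered product of the Sklyanin determinant over an arbitrary list of spaces; the
  recursion exposes the leftmost block for inductions.\<close>

primrec chain :: "(nat \<Rightarrow> 'v \<Rightarrow> 'v) \<Rightarrow> (nat \<Rightarrow> nat \<Rightarrow> 'v \<Rightarrow> 'v) \<Rightarrow> nat list \<Rightarrow> 'v \<Rightarrow> 'v" where
  "chain S Q [] v = v"
| "chain S Q (a # xs) v = S a (foldr (Q a) xs (chain S Q xs v))"

lemma op2_swap:
  assumes "a \<noteq> b"
  shows "op2 N a b X v = op2 N b a (\<lambda>i j k l. X k l i j) v"
proof
  fix I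
  show "op2 N a b X v I = op2 N b a (\<lambda>i j k l. X k l i j) v I"
    unfolding op2_def fun_upd_twist[OF assms] by (subst sum.swap) simp
qed

text \<open>Space 0 carries the free parameter, spaces 1..N the progression u_(i+1) = u_i / q^2. The
  reflection equation is an assumption here and is verified for S(u) later.\<close>

locale reflection_algebra = antisymmetrizer \<iota> N q for \<iota> :: "'k::field_char_0 \<Rightarrow> 'a::ring_1" and N q +
  fixes u :: "nat \<Rightarrow> 'k" and S :: "nat \<Rightarrow> nat \<Rightarrow> nat \<Rightarrow> 'a"
  assumes q2: "q * q \<noteq> 1"
    and u0: "a \<le> N \<Longrightarrow> u a \<noteq> 0"
    and u_Suc: "1 \<le> i \<Longrightarrow> i < N \<Longrightarrow> u (Suc i) = u i / (q * q)"
    and reflection: "a \<le> N \<Longrightarrow> b \<le> N \<Longrightarrow> a \<noteq> b \<Longrightarrow>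
      op2 N a b (\<lambda>i j k l. \<iota> (Rm q (u a) (u b) i j k l)) (op1 N a (S a)
        (op2 N a b (\<lambda>i j k l. \<iota> (Rt q (1 / u a) (u b) i j k l)) (op1 N b (S b) v)))
    = op1 N b (S b) (op2 N a b (\<lambda>i j k l. \<iota> (Rt q (1 / u a) (u b) i j k l))
        (op1 N a (S a) (op2 N a b (\<lambda>i j k l. \<iota> (Rm q (u a) (u b) i j k l)) v)))"
begin

definition R :: "nat \<Rightarrow> nat \<Rightarrow> ((nat \<Rightarrow> nat) \<Rightarrow> 'a) \<Rightarrow> (nat \<Rightarrow> nat) \<Rightarrow> 'a" where
  "R a b = op2 N a b (\<lambda>i j k l. \<iota> (Rm q (u a) (u b) i j k l))"

definition Q :: "nat \<Rightarrow> nat \<Rightarrow> ((nat \<Rightarrow> nat) \<Rightarrow> 'a) \<Rightarrow> (nat \<Rightarrow> nat) \<Rightarrow> 'a" where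
  "Q a b = op2 N a b (\<lambda>i j k l. \<iota> (Rt q (1 / u a) (u b) i j k l))"

definition S1 :: "nat \<Rightarrow> ((nat \<Rightarrow> nat) \<Rightarrow> 'a) \<Rightarrow> (nat \<Rightarrow> nat) \<Rightarrow> 'a" where
  "S1 a = op1 N a (S a)"

lemma oper_R: "oper N (R a b)" and oper_Q: "oper N (Q a b)" and oper_S1: "oper N (S1 a)"
  unfolding R_def Q_def S1_def by (rule oper_op2 oper_op1)+

lemma RSQS: "a \<le> N \<Longrightarrow> b \<le> N \<Longrightarrow> a \<noteq> b \<Longrightarrow> R a b (S1 a (Q a b (S1 b v))) = S1 b (Q a b (S1 a (R a b v)))"
  unfolding R_def Q_def S1_def by (rule reflection)

lemma S1_R: "c \<noteq> a \<Longrightarrow> c \<noteq> b \<Longrightarrow> S1 c (R a b v) = R a b (S1 c v)"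
  unfolding R_def S1_def by (rule op1_op2_commute) (assumption | rule \<iota>_central[symmetric])+

lemma S1_Q: "c \<noteq> a \<Longrightarrow> c \<noteq> b \<Longrightarrow> S1 c (Q a b v) = Q a b (S1 c v)"
  unfolding Q_def S1_def by (rule op1_op2_commute) (assumption | rule \<iota>_central[symmetric])+

lemma R_R: "c \<noteq> a \<Longrightarrow> c \<noteq> b \<Longrightarrow> d \<noteq> a \<Longrightarrow> d \<noteq> b \<Longrightarrow> R c d (R a b v) = R a b (R c d v)"
  unfolding R_def by (rule op2_op2_commute) (assumption | rule \<iota>_central)+

lemma R_Q: "c \<noteq> a \<Longrightarrow> c \<noteq> b \<Longrightarrow> d \<noteq> a \<Longrightarrow> d \<noteq> b \<Longrightarrow> R c d (Q a b v) = Q a b (R c d v)"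
  unfolding R_def Q_def by (rule op2_op2_commute) (assumption | rule \<iota>_central)+

lemma Q_Q: "c \<noteq> a \<Longrightarrow> c \<noteq> b \<Longrightarrow> d \<noteq> a \<Longrightarrow> d \<noteq> b \<Longrightarrow> Q c d (Q a b v) = Q a b (Q c d v)"
  unfolding Q_def by (rule op2_op2_commute) (assumption | rule \<iota>_central)+

lemma RRR:
  assumes "a \<noteq> b" "a \<noteq> c" "b \<noteq> c" "a \<le> N" "b \<le> N" "c \<le> N"
  shows "R a b (R a c (R b c v)) = R b c (R a c (R a b v))"
  unfolding R_def
  by (rule op2_triple[OF assms])
    (simp only: \<iota>_mult[symmetric] \<iota>_sum[symmetric] Rm_yang_baxter[OF q0 finite_atLeastAtMost])

lemma RQQ:
  assumes "a \<noteq> b" "a \<noteq> c" "b \<noteq> c" "a \<le> N" "b \<le> N" "c \<le> N"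
  shows "R a b (Q a c (Q b c v)) = Q b c (Q a c (R a b v))"
  unfolding R_def Q_def
  by (rule op2_triple[OF assms])
    (simp only: \<iota>_mult[symmetric] \<iota>_sum[symmetric] Rt_yang_baxter[OF q0 u0[OF assms(4)] u0[OF assms(5)] finite_atLeastAtMost])

lemma Q_sym:
  assumes "a \<noteq> b" "a \<le> N" "b \<le> N"
  shows "Q a b v = (\<lambda>I. \<iota> (u b / u a) * Q b a v I)"
proof
  fix I
  have e: "Rt q (1 / u a) (u b) i j k l = (u b / u a) * Rt q (1 / u b) (u a) k l i j" for i j k l
    using Rt_inverse_args[OF u0[OF assms(2)] u0[OF assms(3)]] Rt_flip[of q "1 / u b" "u a" k l i j] by simp
  show "Q a b v I = \<iota> (u b / u a) * Q b a v I"
    unfolding Q_def op2_swap[OF assms(1)] e \<iota>_mult op2_def mult.assoc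
    by (cases "grd N I") (simp_all only: if_True if_False sum_distrib_left mult_zero_right)
qed

lemma Q_scale: "Q a b (\<lambda>I. \<iota> c * v I) = (\<lambda>I. \<iota> c * Q a b v I)"
  and R_scale: "R a b (\<lambda>I. \<iota> c * v I) = (\<lambda>I. \<iota> c * R a b v I)"
  by (rule oper_\<iota> oper_Q oper_R)+

lemma RQQ':
  assumes "a \<noteq> b" "a \<noteq> c" "b \<noteq> c" "a \<le> N" "b \<le> N" "c \<le> N"
  shows "R a b (Q c a (Q c b v)) = Q c b (Q c a (R a b v))"
  unfolding Q_sym[of c a, OF assms(2)[symmetric] assms(6,4)] Q_sym[of c b, OF assms(3)[symmetric] assms(6,5)]
    Q_scale R_scale RQQ[OF assms] by (simp only: \<iota>_\<iota> mult.commute)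

lemma RQQ'':
  assumes "a \<noteq> b" "a \<noteq> c" "b \<noteq> c" "a \<le> N" "b \<le> N" "c \<le> N"
  shows "R a b (Q a c (Q c b v)) = Q c b (Q a c (R a b v))"
  unfolding Q_sym[of c b, OF assms(3)[symmetric] assms(6,5)] Q_scale R_scale RQQ[OF assms] ..

text \<open>R_ij can be moved from the left of f to the right. What appears on the other side is f
  with its factors reordered; the antisymmetry argument asks only for the existence of such an
  operator.\<close>

definition good :: "nat \<Rightarrow> nat \<Rightarrow> (((nat \<Rightarrow> nat) \<Rightarrow> 'a) \<Rightarrow> (nat \<Rightarrow> nat) \<Rightarrow> 'a) \<Rightarrow> bool" where
  "good i j f \<longleftrightarrow> (\<exists>g. oper N g \<and> (\<forall>v. R i j (f v) = g (R i j v)))"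

lemma good_comp:
  assumes "good i j f" "good i j f'"
  shows "good i j (\<lambda>v. f (f' v))"
proof -
  obtain g g' where "oper N g" "\<forall>v. R i j (f v) = g (R i j v)" "oper N g'" "\<forall>v. R i j (f' v) = g' (R i j v)"
    using assms unfolding good_def by blast
  then show ?thesis unfolding good_def by (intro exI[of _ "\<lambda>v. g (g' v)"]) (simp add: oper_comp)
qed

lemma good_id: "good i j (\<lambda>v. v)"
  unfolding good_def using oper_id by blast

lemma good_commute: "oper N f \<Longrightarrow> (\<And>v. R i j (f v) = f (R i j v)) \<Longrightarrow> good i j f"
  unfolding good_def by blast

lemma good_foldr: "(\<And>a. a \<in> set xs \<Longrightarrow> good i j (f a)) \<Longrightarrow> good i j (foldr f xs)"
proof (induction xs)
  case Nil
  show ?case using good_id by (simp add: id_def)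
next
  case (Cons a xs)
  then show ?case using good_comp[of i j "f a" "foldr f xs"] by (simp add: comp_def)
qed

lemma good_foldr_pair:
  assumes "\<And>a. a \<in> set ys \<union> set zs \<Longrightarrow> good i j (f a)" "good i j (\<lambda>v. f i (f j v))"
  shows "good i j (foldr f (ys @ i # j # zs))"
proof -
  have "good i j (foldr f ys)" "good i j (foldr f zs)" using assms(1) by (auto intro: good_foldr)
  then have "good i j (\<lambda>v. foldr f ys (f i (f j (foldr f zs v))))"
    using good_comp[OF _ good_comp[OF assms(2)]] by blast
  moreover have "foldr f (ys @ i # j # zs) = (\<lambda>v. foldr f ys (f i (f j (foldr f zs v))))"
    by (rule ext) simp
  ultimately show ?thesis by simp
qed

text \<open>Blocks left of the neighbours i, j meet R_ij through pairs Q_ci Q_cj; at i, j themselves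
  the reflection equation applies, followed by pairs Q_ic Q_jc; blocks further right do not involve
  i or j.\<close>

lemma chain_good:
  assumes "distinct (ys @ i # j # zs)" "set (ys @ i # j # zs) \<subseteq> {1..N}"
  shows "good i j (chain S1 Q (ys @ i # j # zs))"
proof -
  have ij: "i \<noteq> j" "i \<le> N" "j \<le> N" using assms by auto
  have S: "good i j (S1 c)" if "c \<noteq> i" "c \<noteq> j" for c
    using that by (intro good_commute oper_S1) (simp add: S1_R)
  have Qc: "good i j (Q c d)" if "c \<noteq> i" "c \<noteq> j" "d \<noteq> i" "d \<noteq> j" for c d
    using that by (intro good_commute oper_Q) (simp add: R_Q)
  have C: "good i j (chain S1 Q zs)" if "i \<notin> set zs" "j \<notin> set zs" for zs
    using that
  proof (induction zs)
    case Nil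
    show ?case by (simp add: good_id)
  next
    case (Cons c zs)
    have "good i j (foldr (Q c) zs)"
      by (rule good_foldr) (use Cons.prems in \<open>auto intro: Qc\<close>)
    moreover have "good i j (S1 c)" using Cons.prems by (intro S) auto
    ultimately have "good i j (\<lambda>v. S1 c (foldr (Q c) zs (chain S1 Q zs v)))"
      using Cons good_comp[of i j "S1 c"] good_comp[of i j "foldr (Q c) zs"] by simp
    then show ?case by simp
  qed
  have QQ: "good i j (\<lambda>v. foldr (Q i) zs (foldr (Q j) zs v))"
    if "distinct zs" "set zs \<subseteq> {1..N}" "i \<notin> set zs" "j \<notin> set zs" for zs
    using that
  proof (induction zs)
    case Nil
    show ?case by (simp add: good_id)
  next
    case (Cons c zs)
    \<comment> \<open>Regroups the two rows of factors so that Q_ic and Q_jc stand side by side and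
      the Yang-Baxter equation applies.\<close>
    have comm: "foldr (Q i) xs (Q j c v) = Q j c (foldr (Q i) xs v)" if "c \<notin> set xs" "j \<notin> set xs" for xs v
      using that
    proof (induction xs)
      case (Cons d xs)
      then show ?case using ij \<open>i \<notin> set (c # zs)\<close> by (simp add: Q_Q[of i j c d])
    qed simp
    have "good i j (\<lambda>v. Q i c (Q j c v))"
      unfolding good_def
    proof (intro exI conjI allI)
      show "oper N (\<lambda>v. Q j c (Q i c v))" by (rule oper_comp[OF oper_Q oper_Q])
      show "R i j (Q i c (Q j c v)) = Q j c (Q i c (R i j v))" for v
        using Cons.prems ij by (intro RQQ) auto
    qed
    then have "good i j (\<lambda>v. Q i c (Q j c (foldr (Q i) zs (foldr (Q j) zs v))))"
      by (rule good_comp) (use Cons in auto)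
    then show ?case using Cons.prems by (simp add: comm)
  qed
  show ?thesis
    using assms
  proof (induction ys)
    case Nil
    have comm: "foldr (Q i) xs (S1 j v) = S1 j (foldr (Q i) xs v)" if "j \<notin> set xs" for xs v
      using that ij by (induction xs) (auto simp: S1_Q)
    have "good i j (\<lambda>v. S1 i (Q i j (S1 j v)))"
      unfolding good_def
    proof (intro exI conjI allI)
      show "oper N (\<lambda>v. S1 j (Q i j (S1 i v)))" by (rule oper_comp[OF oper_S1 oper_comp[OF oper_Q oper_S1]])
      show "R i j (S1 i (Q i j (S1 j v))) = S1 j (Q i j (S1 i (R i j v)))" for v
        using ij by (intro RSQS) auto
    qed
    then have "good i j (\<lambda>v. S1 i (Q i j (S1 j (foldr (Q i) zs (foldr (Q j) zs (chain S1 Q zs v))))))"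
      by (rule good_comp) (rule good_comp[OF QQ C]; use Nil in auto)
    then show ?case using Nil by (simp add: comm)
  next
    case (Cons c ys)
    have "good i j (\<lambda>v. Q c i (Q c j v))"
      unfolding good_def
    proof (intro exI conjI allI)
      show "oper N (\<lambda>v. Q c j (Q c i v))" by (rule oper_comp[OF oper_Q oper_Q])
      show "R i j (Q c i (Q c j v)) = Q c j (Q c i (R i j v))" for v
        using Cons.prems ij by (intro RQQ') auto
    qed
    then have "good i j (foldr (Q c) (ys @ i # j # zs))"
      using Cons.prems by (intro good_foldr_pair Qc) auto
    moreover have "good i j (chain S1 Q (ys @ i # j # zs))" using Cons by simp
    moreover have "good i j (S1 c)" using Cons.prems by (intro S) auto
    ultimately have "good i j (\<lambda>v. S1 c (foldr (Q c) (ys @ i # j # zs) (chain S1 Q (ys @ i # j # zs) v)))"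
      using good_comp[of i j "S1 c"] good_comp[of i j "foldr (Q c) (ys @ i # j # zs)"] by blast
    then show ?case by simp
  qed
qed

lemma R_foldr_good:
  assumes "distinct (ys @ i # j # zs)" "set (ys @ i # j # zs) \<subseteq> {1..N}"
  shows "good i j (foldr (\<lambda>a. R a 0) (ys @ i # j # zs))"
proof (rule good_foldr_pair)
  show "good i j (R a 0)" if "a \<in> set ys \<union> set zs" for a
    using that assms by (intro good_commute oper_R R_R) auto
  show "good i j (\<lambda>v. R i 0 (R j 0 v))"
    unfolding good_def
  proof (intro exI conjI allI)
    show "oper N (\<lambda>v. R j 0 (R i 0 v))" by (rule oper_comp[OF oper_R oper_R])
    show "R i j (R i 0 (R j 0 v)) = R j 0 (R i 0 (R i j v))" for v
      using assms by (intro RRR) auto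
  qed
qed

lemma Q_foldr_good:
  assumes "distinct (ys @ i # j # zs)" "set (ys @ i # j # zs) \<subseteq> {1..N}"
  shows "good i j (foldr (\<lambda>a. Q a 0) (ys @ i # j # zs))"
proof (rule good_foldr_pair)
  show "good i j (Q a 0)" if "a \<in> set ys \<union> set zs" for a
    using that assms by (intro good_commute oper_Q R_Q) auto
  show "good i j (\<lambda>v. Q i 0 (Q j 0 v))"
    unfolding good_def
  proof (intro exI conjI allI)
    show "oper N (\<lambda>v. Q j 0 (Q i 0 v))" by (rule oper_comp[OF oper_Q oper_Q])
    show "R i j (Q i 0 (Q j 0 v)) = Q j 0 (Q i 0 (R i j v))" for v
      using assms by (intro RQQ) auto
  qed
qed

end

lemma foldr_commute:
  assumes "\<And>a v. a \<in> set xs \<Longrightarrow> f a (g v) = g (f a v)"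
  shows "foldr f xs (g v) = g (foldr f xs v)"
  using assms by (induction xs) auto

section \<open>Passing an auxiliary space through the ordered product\<close>

context reflection_algebra
begin

lemma chain_commute_R:
  assumes "a \<notin> set xs" "b \<notin> set xs"
  shows "chain S1 Q xs (R a b v) = R a b (chain S1 Q xs v)"
  using assms
proof (induction xs)
  case (Cons c xs)
  have "foldr (Q c) xs (R a b w) = R a b (foldr (Q c) xs w)" for w
    by (rule foldr_commute, rule R_Q[symmetric]) (use Cons.prems in auto)
  with Cons show ?case by (simp add: S1_R)
qed simp

lemma chain_commute_Q:
  assumes "a \<notin> set xs" "b \<notin> set xs"
  shows "chain S1 Q xs (Q a b v) = Q a b (chain S1 Q xs v)"
  using assms
proof (induction xs)
  case (Cons c xs)
  have "foldr (Q c) xs (Q a b w) = Q a b (foldr (Q c) xs w)" for w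
    by (rule foldr_commute, rule Q_Q) (use Cons.prems in auto)
  with Cons show ?case by (simp add: S1_Q)
qed simp

lemma R_foldr_Q_foldr:
  assumes "distinct (a # xs)" "set (a # xs) \<subseteq> {1..N}"
  shows "foldr (\<lambda>c. R c 0) xs (foldr (Q a) xs (Q a 0 v)) = Q a 0 (foldr (Q a) xs (foldr (\<lambda>c. R c 0) xs v))"
  using assms
proof (induction xs)
  case (Cons c xs)
  have 1: "foldr (\<lambda>c. R c 0) xs (Q a c w) = Q a c (foldr (\<lambda>c. R c 0) xs w)" for w
    by (rule foldr_commute, rule R_Q) (use Cons.prems in auto)
  have 2: "foldr (Q a) xs (R c 0 w) = R c 0 (foldr (Q a) xs w)" for w
    by (rule foldr_commute, rule R_Q[symmetric]) (use Cons.prems in auto)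
  have "R c 0 (Q a c (Q a 0 w)) = Q a 0 (Q a c (R c 0 w))" for w
    using Cons.prems by (intro RQQ') auto
  with Cons 1 2 show ?case by simp
qed simp

lemma R_Q_foldr_Q_foldr:
  assumes "distinct (a # xs)" "set (a # xs) \<subseteq> {1..N}"
  shows "R a 0 (foldr (Q a) xs (foldr (\<lambda>c. Q c 0) xs v)) = foldr (\<lambda>c. Q c 0) xs (foldr (Q a) xs (R a 0 v))"
  using assms
proof (induction xs)
  case (Cons c xs)
  have 1: "foldr (Q a) xs (Q c 0 w) = Q c 0 (foldr (Q a) xs w)" for w
    by (rule foldr_commute, rule Q_Q) (use Cons.prems in auto)
  have 2: "foldr (\<lambda>c. Q c 0) xs (Q a c w) = Q a c (foldr (\<lambda>c. Q c 0) xs w)" for w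
    by (rule foldr_commute, rule Q_Q) (use Cons.prems in auto)
  have "R a 0 (Q a c (Q c 0 w)) = Q c 0 (Q a c (R a 0 w))" for w
    using Cons.prems by (intro RQQ'') auto
  with Cons 1 2 show ?case by simp
qed simp

text \<open>Induction on the list. The old Z and Z^t are moved past the block of the new space a by
  the two preceding lemmas, the induction hypothesis is inserted, and what remains is one reflection
  equation between a and 0.\<close>

lemma chain_S1_commute:
  assumes "distinct xs" "set xs \<subseteq> {1..N}"
  shows "foldr (\<lambda>c. R c 0) xs (chain S1 Q xs (foldr (\<lambda>c. Q c 0) xs (S1 0 v)))
       = S1 0 (foldr (\<lambda>c. Q c 0) xs (chain S1 Q xs (foldr (\<lambda>c. R c 0) xs v)))"
  using assms
proof (induction xs)
  case (Cons a xs)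
  let ?Z = "foldr (\<lambda>c. R c 0) xs" and ?Zt = "foldr (\<lambda>c. Q c 0) xs" and ?B = "foldr (Q a) xs" and ?X = "chain S1 Q xs"
  have 0: "a \<noteq> 0" "a \<le> N" "a \<notin> set xs" "0 \<notin> set xs" using Cons.prems by auto
  have ZS: "?Z (S1 a w) = S1 a (?Z w)" for w
    by (rule foldr_commute, rule S1_R[symmetric]) (use 0 in auto)
  have ZtS: "?Zt (S1 a w) = S1 a (?Zt w)" for w
    by (rule foldr_commute, rule S1_Q[symmetric]) (use 0 in auto)
  have BS: "?B (S1 0 w) = S1 0 (?B w)" for w
    by (rule foldr_commute, rule S1_Q[symmetric]) (use 0 in \<open>auto intro: ccontr\<close>)
  note XQ = chain_commute_Q[OF 0(3,4)] and XR = chain_commute_R[OF 0(3,4)]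
  note ZBQ = R_foldr_Q_foldr[OF Cons.prems] and RBZ = R_Q_foldr_Q_foldr[OF Cons.prems]
  have IH: "?Z (?X (?Zt (S1 0 v))) = S1 0 (?Zt (?X (?Z v)))" using Cons by simp
  let ?W = "?Zt (?X (?Z v))"
  have "foldr (\<lambda>c. R c 0) (a # xs) (chain S1 Q (a # xs) (foldr (\<lambda>c. Q c 0) (a # xs) (S1 0 v)))
      = R a 0 (S1 a (Q a 0 (S1 0 (?B ?W))))"
    by (simp add: XQ ZS ZBQ IH BS)
  also have "\<dots> = S1 0 (Q a 0 (S1 a (R a 0 (?B ?W))))"
    using 0 by (intro RSQS) auto
  also have "\<dots> = S1 0 (foldr (\<lambda>c. Q c 0) (a # xs) (chain S1 Q (a # xs) (foldr (\<lambda>c. R c 0) (a # xs) v)))"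
    by (simp add: XR ZtS RBZ)
  finally show ?case .
qed simp

abbreviation "sites \<equiv> [1..<Suc N]"

lemma sites_split:
  assumes "1 \<le> i" "i < N"
  shows "sites = [1..<i] @ i # Suc i # [Suc (Suc i)..<Suc N]"
proof -
  have "sites = [1..<i] @ [i..<Suc N]" using assms upt_add_eq_append[of 1 i "Suc N - i"] by simp
  also have "[i..<Suc N] = i # Suc i # [Suc (Suc i)..<Suc N]" using assms by (simp add: upt_rec)
  finally show ?thesis .
qed

text \<open>At the ratio u_(i+1) = u_i / q^2 the coefficient u_i / q - q u_(i+1) on equal indices
  vanishes and R degenerates to a multiple of 1 - P^q. This is the reason for the parameters
  q^(-2i+2) u.\<close>

lemma R_adjacent:
  assumes i: "1 \<le> i" "i < N"
  shows "R i (Suc i) v = (\<lambda>I. \<iota> (u i * (1 - 1 / (q * q))) * (cutoff N v I - P i v I))"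
proof
  fix I
  define c where "c = u i * (1 - 1 / (q * q))"
  show "R i (Suc i) v I = \<iota> (u i * (1 - 1 / (q * q))) * (cutoff N v I - P i v I)"
  proof (cases "grd N I")
    case True
    have V: "I i \<in> {1..N}" "I (Suc i) \<in> {1..N}" using grdD[OF True] i by auto
    let ?j = "I i" and ?k = "I (Suc i)"
    have sw: "I(i := ?k, Suc i := ?j) = I \<circ> adj i" "I(i := ?j, Suc i := ?k) = I"
      by (auto simp: fun_eq_iff Transposition.transpose_def)
    have "R i (Suc i) v I = \<iota> (rdiag q (u i) (u (Suc i)) ?j ?k) * v I + \<iota> (rexch q (u i) (u (Suc i)) ?j ?k) * v (I \<circ> adj i)"
      using True unfolding R_def op2_def by (simp only: if_True sum_\<iota>_Rm[OF finite_atLeastAtMost V] sw)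
    moreover have "P i v I = \<iota> (Pcoef q ?j ?k) * v (I \<circ> adj i)"
      using True unfolding P_def op2_def Pm_def
      by (simp only: if_True mult.assoc sum_\<iota>_of_bool2[OF finite_atLeastAtMost V(2,1)] sw)
    moreover have "?j = ?k \<Longrightarrow> I \<circ> adj i = I"
      using sw by simp
    moreover have "rdiag q (u i) (u (Suc i)) ?j ?k = (if ?j = ?k then 0 else c)"
      using q0 by (simp add: c_def rdiag_def u_Suc[OF i] field_simps)
    moreover have "rexch q (u i) (u (Suc i)) ?j ?k = (if ?j = ?k then 0 else - c * Pcoef q ?j ?k)"
      using q0 by (simp add: c_def rexch_def u_Suc[OF i] Pcoef_def field_simps)
    ultimately show ?thesis unfolding c_def[symmetric] using True
      by (cases "?j = ?k") (simp_all add: cutoff_def \<iota>_zero \<iota>_mult \<iota>_minus right_diff_distrib mult.assoc Pcoef_def \<iota>_one)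
  qed (simp add: R_def P_def op2_def cutoff_def)
qed

text \<open>With R = c (1 - P) one has A R = 2c A and R P = -R. Hence 2c A X P = A R X P = A g R P =
  -A g R = -2c A X, and 2c cancels.\<close>

lemma good_alternating:
  assumes X: "oper N X" and good: "\<And>i. 1 \<le> i \<Longrightarrow> i < N \<Longrightarrow> good i (Suc i) X"
  shows "alternating (\<lambda>v. A (X v))"
  unfolding alternating_def
proof (intro conjI allI impI)
  show "oper N (\<lambda>v. A (X v))" by (rule oper_comp[OF oper_A X])
  show "A (X (cutoff N v)) = A (X v)" for v by (simp add: oper_cutoff[OF X] A_cutoff)
  fix i v assume i: "1 \<le> i" "i < N"
  let ?c = "u i * (1 - 1 / (q * q))" and ?R = "R i (Suc i)"
  obtain g where g: "oper N g" "\<And>v. ?R (X v) = g (?R v)"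
    using good[OF i] unfolding good_def by blast
  \<comment> \<open>Here q^2 \<noteq> 1 enters: otherwise R would vanish at this ratio.\<close>
  have c: "2 * ?c \<noteq> 0" using q0 q2 u0[of i] i by simp
  have AR: "A (?R w) = (\<lambda>I. \<iota> (2 * ?c) * A w I)" for w
  proof -
    have "A (?R w) = (\<lambda>I. \<iota> ?c * (A (cutoff N w) I - A (P i w) I))"
      unfolding R_adjacent[OF i] oper_\<iota>[OF oper_A] oper_diff[OF oper_A] ..
    also have "\<dots> = (\<lambda>I. \<iota> (2 * ?c) * A w I)"
      unfolding A_cutoff A_P[OF i] mult_2 \<iota>_add by (simp only: diff_minus_eq_add distrib_left distrib_right)
    finally show ?thesis .
  qed
  have RP: "?R (P i v) = (\<lambda>I. - ?R v I)"
  proof -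
    have "cutoff N (P i v) = P i v" by (auto simp: cutoff_def P_def op2_def)
    moreover have "P i (P i v) = cutoff N v"
    proof -
      have "adj i \<circ> adj i = id" by auto
      then have "P i (P i v) = Pp id v" unfolding P_eq_Pp[OF i] Pp_comp[OF permutes_adj[OF i]] by simp
      also have "\<dots> = cutoff N v" by (auto simp: Pp_def cutoff_def \<iota>_one)
      finally show ?thesis .
    qed
    ultimately show ?thesis unfolding R_adjacent[OF i] by (simp add: right_diff_distrib)
  qed
  show "A (X (P i v)) = (\<lambda>I. - A (X v) I)"
  proof
    fix I
    have "\<iota> (2 * ?c) * A (X (P i v)) I = A (g (?R (P i v))) I"
      using AR[of "X (P i v)"] g(2) by simp
    also have "\<dots> = - A (g (?R v)) I"
      unfolding RP oper_uminus[OF g(1)] oper_uminus[OF oper_A] ..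
    also have "\<dots> = \<iota> (2 * ?c) * (- A (X v) I)"
      using AR[of "X v"] g(2)[of v] by simp
    finally show "A (X (P i v)) I = - A (X v) I" using c by (rule \<iota>_cancel)
  qed
qed

lemma oper_foldr: "(\<And>a. oper N (f a)) \<Longrightarrow> oper N (foldr f xs)"
proof (induction xs)
  case Nil
  show ?case using oper_id by (simp add: id_def)
next
  case (Cons a xs)
  then show ?case using oper_comp[of N "f a" "foldr f xs"] by (simp add: comp_def)
qed

lemma lop_foldr: "(\<And>a. a \<in> set xs \<Longrightarrow> lop N (f a)) \<Longrightarrow> lop N (foldr f xs)"
proof (induction xs)
  case Nil
  show ?case using lop_id by (simp add: id_def)
next
  case (Cons a xs)
  then show ?case using lop_comp[of N "f a" "foldr f xs"] by (simp add: comp_def)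
qed

lemma lop_chain: "set xs \<subseteq> {1..N} \<Longrightarrow> lop N (chain S1 Q xs)"
proof (induction xs)
  case Nil
  show ?case using lop_id by simp
next
  case (Cons a xs)
  have "lop N (foldr (Q a) xs)" using Cons.prems by (intro lop_foldr) (auto simp: Q_def intro!: lop_op2)
  moreover have "lop N (S1 a)" using Cons.prems by (auto simp: S1_def intro!: lop_op1)
  ultimately have "lop N (\<lambda>v. S1 a (foldr (Q a) xs (chain S1 Q xs v)))"
    using Cons lop_comp[of N "S1 a"] lop_comp[of N "foldr (Q a) xs"] by simp
  then show ?case by simp
qed

lemma alternating_chain: "alternating (\<lambda>v. A (chain S1 Q sites v))"
proof (rule good_alternating)
  show "oper N (chain S1 Q sites)" by (rule lop_oper, rule lop_chain) auto
  show "good i (Suc i) (chain S1 Q sites)" if "1 \<le> i" "i < N" for i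
    unfolding sites_split[OF that] by (rule chain_good) (use that in auto)
qed

lemma chain_scalar: "\<exists>f. \<forall>v. A (chain S1 Q sites v) = (\<lambda>I. f * A v I)"
proof (rule local_scalar)
  show "lop N (chain S1 Q sites)" by (rule lop_chain) auto
  show "A (chain S1 Q sites (P i v)) = (\<lambda>I. - A (chain S1 Q sites v) I)" if "1 \<le> i" "i < N" for i v
    using alternating_chain that unfolding alternating_def by blast
qed

lemma alternating_R: "alternating (\<lambda>v. A (foldr (\<lambda>a. R a 0) sites v))"
proof (rule good_alternating)
  show "oper N (foldr (\<lambda>a. R a 0) sites)" by (rule oper_foldr) (rule oper_R)
  show "good i (Suc i) (foldr (\<lambda>a. R a 0) sites)" if "1 \<le> i" "i < N" for i
    unfolding sites_split[OF that] by (rule R_foldr_good) (use that in auto)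
qed

lemma alternating_Q: "alternating (\<lambda>v. A (foldr (\<lambda>a. Q a 0) sites v))"
proof (rule good_alternating)
  show "oper N (foldr (\<lambda>a. Q a 0) sites)" by (rule oper_foldr) (rule oper_Q)
  show "good i (Suc i) (foldr (\<lambda>a. Q a 0) sites)" if "1 \<le> i" "i < N" for i
    unfolding sites_split[OF that] by (rule Q_foldr_good) (use that in auto)
qed

end

section \<open>The scalars of A Z and A Z^t\<close>

context reflection_algebra
begin

lemma R_action:
  assumes "a \<le> N" "b \<le> N" "a \<noteq> b" "grd N I"
  shows "R a b v I = \<iota> (rdiag q (u a) (u b) (I a) (I b)) * v I
     + \<iota> (rexch q (u a) (u b) (I a) (I b)) * v (I(a := I b, b := I a))"
proof -
  have V: "I a \<in> {1..N}" "I b \<in> {1..N}" using assms grdD by auto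
  show ?thesis
    using assms(4) unfolding R_def op2_def by (simp only: if_True sum_\<iota>_Rm[OF finite_atLeastAtMost V] fun_upd_triv)
qed

lemma Q_action:
  assumes "a \<le> N" "b \<le> N" "a \<noteq> b" "grd N I"
  shows "Q a b v I = \<iota> (rdiag q (1 / u a) (u b) (I a) (I b)) * v I
     + (if I a = I b then \<Sum>j=1..N. \<iota> (rexch q (1 / u a) (u b) j (I b)) * v (I(a := j, b := j)) else 0)"
proof -
  have V: "I a \<in> {1..N}" "I b \<in> {1..N}" using assms grdD by auto
  show ?thesis
    using assms(4) unfolding Q_def op2_def by (simp only: if_True sum_\<iota>_Rt[OF finite_atLeastAtMost V] fun_upd_triv)
qed

lemma R_not_grd: "\<not> grd N I \<Longrightarrow> R a b v I = 0"
  and Q_not_grd: "\<not> grd N I \<Longrightarrow> Q a b v I = 0"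
  by (simp_all add: R_def Q_def op2_def)

text \<open>Product of the diagonal entries met by a multi-index whose entries in spaces N and 0
  agree: equal indices for R_N0, distinct ones for the other factors. \<open>Q_scalar\<close> is the
  analogue for spaces 1 and 0 with arguments 1 / u_a.\<close>

definition R_scalar :: 'k where
  "R_scalar = (u N / q - q * u 0) * (\<Prod>a\<in>{1..<N}. u a - u 0)"

definition Q_scalar :: 'k where
  "Q_scalar = (1 / u 1 / q - q * u 0) * (\<Prod>a\<in>{1<..N}. 1 / u a - u 0)"

text \<open>On vectors supported where the entries in spaces \<open>N\<close> and \<open>0\<close> agree, every exchange performed
  by a factor \<open>R a 0\<close> makes the entries in spaces \<open>a\<close> and \<open>N\<close> equal, which \<open>A\<close> kills.\<close>

lemma A_R_foldr: "A (foldr (\<lambda>a. R a 0) sites v) = (\<lambda>I. \<iota> R_scalar * A v I)"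
proof (rule alternating_scalar[OF alternating_R, of N])
  show "N \<in> {1..N}" using N1 by simp
  fix w :: "(nat \<Rightarrow> nat) \<Rightarrow> 'a" assume w: "\<And>J. w J \<noteq> 0 \<Longrightarrow> grd N J \<and> inj_on J {1..N} \<and> J N = J 0"
  have w0: "w J = 0" if "\<not> (grd N J \<and> inj_on J {1..N} \<and> J N = J 0)" for J using w that by blast
  \<comment> \<open>R_N0 acts first, and on equal indices in spaces N and 0 it is diagonal.\<close>
  have RN: "R N 0 w = (\<lambda>I. \<iota> (u N / q - q * u 0) * w I)"
  proof
    fix I
    show "R N 0 w I = \<iota> (u N / q - q * u 0) * w I"
    proof (cases "grd N I")
      case True
      show ?thesis
      proof (cases "I N = I 0")
        case eq: True
        then show ?thesis using N1 True by (simp add: R_action rdiag_def rexch_def \<iota>_zero)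
      next
        case False
        then have "w I = 0" "w (I(N := I 0, 0 := I N)) = 0" using N1 by (auto intro!: w0)
        then show ?thesis using N1 True by (simp add: R_action)
      qed
    qed (simp add: R_not_grd w0)
  qed
  \<comment> \<open>\<open>bad\<close> collects everything produced by exchanges. Its support
    condition is stable because a new factor touches neither space N nor the spaces already
    treated.\<close>
  have step: "\<exists>bad. foldr (\<lambda>a. R a 0) ys w = (\<lambda>J. \<iota> (\<Prod>a\<leftarrow>ys. u a - u 0) * w J + bad J)
      \<and> (\<forall>J. bad J \<noteq> 0 \<longrightarrow> (\<exists>p\<in>set ys. J p = J N))"
    if "distinct ys" "set ys \<subseteq> {1..<N}" for ys
    using that
  proof (induction ys)
    case Nil
    show ?case by (intro exI[of _ "\<lambda>_. 0"]) (simp add: \<iota>_one)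
  next
    case (Cons a ys)
    then obtain bad where bad: "foldr (\<lambda>a. R a 0) ys w = (\<lambda>J. \<iota> (\<Prod>a\<leftarrow>ys. u a - u 0) * w J + bad J)"
      "\<And>J. bad J \<noteq> 0 \<Longrightarrow> \<exists>p\<in>set ys. J p = J N"
      by auto
    have a: "a \<in> {1..<N}" "a \<notin> set ys" using Cons.prems by auto
    define e where "e J = R a 0 w J - \<iota> (u a - u 0) * w J" for J
    \<comment> \<open>The exchanged multi-index carries J N in space N and J a in space 0, so it
      lies in the support of w only if J a = J N.\<close>
    have e: "e J = 0" if J: "J a \<noteq> J N" for J
    proof (cases "grd N J")
      case True
      have "w (J(a := J 0, 0 := J a)) = 0" using J a by (intro w0) auto
      moreover have "\<iota> (rdiag q (u a) (u 0) (J a) (J 0)) * w J = \<iota> (u a - u 0) * w J"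
      proof (cases "w J = 0")
        case False
        then have "J a \<noteq> J 0" using w[OF False] J by simp
        then show ?thesis by (simp add: rdiag_def)
      qed simp
      ultimately show ?thesis using a True by (simp add: e_def R_action)
    qed (simp add: e_def R_not_grd w0)
    have b: "R a 0 bad J = 0" if J: "\<forall>p\<in>set ys. J p \<noteq> J N" for J
    proof (cases "grd N J")
      case True
      have "bad J = 0" using bad(2) J by blast
      moreover have "bad (J(a := J 0, 0 := J a)) = 0"
      proof (rule ccontr)
        assume "bad (J(a := J 0, 0 := J a)) \<noteq> 0"
        then obtain p where p: "p \<in> set ys" "(J(a := J 0, 0 := J a)) p = (J(a := J 0, 0 := J a)) N"
          using bad(2) by blast
        moreover have "p \<noteq> a" "p \<noteq> 0" "N \<noteq> a" "N \<noteq> 0" using p(1) a Cons.prems(2) by auto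
        ultimately show False using J by simp
      qed
      ultimately show ?thesis using a True by (simp add: R_action)
    qed (simp add: R_not_grd)
    let ?c = "\<Prod>a\<leftarrow>ys. u a - u 0"
    have "foldr (\<lambda>a. R a 0) (a # ys) w = (\<lambda>J. \<iota> ?c * R a 0 w J + R a 0 bad J)"
      using bad(1) by (simp add: oper_add[OF oper_R] R_scale)
    also have "\<dots> = (\<lambda>J. \<iota> (\<Prod>a\<leftarrow>a # ys. u a - u 0) * w J + (\<iota> ?c * e J + R a 0 bad J))"
      by (simp add: e_def right_diff_distrib \<iota>_\<iota> mult.commute)
    finally show ?case
    proof (intro exI conjI allI impI)
      fix J assume "\<iota> ?c * e J + R a 0 bad J \<noteq> 0"
      then have "e J \<noteq> 0 \<or> R a 0 bad J \<noteq> 0" by auto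
      then show "\<exists>p\<in>set (a # ys). J p = J N" using e[of J] b[of J] by auto
    qed
  qed
  obtain bad where bad: "foldr (\<lambda>a. R a 0) [1..<N] w = (\<lambda>J. \<iota> (\<Prod>a\<leftarrow>[1..<N]. u a - u 0) * w J + bad J)"
      "\<And>J. bad J \<noteq> 0 \<Longrightarrow> \<exists>p\<in>{1..<N}. J p = J N"
    using step[of "[1..<N]"] by auto
  have prod: "(\<Prod>a\<leftarrow>[1..<N]. u a - u 0) = (\<Prod>a\<in>{1..<N}. u a - u 0)"
    by (subst prod.distinct_set_conv_list[symmetric]) auto
  have "sites = [1..<N] @ [N]" using N1 by simp
  then have "foldr (\<lambda>a. R a 0) sites w = foldr (\<lambda>a. R a 0) [1..<N] (\<lambda>I. \<iota> (u N / q - q * u 0) * w I)"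
    by (simp add: RN)
  also have "\<dots> = (\<lambda>I. \<iota> (u N / q - q * u 0) * (\<iota> (\<Prod>a\<in>{1..<N}. u a - u 0) * w I + bad I))"
    unfolding oper_\<iota>[OF oper_foldr[OF oper_R]] bad(1) prod ..
  finally have "A (foldr (\<lambda>a. R a 0) sites w)
      = A (\<lambda>I. \<iota> (u N / q - q * u 0) * (\<iota> (\<Prod>a\<in>{1..<N}. u a - u 0) * w I + bad I))" by simp
  also have "\<dots> = A (\<lambda>I. \<iota> R_scalar * w I)"
  proof (rule A_cong)
    fix J assume "grd N J" and inj: "inj_on J {1..N}"
    have "bad J = 0"
    proof (rule ccontr)
      assume "bad J \<noteq> 0"
      then obtain p where "p \<in> {1..<N}" "J p = J N" using bad(2) by blast
      then show False using inj_onD[OF inj, of p N] by auto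
    qed
    then show "\<iota> (u N / q - q * u 0) * (\<iota> (\<Prod>a\<in>{1..<N}. u a - u 0) * w J + bad J) = \<iota> R_scalar * w J"
      by (simp add: R_scalar_def \<iota>_\<iota>)
  qed
  also have "\<dots> = (\<lambda>I. \<iota> R_scalar * A w I)" by (rule oper_\<iota>[OF oper_A])
  finally show "A (foldr (\<lambda>a. R a 0) sites w) = (\<lambda>I. \<iota> R_scalar * A w I)" .
qed

text \<open>For a > 1 an exchange term of Q_a0 reads w where spaces a and 0 agree; on the support of
  w also 1 and 0 agree, against injectivity, so Q_a0 is scalar on w. The last factor Q_10 may change
  the support, but on injective multi-indices, the only ones seen by \<open>A\<close>, its exchange
  terms contribute nothing.\<close>

lemma A_Q_foldr: "A (foldr (\<lambda>a. Q a 0) sites v) = (\<lambda>I. \<iota> Q_scalar * A v I)"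
proof (rule alternating_scalar[OF alternating_Q, of 1])
  show "1 \<in> {1..N}" using N1 by simp
  fix w :: "(nat \<Rightarrow> nat) \<Rightarrow> 'a" assume w: "\<And>J. w J \<noteq> 0 \<Longrightarrow> grd N J \<and> inj_on J {1..N} \<and> J 1 = J 0"
  have w0: "w J = 0" if "\<not> (grd N J \<and> inj_on J {1..N} \<and> J 1 = J 0)" for J using w that by blast
  have Qa: "Q a 0 w = (\<lambda>I. \<iota> (1 / u a - u 0) * w I)" if a: "1 < a" "a \<le> N" for a
  proof
    fix I
    show "Q a 0 w I = \<iota> (1 / u a - u 0) * w I"
    proof (cases "grd N I")
      case True
      have ne: "J a \<noteq> J 1" if "inj_on J {1..N}" for J
        using inj_onD[OF that, of a 1] a by auto
      have "w (I(a := j, 0 := j)) = 0" for j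
      proof (rule ccontr)
        assume "w (I(a := j, 0 := j)) \<noteq> 0"
        then show False using w[of "I(a := j, 0 := j)"] ne[of "I(a := j, 0 := j)"] a by simp
      qed
      moreover have "\<iota> (rdiag q (1 / u a) (u 0) (I a) (I 0)) * w I = \<iota> (1 / u a - u 0) * w I"
      proof (cases "w I = 0")
        case False
        then have "I a \<noteq> I 0" using w[OF False] ne[of I] by simp
        then show ?thesis by (simp add: rdiag_def)
      qed simp
      ultimately show ?thesis using a True by (simp add: Q_action)
    qed (simp add: Q_not_grd w0)
  qed
  have step: "foldr (\<lambda>a. Q a 0) ys w = (\<lambda>J. \<iota> (\<Prod>a\<leftarrow>ys. 1 / u a - u 0) * w J)"
    if "set ys \<subseteq> {1<..N}" for ys
    using that
  proof (induction ys)
    case Nil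
    show ?case by (simp add: \<iota>_one)
  next
    case (Cons a ys)
    then show ?case by (simp add: Q_scale Qa \<iota>_\<iota> mult.commute)
  qed
  have prod: "(\<Prod>a\<leftarrow>[Suc 1..<Suc N]. 1 / u a - u 0) = (\<Prod>a\<in>{1<..N}. 1 / u a - u 0)"
    by (subst prod.distinct_set_conv_list[symmetric]) (auto intro!: prod.cong)
  have "sites = 1 # [Suc 1..<Suc N]" using N1 by (simp add: upt_conv_Cons)
  then have "foldr (\<lambda>a. Q a 0) sites w = Q 1 0 (foldr (\<lambda>a. Q a 0) [Suc 1..<Suc N] w)"
    by simp
  also have "foldr (\<lambda>a. Q a 0) [Suc 1..<Suc N] w = (\<lambda>J. \<iota> (\<Prod>a\<in>{1<..N}. 1 / u a - u 0) * w J)"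
    unfolding prod[symmetric] by (rule step) auto
  also have "Q 1 0 \<dots> = (\<lambda>J. \<iota> (\<Prod>a\<in>{1<..N}. 1 / u a - u 0) * Q 1 0 w J)"
    by (rule Q_scale)
  finally have "A (foldr (\<lambda>a. Q a 0) sites w) = A (\<lambda>J. \<iota> (\<Prod>a\<in>{1<..N}. 1 / u a - u 0) * Q 1 0 w J)"
    by simp
  also have "\<dots> = A (\<lambda>J. \<iota> Q_scalar * w J)"
  proof (rule A_cong)
    fix J assume J: "grd N J" and inj: "inj_on J {1..N}"
    have surj: "J ` {1..N} = {1..N}"
      using grdD[OF J] inj by (intro endo_inj_surj image_subsetI) auto
    have "Q 1 0 w J = \<iota> (1 / u 1 / q - q * u 0) * w J"
    proof (cases "J 1 = J 0")
      case True
      \<comment> \<open>For j \<noteq> J 0 the value j already occurs at another position of the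
        surjective word J, so putting it in space 1 breaks injectivity; for j = J 0 the coefficient
        is zero.\<close>
      have "\<iota> (rexch q (1 / u 1) (u 0) j (J 0)) * w (J(1 := j, 0 := j)) = 0" if "j \<in> {1..N}" for j
      proof (cases "j = J 0")
        case False
        have "w (J(1 := j, 0 := j)) = 0"
        proof (rule ccontr)
          assume "w (J(1 := j, 0 := j)) \<noteq> 0"
          then have i: "inj_on (J(1 := j, 0 := j)) {1..N}" using w by blast
          obtain p where p: "p \<in> {1..N}" "J p = j" using surj \<open>j \<in> {1..N}\<close> by (metis imageE)
          then have "p \<noteq> 1" "p \<noteq> 0" using False True by auto
          then show False using inj_onD[OF i, of p 1] p N1 by simp
        qed
        then show ?thesis by simp
      qed (simp add: rexch_def \<iota>_zero)
      then show ?thesis using J N1 True by (simp add: Q_action rdiag_def)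
    next
      case False
      then have "w J = 0" by (intro w0) simp
      then show ?thesis using J N1 False by (simp add: Q_action)
    qed
    then show "\<iota> (\<Prod>a\<in>{1<..N}. 1 / u a - u 0) * Q 1 0 w J = \<iota> Q_scalar * w J"
      by (simp only: Q_scalar_def \<iota>_\<iota> mult.commute)
  qed
  also have "\<dots> = (\<lambda>I. \<iota> Q_scalar * A w I)" by (rule oper_\<iota>[OF oper_A])
  finally show "A (foldr (\<lambda>a. Q a 0) sites w) = (\<lambda>I. \<iota> Q_scalar * A w I)" .
qed

text \<open>Applying \<open>A\<close> to the identity for Z X Z^t S_0 reduces each product to
  scalars, f and S_0; one entry of S_0 is then isolated by a basis vector, and the two scalars
  cancel.\<close>

theorem chain_scalar_commutes:
  assumes f: "\<And>v. A (chain S1 Q sites v) = (\<lambda>I. f * A v I)"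
    and c: "R_scalar \<noteq> 0" "Q_scalar \<noteq> 0"
    and ij: "i \<in> {1..N}" "j \<in> {1..N}"
  shows "f * S 0 i j = S 0 i j * f"
proof -
  \<comment> \<open>At \<open>K m\<close> the vector A v takes the value 1 for m = j and 0
    otherwise, so evaluating at \<open>K i\<close> reads off the entry (i, j) of S_0.\<close>
  define K :: "nat \<Rightarrow> nat \<Rightarrow> nat" where "K m = (\<lambda>c. if c = 0 then m else c)" for m
  have K: "grd N (K m)" "inj_on (K m) {1..N}" if "m \<in> {1..N}" for m
    using that by (auto simp: grd_def K_def inj_on_def)
  define v :: "(nat \<Rightarrow> nat) \<Rightarrow> 'a" where "v = (\<lambda>J. of_bool (J = K j))"
  have Av: "A v (K m) = of_bool (m = j)" if m: "m \<in> {1..N}" for m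
  proof (cases "m = j")
    case True
    then show ?thesis using A_delta[OF K[OF m]] by (simp add: v_def)
  next
    case False
    have "K m \<circ> \<sigma> \<noteq> K j" if "\<sigma> permutes {1..N}" for \<sigma>
    proof
      assume "K m \<circ> \<sigma> = K j"
      then have "K m (\<sigma> 0) = K j 0" by (metis comp_apply)
      moreover have "\<sigma> 0 = 0" using permutes_not_in[OF that, of 0] by simp
      ultimately show False using False by (simp add: K_def)
    qed
    then have "Pp \<sigma> v (K m) = 0" if "\<sigma> permutes {1..N}" for \<sigma>
      using that unfolding Pp_def v_def by simp
    with False show ?thesis by (simp add: A_def)
  qed
  have Kupd: "(K i)(0 := m) = K m" for m by (auto simp: K_def)
  have S1K: "S1 0 (\<lambda>J. g * A v J) (K i) = S 0 i j * g" for g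
  proof -
    have "S1 0 (\<lambda>J. g * A v J) (K i) = (\<Sum>m=1..N. S 0 i m * g * of_bool (m = j))"
    proof -
      have "K i 0 = i" by (simp add: K_def)
      then have "S1 0 (\<lambda>J. g * A v J) (K i) = (\<Sum>m=1..N. S 0 i m * (g * A v (K m)))"
        unfolding S1_def op1_def Kupd using K(1)[OF ij(1)] by simp
      also have "\<dots> = (\<Sum>m=1..N. S 0 i m * g * of_bool (m = j))"
        by (intro sum.cong refl) (simp only: Av mult.assoc)
      finally show ?thesis .
    qed
    also have "\<dots> = S 0 i j * g" by (rule sum_of_bool_mult) (use ij in auto)
    finally show ?thesis .
  qed
  have "distinct sites" "set sites \<subseteq> {1..N}" by auto
  from chain_S1_commute[OF this, of v]
  have "A (foldr (\<lambda>c. R c 0) sites (chain S1 Q sites (foldr (\<lambda>c. Q c 0) sites (S1 0 v))))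
     = A (S1 0 (foldr (\<lambda>c. Q c 0) sites (chain S1 Q sites (foldr (\<lambda>c. R c 0) sites v))))" by simp
  also have "\<dots> = S1 0 (\<lambda>I. \<iota> Q_scalar * (f * (\<iota> R_scalar * A v I)))"
    unfolding S1_def A_op1_commute by (fold S1_def) (simp only: A_R_foldr A_Q_foldr f)
  finally have "\<iota> R_scalar * (f * (\<iota> Q_scalar * S1 0 (A v) (K i)))
     = S1 0 (\<lambda>I. \<iota> Q_scalar * (f * (\<iota> R_scalar * A v I))) (K i)"
    unfolding A_R_foldr f A_Q_foldr by (simp only: S1_def A_op1_commute fun_eq_iff)
  also have "\<dots> = S1 0 (\<lambda>I. \<iota> (Q_scalar * R_scalar) * f * A v I) (K i)"
    by (simp only: \<iota>_left_commute[of f R_scalar] \<iota>_\<iota> mult.assoc)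
  also have "\<dots> = \<iota> (Q_scalar * R_scalar) * (S 0 i j * f)"
    unfolding S1K by (simp only: mult.assoc[symmetric] \<iota>_central[of _ "S 0 i j"])
  also have "S1 0 (A v) (K i) = S 0 i j" using S1K[of 1] by simp
  also have "\<iota> R_scalar * (f * (\<iota> Q_scalar * S 0 i j)) = \<iota> (Q_scalar * R_scalar) * (f * S 0 i j)"
    by (simp only: \<iota>_left_commute[of f Q_scalar] \<iota>_\<iota> mult.commute[of R_scalar])
  finally show ?thesis by (rule \<iota>_cancel) (use c in simp)
qed

end

section \<open>The reflection equation\<close>

context scalar_embedding
begin

text \<open>Partial transposition in space a of R B_1 T_2 = T_2 B_1 R: it reverses the order of the
  factors in that space only, which puts R^t between the transposed B and T.\<close>

lemma transposed_BT:
  assumes ab: "a \<noteq> b" "a \<le> N" "b \<le> N"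
    and BT: "\<And>i j k l. i \<in> {1..N} \<Longrightarrow> j \<in> {1..N} \<Longrightarrow> k \<in> {1..N} \<Longrightarrow> l \<in> {1..N} \<Longrightarrow>
      (\<Sum>m=1..N. \<Sum>p=1..N. \<iota> (Rm q x y i m k p) * (B m j * T p l))
      = (\<Sum>m=1..N. \<Sum>p=1..N. (T k p * B i m) * \<iota> (Rm q x y m j p l))"
  shows "op1 N a (\<lambda>i j. B j i) (op2 N a b (\<lambda>i j k l. \<iota> (Rt q x y i j k l)) (op1 N b T v))
       = op1 N b T (op2 N a b (\<lambda>i j k l. \<iota> (Rt q x y i j k l)) (op1 N a (\<lambda>i j. B j i) v))"
  unfolding op2_op1_snd[OF ab(1)] op1_fst_op2[OF ab(1)] op2_op1_fst[OF ab(1,3)] op1_snd_op2[OF ab(1)]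
proof (rule op2_cong[OF ab(2,3)])
  fix i j k l assume V: "i \<in> {1..N}" "j \<in> {1..N}" "k \<in> {1..N}" "l \<in> {1..N}"
  have "(\<Sum>m=1..N. B m i * (\<Sum>p=1..N. \<iota> (Rt q x y m j k p) * T p l))
     = (\<Sum>m=1..N. \<Sum>p=1..N. \<iota> (Rm q x y j m k p) * (B m i * T p l))"
    unfolding sum_distrib_left Rt_def by (intro sum.cong refl \<iota>_left_commute)
  also have "\<dots> = (\<Sum>m=1..N. \<Sum>p=1..N. (T k p * B j m) * \<iota> (Rm q x y m i p l))"
    by (rule BT) fact+
  also have "\<dots> = (\<Sum>m=1..N. \<Sum>p=1..N. T k p * (\<iota> (Rm q x y m i p l) * B j m))"
    by (intro sum.cong refl) (simp only: \<iota>_central mult.assoc)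
  also have "\<dots> = (\<Sum>p=1..N. \<Sum>m=1..N. T k p * (\<iota> (Rt q x y i m p l) * B j m))"
    unfolding Rt_def by (rule sum.swap)
  finally show "(\<Sum>m=1..N. B m i * (\<Sum>p=1..N. \<iota> (Rt q x y m j k p) * T p l))
     = (\<Sum>p=1..N. T k p * (\<Sum>m=1..N. \<iota> (Rt q x y i m p l) * B j m))"
    unfolding sum_distrib_left .
qed

text \<open>Transposition in both spaces. \<open>Rm_flip\<close> turns the doubly transposed R into
  R with exchanged factors, and homogeneity turns the arguments (1/y, 1/x) into (x, y).\<close>

lemma transposed_BB:
  assumes ab: "a \<noteq> b" "a \<le> N" "b \<le> N" and xy: "x \<noteq> 0" "y \<noteq> 0"
    and BB: "\<And>i j k l. i \<in> {1..N} \<Longrightarrow> j \<in> {1..N} \<Longrightarrow> k \<in> {1..N} \<Longrightarrow> l \<in> {1..N} \<Longrightarrow>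
      (\<Sum>m=1..N. \<Sum>p=1..N. \<iota> (Rm q (1 / y) (1 / x) i m k p) * (B' m j * B p l))
      = (\<Sum>m=1..N. \<Sum>p=1..N. (B k p * B' i m) * \<iota> (Rm q (1 / y) (1 / x) m j p l))"
  shows "op2 N a b (\<lambda>i j k l. \<iota> (Rm q x y i j k l)) (op1 N a (\<lambda>i j. B j i) (op1 N b (\<lambda>i j. B' j i) v))
       = op1 N b (\<lambda>i j. B' j i) (op1 N a (\<lambda>i j. B j i) (op2 N a b (\<lambda>i j k l. \<iota> (Rm q x y i j k l)) v))"
  unfolding op1_op1_pair[OF ab(1)] op2_op2_same[OF ab(1)]
proof (rule op2_cong[OF ab(2,3)])
  fix i j k l assume V: "i \<in> {1..N}" "j \<in> {1..N}" "k \<in> {1..N}" "l \<in> {1..N}"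
  have e1: "Rm q x y i m k p = (x * y) * Rm q (1 / y) (1 / x) p k m i" for m p
    unfolding Rm_inverse_args[OF xy, of q i m k p] Rm_flip[of q "1 / y" "1 / x" p k m i] ..
  have e2: "Rm q x y m j p l = (x * y) * Rm q (1 / y) (1 / x) l p j m" for m p
    unfolding Rm_inverse_args[OF xy, of q m j p l] Rm_flip[of q "1 / y" "1 / x" l p j m] ..
  have "(\<Sum>m=1..N. \<Sum>p=1..N. \<iota> (Rm q x y i m k p) * (B j m * B' l p))
     = \<iota> (x * y) * (\<Sum>m=1..N. \<Sum>p=1..N. (B j m * B' l p) * \<iota> (Rm q (1 / y) (1 / x) p k m i))"
    unfolding sum_distrib_left e1
    by (intro sum.cong refl) (simp only: \<iota>_mult mult.assoc \<iota>_central[of "Rm q (1 / y) (1 / x) _ _ _ _"])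
  also have "(\<Sum>m=1..N. \<Sum>p=1..N. (B j m * B' l p) * \<iota> (Rm q (1 / y) (1 / x) p k m i))
     = (\<Sum>p=1..N. \<Sum>m=1..N. (B j m * B' l p) * \<iota> (Rm q (1 / y) (1 / x) p k m i))"
    by (rule sum.swap)
  also have "\<dots> = (\<Sum>p=1..N. \<Sum>m=1..N. \<iota> (Rm q (1 / y) (1 / x) l p j m) * (B' p k * B m i))"
    by (rule BB[symmetric]) fact+
  also have "\<dots> = (\<Sum>m=1..N. \<Sum>p=1..N. \<iota> (Rm q (1 / y) (1 / x) l p j m) * (B' p k * B m i))"
    by (rule sum.swap)
  also have "\<iota> (x * y) * \<dots> = (\<Sum>m=1..N. \<Sum>p=1..N. B' p k * B m i * \<iota> (Rm q x y m j p l))"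
    unfolding sum_distrib_left e2 \<iota>_\<iota> by (intro sum.cong refl \<iota>_central)
  finally show "(\<Sum>m=1..N. \<Sum>p=1..N. \<iota> (Rm q x y i m k p) * (B j m * B' l p))
     = (\<Sum>m=1..N. \<Sum>p=1..N. B' p k * B m i * \<iota> (Rm q x y m j p l))" .
qed

lemma G_reflection_op:
  assumes ab: "a \<noteq> b" "a \<le> N" "b \<le> N" and q: "q \<noteq> 0" and N: "ty = Symplectic \<longrightarrow> even N"
  defines "G \<equiv> \<lambda>i j. \<iota> (Gm ty q i j)"
  shows "op2 N a b (\<lambda>i j k l. \<iota> (Rm q x y i j k l)) (op1 N a G (op2 N a b (\<lambda>i j k l. \<iota> (Rt q z w i j k l)) (op1 N b G v)))
       = op1 N b G (op2 N a b (\<lambda>i j k l. \<iota> (Rt q z w i j k l)) (op1 N a G (op2 N a b (\<lambda>i j k l. \<iota> (Rm q x y i j k l)) v)))"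
proof -
  have e1: "op1 N a G (op2 N a b (\<lambda>i j k l. \<iota> (Rt q z w i j k l)) (op1 N b G v))
    = op2 N a b (\<lambda>i j k l. \<iota> (\<Sum>m=1..N. \<Sum>p=1..N. Gm ty q i m * Rt q z w m j k p * Gm ty q p l)) v" for v
    unfolding op2_op1_snd[OF ab(1)] op1_fst_op2[OF ab(1)] G_def \<iota>_mult[symmetric] \<iota>_sum[symmetric]
    by (simp only: sum_distrib_left mult.assoc)
  have e2: "op1 N b G (op2 N a b (\<lambda>i j k l. \<iota> (Rt q z w i j k l)) (op1 N a G v))
    = op2 N a b (\<lambda>i j k l. \<iota> (\<Sum>m=1..N. \<Sum>p=1..N. Gm ty q k p * Rt q z w i m p l * Gm ty q m j)) v" for v
  proof -
    have "(\<Sum>p=1..N. Gm ty q k p * (\<Sum>m=1..N. Rt q z w i m p l * Gm ty q m j))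
       = (\<Sum>m=1..N. \<Sum>p=1..N. Gm ty q k p * Rt q z w i m p l * Gm ty q m j)" for i j k l
      unfolding sum_distrib_left mult.assoc by (rule sum.swap)
    then show ?thesis
      unfolding op2_op1_fst[OF ab(1,3)] op1_snd_op2[OF ab(1)] G_def \<iota>_mult[symmetric] \<iota>_sum[symmetric]
      by simp
  qed
  show ?thesis
    unfolding e1 e2 op2_op2_same[OF ab(1)] \<iota>_mult[symmetric] \<iota>_sum[symmetric]
  proof (rule op2_cong[OF ab(2,3)], rule arg_cong[where f = \<iota>])
    fix i j k l assume V: "i \<in> {1..N}" "j \<in> {1..N}" "k \<in> {1..N}" "l \<in> {1..N}"
    show "(\<Sum>m=1..N. \<Sum>p=1..N. Rm q x y i m k p * (\<Sum>ma=1..N. \<Sum>pa=1..N. Gm ty q m ma * Rt q z w ma j p pa * Gm ty q pa l))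
      = (\<Sum>m=1..N. \<Sum>p=1..N. (\<Sum>ma=1..N. \<Sum>pa=1..N. Gm ty q k pa * Rt q z w i ma pa p * Gm ty q ma m) * Rm q x y m j p l)"
      by (rule Gm_reflection) fact+
  qed
qed

text \<open>With S = T G B^t, the mixed relation brings the T factors to the left of R^t and the
  transposed B factors to the right; R then passes T_a T_b, the constant part G_a R^t G_b, and the
  transposed B_a B_b. The mixed relation is used for both orders of the two spaces, once to sort the
  factors and once to restore S.\<close>

theorem reflection_equation:
  fixes T B :: "nat \<Rightarrow> nat \<Rightarrow> nat \<Rightarrow> 'a" and u :: "nat \<Rightarrow> 'k"
  assumes ab: "a \<noteq> b" "a \<le> N" "b \<le> N" and q: "q \<noteq> 0" and N: "ty = Symplectic \<longrightarrow> even N"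
    and u0: "u a \<noteq> 0" "u b \<noteq> 0"
    and TT: "\<And>i j k l. i \<in> {1..N} \<Longrightarrow> j \<in> {1..N} \<Longrightarrow> k \<in> {1..N} \<Longrightarrow> l \<in> {1..N} \<Longrightarrow>
      (\<Sum>m=1..N. \<Sum>p=1..N. \<iota> (Rm q (u a) (u b) i m k p) * (T a m j * T b p l))
      = (\<Sum>m=1..N. \<Sum>p=1..N. (T b k p * T a i m) * \<iota> (Rm q (u a) (u b) m j p l))"
    and BB: "\<And>i j k l. i \<in> {1..N} \<Longrightarrow> j \<in> {1..N} \<Longrightarrow> k \<in> {1..N} \<Longrightarrow> l \<in> {1..N} \<Longrightarrow>
      (\<Sum>m=1..N. \<Sum>p=1..N. \<iota> (Rm q (1 / u b) (1 / u a) i m k p) * (B b m j * B a p l))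
      = (\<Sum>m=1..N. \<Sum>p=1..N. (B a k p * B b i m) * \<iota> (Rm q (1 / u b) (1 / u a) m j p l))"
    and BT: "\<And>c d i j k l. {c, d} = {a, b} \<Longrightarrow> i \<in> {1..N} \<Longrightarrow> j \<in> {1..N} \<Longrightarrow> k \<in> {1..N} \<Longrightarrow> l \<in> {1..N} \<Longrightarrow>
      (\<Sum>m=1..N. \<Sum>p=1..N. \<iota> (Rm q (1 / u c) (u d) i m k p) * (B c m j * T d p l))
      = (\<Sum>m=1..N. \<Sum>p=1..N. (T d k p * B c i m) * \<iota> (Rm q (1 / u c) (u d) m j p l))"
    and S: "\<And>c i j. S c i j = (\<Sum>m=1..N. \<Sum>p=1..N. T c i m * \<iota> (Gm ty q m p) * B c j p)"
  shows "op2 N a b (\<lambda>i j k l. \<iota> (Rm q (u a) (u b) i j k l)) (op1 N a (S a)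
        (op2 N a b (\<lambda>i j k l. \<iota> (Rt q (1 / u a) (u b) i j k l)) (op1 N b (S b) v)))
    = op1 N b (S b) (op2 N a b (\<lambda>i j k l. \<iota> (Rt q (1 / u a) (u b) i j k l))
        (op1 N a (S a) (op2 N a b (\<lambda>i j k l. \<iota> (Rm q (u a) (u b) i j k l)) v)))"
proof -
  define Ra where "Ra = op2 N a b (\<lambda>i j k l. \<iota> (Rm q (u a) (u b) i j k l))"
  define Qa where "Qa = op2 N a b (\<lambda>i j k l. \<iota> (Rt q (1 / u a) (u b) i j k l))"
  define To where "To c = op1 N c (T c)" for c
  define Bo where "Bo c = op1 N c (\<lambda>i j. B c j i)" for c
  define Go where "Go c = op1 N c (\<lambda>i j. \<iota> (Gm ty q i j))" for c
  have So: "op1 N c (S c) v = To c (Go c (Bo c v))" for c v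
  proof -
    have "S c = (\<lambda>i j. \<Sum>m=1..N. T c i m * (\<Sum>p=1..N. \<iota> (Gm ty q m p) * B c j p))"
      by (intro ext) (simp only: S sum_distrib_left mult.assoc)
    then show ?thesis unfolding To_def Go_def Bo_def op1_op1_same by simp
  qed
  have RTT: "Ra (To a (To b v)) = To b (To a (Ra v))" for v
    unfolding Ra_def To_def op1_op1_pair[OF ab(1)] op2_op2_same[OF ab(1)]
    by (rule op2_cong[OF ab(2,3)]) (rule TT)
  have RBB: "Ra (Bo a (Bo b v)) = Bo b (Bo a (Ra v))" for v
    unfolding Ra_def Bo_def by (rule transposed_BB[OF ab u0 BB])
  have BQT: "Bo a (Qa (To b v)) = To b (Qa (Bo a v))" for v
    unfolding Qa_def Bo_def To_def by (rule transposed_BT[OF ab BT]) auto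
  \<comment> \<open>The mixed relation with the spaces exchanged involves R^t_ba, which is R^t_ab up
    to a scalar.\<close>
  have Qsw: "Qa v = (\<lambda>I. \<iota> (u b / u a) * op2 N b a (\<lambda>i j k l. \<iota> (Rt q (1 / u b) (u a) i j k l)) v I)" for v
  proof
    fix I
    have e: "Rt q (1 / u a) (u b) i j k l = (u b / u a) * Rt q (1 / u b) (u a) k l i j" for i j k l
      using Rt_inverse_args[OF u0] Rt_flip[of q "1 / u b" "u a" k l i j] by simp
    show "Qa v I = \<iota> (u b / u a) * op2 N b a (\<lambda>i j k l. \<iota> (Rt q (1 / u b) (u a) i j k l)) v I"
      unfolding Qa_def op2_swap[OF ab(1)] e \<iota>_mult op2_def mult.assoc
      by (cases "grd N I") (simp_all only: if_True if_False sum_distrib_left mult_zero_right)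
  qed
  have BQT': "Bo b (Qa (To a v)) = To a (Qa (Bo b v))" for v
  proof -
    have "Bo b (op2 N b a (\<lambda>i j k l. \<iota> (Rt q (1 / u b) (u a) i j k l)) (To a v))
        = To a (op2 N b a (\<lambda>i j k l. \<iota> (Rt q (1 / u b) (u a) i j k l)) (Bo b v))"
      unfolding Bo_def To_def by (rule transposed_BT[OF ab(1)[symmetric] ab(3,2) BT]) auto
    moreover have "oper N (Bo b)" "oper N (To a)" unfolding Bo_def To_def by (rule oper_op1)+
    ultimately show ?thesis unfolding Qsw by (simp only: oper_\<iota>)
  qed
  have GT: "Go c (To d v) = To d (Go c v)" if "c \<noteq> d" for c d v
    unfolding Go_def To_def by (rule op1_op1_commute[OF that]) (rule \<iota>_central)
  have BG: "Bo c (Go d v) = Go d (Bo c v)" if "c \<noteq> d" for c d v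
    unfolding Go_def Bo_def by (rule op1_op1_commute[OF that]) (rule \<iota>_central[symmetric])
  have RGQG: "Ra (Go a (Qa (Go b v))) = Go b (Qa (Go a (Ra v)))" for v
    unfolding Ra_def Qa_def Go_def by (rule G_reflection_op[OF ab q N])
  have "Ra (To a (Go a (Bo a (Qa (To b (Go b (Bo b v)))))))
      = To b (To a (Go b (Qa (Go a (Bo b (Bo a (Ra v)))))))"
    by (simp only: BQT GT[OF ab(1)] BG[OF ab(1)] RTT RGQG RBB)
  also have "\<dots> = To b (Go b (Bo b (Qa (To a (Go a (Bo a (Ra v)))))))"
    by (simp only: BQT' GT[OF ab(1)[symmetric]] BG[OF ab(1)[symmetric]])
  finally show ?thesis
    unfolding So Ra_def[symmetric] Qa_def[symmetric] .
qed

end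

section \<open>The quantum affine algebra as a ring\<close>

lemma free_algebra_simps:
  "carrier (free_algebra X) = {f. finite {w. f w \<noteq> 0} \<and> {w. f w \<noteq> 0} \<subseteq> lists X}"
  "f \<otimes>\<^bsub>free_algebra X\<^esub> g = (\<lambda>w. \<Sum>k\<le>length w. f (take k w) * g (drop k w))"
  "\<one>\<^bsub>free_algebra X\<^esub> = (\<lambda>w. of_bool (w = []))"
  "\<zero>\<^bsub>free_algebra X\<^esub> = (\<lambda>w. 0)"
  "f \<oplus>\<^bsub>free_algebra X\<^esub> g = (\<lambda>w. f w + g w)"
  by (simp_all add: free_algebra_def)

lemma free_algebra_mult_closed:
  assumes f: "f \<in> carrier (free_algebra X)" and g: "g \<in> carrier (free_algebra X)"
  shows "f \<otimes>\<^bsub>free_algebra X\<^esub> g \<in> carrier (free_algebra X)"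
proof -
  let ?F = "{w. f w \<noteq> 0}" and ?G = "{w. g w \<noteq> 0}"
  have fin: "finite ?F" "finite ?G" and sub: "?F \<subseteq> lists X" "?G \<subseteq> lists X"
    using assms by (auto simp: free_algebra_simps)
  have s: "{w. (f \<otimes>\<^bsub>free_algebra X\<^esub> g) w \<noteq> 0} \<subseteq> (\<lambda>(x, y). x @ y) ` (?F \<times> ?G)"
  proof
    fix w assume "w \<in> {w. (f \<otimes>\<^bsub>free_algebra X\<^esub> g) w \<noteq> 0}"
    then have "(\<Sum>k\<le>length w. f (take k w) * g (drop k w)) \<noteq> 0" by (simp add: free_algebra_simps)
    then obtain k where "f (take k w) * g (drop k w) \<noteq> 0" by (metis (no_types, lifting) sum.neutral)
    then show "w \<in> (\<lambda>(x, y). x @ y) ` (?F \<times> ?G)"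
      by (intro image_eqI[of _ _ "(take k w, drop k w)"]) auto
  qed
  moreover have "finite ((\<lambda>(x, y). x @ y) ` (?F \<times> ?G))" using fin by blast
  moreover have "(\<lambda>(x, y). x @ y) ` (?F \<times> ?G) \<subseteq> lists X"
    using sub by (auto dest!: subsetD)
  ultimately show ?thesis unfolding free_algebra_simps(1) using finite_subset by blast
qed

lemma free_algebra_ring: "ring (free_algebra X)"
proof (rule ringI)
  show "abelian_group (free_algebra X)"
  proof (rule abelian_groupI)
    fix f g assume "f \<in> carrier (free_algebra X)" "g \<in> carrier (free_algebra X)"
    then have "finite {w. f w \<noteq> 0}" "finite {w. g w \<noteq> 0}" "{w. f w \<noteq> 0} \<subseteq> lists X" "{w. g w \<noteq> 0} \<subseteq> lists X"
      by (auto simp: free_algebra_simps)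
    moreover have "{w. f w + g w \<noteq> 0} \<subseteq> {w. f w \<noteq> 0} \<union> {w. g w \<noteq> 0}" by auto
    ultimately show "f \<oplus>\<^bsub>free_algebra X\<^esub> g \<in> carrier (free_algebra X)"
      unfolding free_algebra_simps(1,5) using finite_subset[of _ "{w. f w \<noteq> 0} \<union> {w. g w \<noteq> 0}"] by blast
  next
    fix f assume "f \<in> carrier (free_algebra X)"
    then show "\<exists>g\<in>carrier (free_algebra X). g \<oplus>\<^bsub>free_algebra X\<^esub> f = \<zero>\<^bsub>free_algebra X\<^esub>"
      by (intro bexI[of _ "\<lambda>w. - f w"]) (auto simp: free_algebra_simps)
  qed (auto simp: free_algebra_simps add.assoc)
  show "monoid (free_algebra X)"
  proof (rule monoidI)
    fix f g h :: "'a list \<Rightarrow> complex"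
    show "(f \<otimes>\<^bsub>free_algebra X\<^esub> g) \<otimes>\<^bsub>free_algebra X\<^esub> h = f \<otimes>\<^bsub>free_algebra X\<^esub> (g \<otimes>\<^bsub>free_algebra X\<^esub> h)"
    proof
      fix w :: "'a list"
      let ?n = "length w"
      have "((f \<otimes>\<^bsub>free_algebra X\<^esub> g) \<otimes>\<^bsub>free_algebra X\<^esub> h) w
          = (\<Sum>k\<le>?n. \<Sum>j\<le>k. f (take j w) * g (drop j (take k w)) * h (drop k w))"
        by (auto simp: free_algebra_simps sum_distrib_right min_def intro!: sum.cong)
      also have "\<dots> = (\<Sum>(k, j)\<in>(SIGMA k:{..?n}. {..k}). f (take j w) * g (drop j (take k w)) * h (drop k w))"
        by (rule sum.Sigma) auto
      \<comment> \<open>Both bracketings sum over the ways of cutting the word into three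
        pieces.\<close>
      also have "\<dots> = (\<Sum>(j, k)\<in>(SIGMA j:{..?n}. {..?n - j}). f (take j w) * (g (take k (drop j w)) * h (drop k (drop j w))))"
        by (rule sum.reindex_bij_witness[of _ "\<lambda>(j, k). (j + k, j)" "\<lambda>(k, j). (j, k - j)"])
          (auto simp: drop_take add.commute)
      also have "\<dots> = (\<Sum>j\<le>?n. \<Sum>k\<le>?n - j. f (take j w) * (g (take k (drop j w)) * h (drop k (drop j w))))"
        by (rule sum.Sigma[symmetric]) auto
      also have "\<dots> = (f \<otimes>\<^bsub>free_algebra X\<^esub> (g \<otimes>\<^bsub>free_algebra X\<^esub> h)) w"
        by (simp add: free_algebra_simps sum_distrib_left)
      finally show "((f \<otimes>\<^bsub>free_algebra X\<^esub> g) \<otimes>\<^bsub>free_algebra X\<^esub> h) w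
          = (f \<otimes>\<^bsub>free_algebra X\<^esub> (g \<otimes>\<^bsub>free_algebra X\<^esub> h)) w" .
    qed
  next
    fix f :: "'a list \<Rightarrow> complex"
    show "\<one>\<^bsub>free_algebra X\<^esub> \<otimes>\<^bsub>free_algebra X\<^esub> f = f"
    proof
      fix w :: "'a list"
      have "(\<Sum>k\<le>length w. of_bool (take k w = []) * f (drop k w)) = (\<Sum>k\<le>length w. if k = 0 then f w else 0)"
        by (intro sum.cong refl) auto
      then show "(\<one>\<^bsub>free_algebra X\<^esub> \<otimes>\<^bsub>free_algebra X\<^esub> f) w = f w" by (simp add: free_algebra_simps)
    qed
    show "f \<otimes>\<^bsub>free_algebra X\<^esub> \<one>\<^bsub>free_algebra X\<^esub> = f"
    proof
      fix w :: "'a list"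
      have "(\<Sum>k\<le>length w. f (take k w) * of_bool (drop k w = [])) = (\<Sum>k\<le>length w. if k = length w then f w else 0)"
        by (intro sum.cong refl) auto
      then show "(f \<otimes>\<^bsub>free_algebra X\<^esub> \<one>\<^bsub>free_algebra X\<^esub>) w = f w" by (simp add: free_algebra_simps)
    qed
  qed ((rule free_algebra_mult_closed; assumption) | simp add: free_algebra_simps(1,3))+
qed (auto simp: free_algebra_simps distrib_left distrib_right sum.distrib)

lemma free_scalar_carrier: "free_scalar c \<in> carrier (free_algebra X)"
proof -
  have "{w. free_scalar c w \<noteq> 0} \<subseteq> {[]}" by (auto simp: free_scalar_def)
  then show ?thesis unfolding free_algebra_simps(1) by (auto intro: finite_subset)
qed

lemma free_gen_carrier: "x \<in> X \<Longrightarrow> free_gen x \<in> carrier (free_algebra X)"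
  by (auto simp: free_gen_def free_algebra_simps(1))

lemma free_scalar_mult:
  "free_scalar c \<otimes>\<^bsub>free_algebra X\<^esub> f = (\<lambda>w. c * f w)" "f \<otimes>\<^bsub>free_algebra X\<^esub> free_scalar c = (\<lambda>w. f w * c)"
proof -
  have "(\<Sum>k\<le>length w. free_scalar c (take k w) * f (drop k w)) = (\<Sum>k\<le>length w. if k = 0 then c * f w else 0)" for w
    by (intro sum.cong refl) (auto simp: free_scalar_def)
  then show "free_scalar c \<otimes>\<^bsub>free_algebra X\<^esub> f = (\<lambda>w. c * f w)" by (simp add: free_algebra_simps)
  have "(\<Sum>k\<le>length w. f (take k w) * free_scalar c (drop k w)) = (\<Sum>k\<le>length w. if k = length w then f w * c else 0)" for w
    by (intro sum.cong refl) (auto simp: free_scalar_def)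
  then show "f \<otimes>\<^bsub>free_algebra X\<^esub> free_scalar c = (\<lambda>w. f w * c)" by (simp add: free_algebra_simps)
qed

lemma free_scalar_add: "free_scalar (c + d) = free_scalar c \<oplus>\<^bsub>free_algebra X\<^esub> free_scalar d"
  and free_scalar_prod: "free_scalar (c * d) = free_scalar c \<otimes>\<^bsub>free_algebra X\<^esub> free_scalar d"
  and free_scalar_one: "free_scalar 1 = \<one>\<^bsub>free_algebra X\<^esub>"
  unfolding free_scalar_mult by (auto simp: free_scalar_def free_algebra_simps(3,5) fun_eq_iff)

lemma t_free_carrier:
  assumes "i \<in> {1..N}" "j \<in> {1..N}"
  shows "t_free i j a \<in> carrier (uq_free N)" "tbar_free i j a \<in> carrier (uq_free N)"
proof -
  have z: "(\<lambda>w. 0) \<in> carrier (uq_free N)" by (simp add: free_algebra_simps(1))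
  show "t_free i j a \<in> carrier (uq_free N)" "tbar_free i j a \<in> carrier (uq_free N)"
    using assms z by (auto simp: t_free_def tbar_free_def uq_gens_def intro!: free_gen_carrier)
qed

lemma RXY_carrier:
  assumes "\<And>i j a. i \<in> {1..N} \<Longrightarrow> j \<in> {1..N} \<Longrightarrow> X i j a \<in> carrier (uq_free N)"
    "\<And>i j a. i \<in> {1..N} \<Longrightarrow> j \<in> {1..N} \<Longrightarrow> Y i j a \<in> carrier (uq_free N)"
    and "i \<in> {1..N}" "j \<in> {1..N}" "k \<in> {1..N}" "l \<in> {1..N}"
  shows "RXY q N X Y i j k l a b \<in> carrier (uq_free N)" "YXR q N X Y i j k l a b \<in> carrier (uq_free N)"
proof -
  interpret ring "uq_free N" by (rule free_algebra_ring)
  show "RXY q N X Y i j k l a b \<in> carrier (uq_free N)" "YXR q N X Y i j k l a b \<in> carrier (uq_free N)"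
    unfolding RXY_def YXR_def using assms by (auto intro!: finsum_closed a_closed m_closed free_scalar_carrier)
qed

lemma uq_relators_carrier: "uq_relators q N \<subseteq> carrier (uq_free N)"
proof -
  interpret ring "uq_free N" by (rule free_algebra_ring)
  have g: "free_gen (Tgen i j r) \<in> carrier (uq_free N)" "free_gen (Tbargen i j r) \<in> carrier (uq_free N)"
    if "i \<in> {1..N}" "j \<in> {1..N}" for i j r
    using that by (auto simp: uq_gens_def intro!: free_gen_carrier)
  have r: "RXY_relators q N X Y \<subseteq> carrier (uq_free N)"
    if "\<And>i j a. i \<in> {1..N} \<Longrightarrow> j \<in> {1..N} \<Longrightarrow> X i j a \<in> carrier (uq_free N)"
      "\<And>i j a. i \<in> {1..N} \<Longrightarrow> j \<in> {1..N} \<Longrightarrow> Y i j a \<in> carrier (uq_free N)" for X Y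
    unfolding RXY_relators_def using RXY_carrier[of N X Y] that by (blast intro: minus_closed)
  show ?thesis
    unfolding uq_relators_def Un_subset_iff
    using r[OF t_free_carrier(1) t_free_carrier(1)] r[OF t_free_carrier(2) t_free_carrier(2)]
      r[OF t_free_carrier(2) t_free_carrier(1)]
    by (auto intro!: g minus_closed m_closed)
qed

lemma uq_ideal: "ideal (uq_ideal q N) (uq_free N)"
  unfolding uq_ideal_def by (rule ring.genideal_ideal[OF free_algebra_ring uq_relators_carrier])

lemma Uq_ring: "ring (Uq q N)"
  unfolding Uq_def by (rule ideal.quotient_is_ring[OF uq_ideal])

lemma uq_class_hom: "uq_class q N \<in> ring_hom (uq_free N) (Uq q N)"
  using ideal.rcos_ring_hom[OF uq_ideal[of q N]] unfolding Uq_def uq_class_def[abs_def] .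

lemma uq_class_carrier: "f \<in> carrier (uq_free N) \<Longrightarrow> uq_class q N f \<in> carrier (Uq q N)"
  and uq_class_mult: "f \<in> carrier (uq_free N) \<Longrightarrow> g \<in> carrier (uq_free N) \<Longrightarrow>
    uq_class q N (f \<otimes>\<^bsub>uq_free N\<^esub> g) = uq_class q N f \<otimes>\<^bsub>Uq q N\<^esub> uq_class q N g"
  and uq_class_add: "f \<in> carrier (uq_free N) \<Longrightarrow> g \<in> carrier (uq_free N) \<Longrightarrow>
    uq_class q N (f \<oplus>\<^bsub>uq_free N\<^esub> g) = uq_class q N f \<oplus>\<^bsub>Uq q N\<^esub> uq_class q N g"
  and uq_class_one: "uq_class q N \<one>\<^bsub>uq_free N\<^esub> = \<one>\<^bsub>Uq q N\<^esub>"
  using uq_class_hom[of q N] by (auto simp: ring_hom_def)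

lemma uq_class_zero: "uq_class q N (\<lambda>w. 0) = \<zero>\<^bsub>Uq q N\<^esub>"
  using ring_hom_zero[OF uq_class_hom free_algebra_ring Uq_ring, of q N] by (simp only: free_algebra_simps(4))

lemma uq_class_eqI:
  assumes "f \<ominus>\<^bsub>uq_free N\<^esub> g \<in> uq_relators q N" "f \<in> carrier (uq_free N)" "g \<in> carrier (uq_free N)"
  shows "uq_class q N f = uq_class q N g"
proof -
  have "f \<ominus>\<^bsub>uq_free N\<^esub> g \<in> uq_ideal q N"
    using assms(1) ring.genideal_self[OF free_algebra_ring uq_relators_carrier] unfolding uq_ideal_def by blast
  then show ?thesis
    unfolding uq_class_def
    using ring.quotient_eq_iff_same_a_r_cos[OF free_algebra_ring uq_ideal assms(2,3)] by blast
qed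

lemma uq_scalar_carrier: "uq_scalar q N c \<in> carrier (Uq q N)"
  unfolding uq_scalar_def by (intro uq_class_carrier free_scalar_carrier)

lemma Uq_surj: "x \<in> carrier (Uq q N) \<Longrightarrow> \<exists>f\<in>carrier (uq_free N). x = uq_class q N f"
  unfolding Uq_def FactRing_def A_RCOSETS_def' uq_class_def by auto

lemma uq_scalar_central:
  assumes "x \<in> carrier (Uq q N)"
  shows "uq_scalar q N c \<otimes>\<^bsub>Uq q N\<^esub> x = x \<otimes>\<^bsub>Uq q N\<^esub> uq_scalar q N c"
proof -
  obtain f where f: "f \<in> carrier (uq_free N)" "x = uq_class q N f" using Uq_surj[OF assms] by blast
  have "free_scalar c \<otimes>\<^bsub>uq_free N\<^esub> f = f \<otimes>\<^bsub>uq_free N\<^esub> free_scalar c"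
    unfolding free_scalar_mult by (simp add: mult.commute)
  then show ?thesis unfolding f(2) uq_scalar_def
    by (simp add: uq_class_mult[symmetric] f(1) free_scalar_carrier)
qed

lemma uq_scalar_add: "uq_scalar q N (c + d) = uq_scalar q N c \<oplus>\<^bsub>Uq q N\<^esub> uq_scalar q N d"
  and uq_scalar_mult: "uq_scalar q N (c * d) = uq_scalar q N c \<otimes>\<^bsub>Uq q N\<^esub> uq_scalar q N d"
  and uq_scalar_one: "uq_scalar q N 1 = \<one>\<^bsub>Uq q N\<^esub>"
  unfolding uq_scalar_def
  by (simp_all only: free_scalar_add[of c d "uq_gens N"] free_scalar_prod[of c d "uq_gens N"]
      free_scalar_one[of "uq_gens N"] uq_class_add uq_class_mult uq_class_one free_scalar_carrier)

text \<open>For N = 0 there are neither generators nor relators, so the unit survives in the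
  quotient. One nontrivial coordinate gives 0 \<noteq> 1 in the product ring, as class
  \<open>ring_1\<close> demands.\<close>

lemma Uq_0_nontrivial: "\<zero>\<^bsub>Uq q 0\<^esub> \<noteq> \<one>\<^bsub>Uq q 0\<^esub>"
proof
  let ?F = "uq_free 0"
  interpret ring ?F by (rule free_algebra_ring)
  have "uq_relators q 0 = {}" by (auto simp: uq_relators_def RXY_relators_def)
  then have I: "uq_ideal q 0 \<subseteq> {\<zero>\<^bsub>?F\<^esub>}"
    unfolding uq_ideal_def by (intro genideal_minimal zeroideal) auto
  assume "\<zero>\<^bsub>Uq q 0\<^esub> = \<one>\<^bsub>Uq q 0\<^esub>"
  then have "uq_class q 0 \<one>\<^bsub>?F\<^esub> = uq_class q 0 \<zero>\<^bsub>?F\<^esub>"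
    using uq_class_one[of q 0] uq_class_zero[of q 0] by (simp only: free_algebra_simps(4))
  then have "\<one>\<^bsub>?F\<^esub> \<ominus>\<^bsub>?F\<^esub> \<zero>\<^bsub>?F\<^esub> \<in> uq_ideal q 0"
    unfolding uq_class_def using quotient_eq_iff_same_a_r_cos[OF uq_ideal] by blast
  moreover have "\<one>\<^bsub>?F\<^esub> \<ominus>\<^bsub>?F\<^esub> \<zero>\<^bsub>?F\<^esub> = \<one>\<^bsub>?F\<^esub>" by algebra
  ultimately have "\<one>\<^bsub>?F\<^esub> = \<zero>\<^bsub>?F\<^esub>" using I by auto
  then have "(\<one>\<^bsub>?F\<^esub>) [] = (\<zero>\<^bsub>?F\<^esub>) []" by (rule arg_cong)
  then show False by (simp add: free_algebra_simps(3,4))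
qed

text \<open>The algebras \<open>Uq q N\<close> for all \<open>q\<close> and \<open>N\<close> are the coordinates of one product ring,
  which does not depend on parameters and hence can be made a type of class \<open>ring_1\<close>.\<close>

typedef uqs = "{F :: complex \<times> nat \<Rightarrow> uq. \<forall>q N. F (q, N) \<in> carrier (Uq q N)}"
proof -
  have "(\<lambda>(q, N). \<zero>\<^bsub>Uq q N\<^esub>) \<in> {F :: complex \<times> nat \<Rightarrow> uq. \<forall>q N. F (q, N) \<in> carrier (Uq q N)}"
    using ring.ring_simprules(2)[OF Uq_ring] by simp
  then show ?thesis by blast
qed

definition coord :: "complex \<Rightarrow> nat \<Rightarrow> uqs \<Rightarrow> uq" where
  "coord q N x = Rep_uqs x (q, N)"

lemma coord_carrier [simp]: "coord q N x \<in> carrier (Uq q N)"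
  using Rep_uqs[of x] by (simp add: coord_def)

lemma uqs_eqI: "(\<And>q N. coord q N x = coord q N y) \<Longrightarrow> x = y"
  unfolding coord_def by (metis Rep_uqs_inject ext surj_pair)

lemma coord_Abs: "(\<And>q N. F q N \<in> carrier (Uq q N)) \<Longrightarrow> coord q N (Abs_uqs (\<lambda>(q, N). F q N)) = F q N"
  unfolding coord_def by (subst Abs_uqs_inverse) auto

instantiation uqs :: ring_1
begin

definition "0 = Abs_uqs (\<lambda>(q, N). \<zero>\<^bsub>Uq q N\<^esub>)"
definition "1 = Abs_uqs (\<lambda>(q, N). \<one>\<^bsub>Uq q N\<^esub>)"
definition "x + y = Abs_uqs (\<lambda>(q, N). coord q N x \<oplus>\<^bsub>Uq q N\<^esub> coord q N y)"
definition "x * y = Abs_uqs (\<lambda>(q, N). coord q N x \<otimes>\<^bsub>Uq q N\<^esub> coord q N y)"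
definition "- x = Abs_uqs (\<lambda>(q, N). \<ominus>\<^bsub>Uq q N\<^esub> coord q N x)"
definition "x - (y :: uqs) = x + - y"

lemma coord_simps:
  "coord q N 0 = \<zero>\<^bsub>Uq q N\<^esub>" "coord q N 1 = \<one>\<^bsub>Uq q N\<^esub>"
  "coord q N (x + y) = coord q N x \<oplus>\<^bsub>Uq q N\<^esub> coord q N y"
  "coord q N (x * y) = coord q N x \<otimes>\<^bsub>Uq q N\<^esub> coord q N y"
  "coord q N (- x) = \<ominus>\<^bsub>Uq q N\<^esub> coord q N x"
proof -
  have R: "ring (Uq q N)" for q N by (rule Uq_ring)
  show "coord q N 0 = \<zero>\<^bsub>Uq q N\<^esub>" unfolding zero_uqs_def
    by (rule coord_Abs) (rule ring.ring_simprules(2)[OF R])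
  show "coord q N 1 = \<one>\<^bsub>Uq q N\<^esub>" unfolding one_uqs_def
    by (rule coord_Abs) (rule ring.ring_simprules(6)[OF R])
  show "coord q N (x + y) = coord q N x \<oplus>\<^bsub>Uq q N\<^esub> coord q N y" unfolding plus_uqs_def
    by (rule coord_Abs) (rule ring.ring_simprules(1)[OF R]; simp)
  show "coord q N (x * y) = coord q N x \<otimes>\<^bsub>Uq q N\<^esub> coord q N y" unfolding times_uqs_def
    by (rule coord_Abs) (rule ring.ring_simprules(5)[OF R]; simp)
  show "coord q N (- x) = \<ominus>\<^bsub>Uq q N\<^esub> coord q N x" unfolding uminus_uqs_def
    by (rule coord_Abs) (rule ring.ring_simprules(3)[OF R]; simp)
qed

instance
proof
  fix x y z :: uqs
  have R: "ring (Uq q N)" for q N by (rule Uq_ring)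
  note c = coord_simps ring.ring_simprules[OF R]
  show "x + y + z = x + (y + z)" by (rule uqs_eqI) (simp add: c)
  show "x + y = y + x" by (rule uqs_eqI) (simp add: c)
  show "0 + x = x" by (rule uqs_eqI) (simp add: c)
  show "- x + x = 0" by (rule uqs_eqI) (simp add: c)
  show "x - y = x + - y" by (simp add: minus_uqs_def)
  show "x * y * z = x * (y * z)" by (rule uqs_eqI) (simp add: c)
  show "1 * x = x" by (rule uqs_eqI) (simp add: c)
  show "x * 1 = x" by (rule uqs_eqI) (simp add: coord_simps monoid.r_one[OF ring.is_monoid[OF R]])
  show "(x + y) * z = x * z + y * z" by (rule uqs_eqI) (simp add: c)
  show "x * (y + z) = x * y + x * z" by (rule uqs_eqI) (simp add: c)
  show "(0::uqs) \<noteq> 1"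
  proof
    assume "(0::uqs) = 1"
    then have "coord 0 0 0 = coord 0 0 1" by simp
    then show False using Uq_0_nontrivial by (simp add: coord_simps)
  qed
qed

end

lemma coord_sum:
  assumes "finite A"
  shows "coord q N (sum f A) = (\<Oplus>\<^bsub>Uq q N\<^esub> x\<in>A. coord q N (f x))"
proof -
  interpret ring "Uq q N" by (rule Uq_ring)
  show ?thesis using assms
    by (induction A rule: finite_induct) (simp_all add: coord_simps finsum_insert)
qed

text \<open>The scalar is placed in every coordinate at once, so that the embedding is
  unital.\<close>

definition sc :: "complex \<Rightarrow> uqs" where
  "sc c = Abs_uqs (\<lambda>(q, N). uq_scalar q N c)"

lemma coord_sc: "coord q N (sc c) = uq_scalar q N c"
  unfolding sc_def by (rule coord_Abs) (rule uq_scalar_carrier)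

lemma sc_add: "sc (c + d) = sc c + sc d"
  and sc_mult: "sc (c * d) = sc c * sc d"
  and sc_one: "sc 1 = 1"
  and sc_central: "sc c * x = x * sc c"
  by (auto intro!: uqs_eqI simp: coord_simps coord_sc uq_scalar_add uq_scalar_mult uq_scalar_one uq_scalar_central)

lemma sc_zero: "sc 0 = 0"
  using sc_add[of 0 0] by simp

lemma sc_sum: "sc (sum f A) = (\<Sum>x\<in>A. sc (f x))"
  by (induction A rule: infinite_finite_induct) (simp_all add: sc_zero sc_add)

text \<open>Concentrated in one coordinate, this preserves sums and products but sends 1 to an
  idempotent. The quadratic RTT-type relations survive, as they involve only sums, products and
  multiplication by scalars.\<close>

definition cls :: "complex \<Rightarrow> nat \<Rightarrow> (uq_gen list \<Rightarrow> complex) \<Rightarrow> uqs" where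
  "cls q N f = Abs_uqs (\<lambda>(q', N'). if (q', N') = (q, N) then uq_class q N f else \<zero>\<^bsub>Uq q' N'\<^esub>)"

lemma coord_cls:
  assumes "f \<in> carrier (uq_free N)"
  shows "coord q' N' (cls q N f) = (if (q', N') = (q, N) then uq_class q N f else \<zero>\<^bsub>Uq q' N'\<^esub>)"
  unfolding cls_def
  by (rule coord_Abs) (use assms ring.ring_simprules(2)[OF Uq_ring] in \<open>auto intro: uq_class_carrier\<close>)

lemma cls_mult:
  assumes "f \<in> carrier (uq_free N)" "g \<in> carrier (uq_free N)"
  shows "cls q N (f \<otimes>\<^bsub>uq_free N\<^esub> g) = cls q N f * cls q N g"
proof (rule uqs_eqI)
  fix q' N'
  interpret F: ring "uq_free N" by (rule free_algebra_ring)
  interpret ring "Uq q' N'" by (rule Uq_ring)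
  show "coord q' N' (cls q N (f \<otimes>\<^bsub>uq_free N\<^esub> g)) = coord q' N' (cls q N f * cls q N g)"
    using assms by (auto simp: coord_simps coord_cls uq_class_mult)
qed

lemma cls_add:
  assumes "f \<in> carrier (uq_free N)" "g \<in> carrier (uq_free N)"
  shows "cls q N (f \<oplus>\<^bsub>uq_free N\<^esub> g) = cls q N f + cls q N g"
proof (rule uqs_eqI)
  fix q' N'
  interpret F: ring "uq_free N" by (rule free_algebra_ring)
  interpret ring "Uq q' N'" by (rule Uq_ring)
  show "coord q' N' (cls q N (f \<oplus>\<^bsub>uq_free N\<^esub> g)) = coord q' N' (cls q N f + cls q N g)"
    using assms by (auto simp: coord_simps coord_cls uq_class_add)
qed

lemma cls_zero: "cls q N (\<lambda>w. 0) = 0"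
proof (rule uqs_eqI)
  fix q' N'
  have "(\<lambda>w. 0) \<in> carrier (uq_free N)" by (simp add: free_algebra_simps(1))
  then show "coord q' N' (cls q N (\<lambda>w. 0)) = coord q' N' 0"
    by (auto simp: coord_cls coord_simps uq_class_zero)
qed

lemma cls_finsum:
  assumes "finite A" "\<And>x. x \<in> A \<Longrightarrow> f x \<in> carrier (uq_free N)"
  shows "cls q N (\<Oplus>\<^bsub>uq_free N\<^esub> x\<in>A. f x) = (\<Sum>x\<in>A. cls q N (f x))"
proof -
  interpret ring "uq_free N" by (rule free_algebra_ring)
  show ?thesis using assms
    by (induction A rule: finite_induct) (simp_all add: finsum_insert cls_add finsum_closed free_algebra_simps(4) cls_zero Pi_I)
qed

lemma cls_finsum2:
  assumes "finite A" "finite B" "\<And>x y. x \<in> A \<Longrightarrow> y \<in> B \<Longrightarrow> f x y \<in> carrier (uq_free N)"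
  shows "cls q N (\<Oplus>\<^bsub>uq_free N\<^esub> x\<in>A. \<Oplus>\<^bsub>uq_free N\<^esub> y\<in>B. f x y) = (\<Sum>x\<in>A. \<Sum>y\<in>B. cls q N (f x y))"
proof -
  interpret ring "uq_free N" by (rule free_algebra_ring)
  have "cls q N (\<Oplus>\<^bsub>uq_free N\<^esub> x\<in>A. \<Oplus>\<^bsub>uq_free N\<^esub> y\<in>B. f x y) = (\<Sum>x\<in>A. cls q N (\<Oplus>\<^bsub>uq_free N\<^esub> y\<in>B. f x y))"
    using assms by (intro cls_finsum finsum_closed) auto
  also have "\<dots> = (\<Sum>x\<in>A. \<Sum>y\<in>B. cls q N (f x y))"
    using assms by (intro sum.cong refl cls_finsum) auto
  finally show ?thesis .
qed

lemma cls_scalar: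
  assumes "f \<in> carrier (uq_free N)"
  shows "cls q N (free_scalar c \<otimes>\<^bsub>uq_free N\<^esub> f) = sc c * cls q N f"
    "cls q N (f \<otimes>\<^bsub>uq_free N\<^esub> free_scalar c) = cls q N f * sc c"
proof -
  interpret F: ring "uq_free N" by (rule free_algebra_ring)
  show "cls q N (free_scalar c \<otimes>\<^bsub>uq_free N\<^esub> f) = sc c * cls q N f"
  proof (rule uqs_eqI)
    fix q' N'
    interpret ring "Uq q' N'" by (rule Uq_ring)
    show "coord q' N' (cls q N (free_scalar c \<otimes>\<^bsub>uq_free N\<^esub> f)) = coord q' N' (sc c * cls q N f)"
      using assms by (auto simp: coord_simps coord_cls uq_class_mult coord_sc free_scalar_carrier uq_scalar_carrier uq_scalar_def[symmetric])
  qed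
  moreover have "f \<otimes>\<^bsub>uq_free N\<^esub> free_scalar c = free_scalar c \<otimes>\<^bsub>uq_free N\<^esub> f"
    unfolding free_scalar_mult by (simp add: mult.commute)
  ultimately show "cls q N (f \<otimes>\<^bsub>uq_free N\<^esub> free_scalar c) = cls q N f * sc c"
    by (simp add: sc_central)
qed

lemma RXY_relation:
  assumes X: "\<And>i j a. i \<in> {1..N} \<Longrightarrow> j \<in> {1..N} \<Longrightarrow> X i j a \<in> carrier (uq_free N)"
    and Y: "\<And>i j a. i \<in> {1..N} \<Longrightarrow> j \<in> {1..N} \<Longrightarrow> Y i j a \<in> carrier (uq_free N)"
    and rel: "RXY_relators q N X Y \<subseteq> uq_relators q N"
    and V: "i \<in> {1..N}" "j \<in> {1..N}" "k \<in> {1..N}" "l \<in> {1..N}"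
  defines "x \<equiv> \<lambda>i j a. cls q N (X i j a)" and "y \<equiv> \<lambda>i j a. cls q N (Y i j a)"
  shows "(\<Sum>m=1..N. \<Sum>p=1..N. sc (Rmat q 1 0 i m k p) * (x m j (a - 1) * y p l b)
            + sc (Rmat q 0 1 i m k p) * (x m j a * y p l (b - 1)))
       = (\<Sum>m=1..N. \<Sum>p=1..N. (y k p b * x i m (a - 1)) * sc (Rmat q 1 0 m j p l)
            + (y k p (b - 1) * x i m a) * sc (Rmat q 0 1 m j p l))"
proof -
  interpret F: ring "uq_free N" by (rule free_algebra_ring)
  have "RXY q N X Y i j k l a b \<ominus>\<^bsub>uq_free N\<^esub> YXR q N X Y i j k l a b \<in> uq_relators q N"
    using rel V unfolding RXY_relators_def by blast
  then have "uq_class q N (RXY q N X Y i j k l a b) = uq_class q N (YXR q N X Y i j k l a b)"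
    by (rule uq_class_eqI) (rule RXY_carrier[of N X Y]; fact)+
  then have "cls q N (RXY q N X Y i j k l a b) = cls q N (YXR q N X Y i j k l a b)"
    by (simp only: cls_def)
  moreover have "cls q N (RXY q N X Y i j k l a b) = (\<Sum>m=1..N. \<Sum>p=1..N. sc (Rmat q 1 0 i m k p) * (x m j (a - 1) * y p l b)
            + sc (Rmat q 0 1 i m k p) * (x m j a * y p l (b - 1)))"
    unfolding RXY_def x_def y_def using X Y V
    by (subst cls_finsum2) (auto simp: cls_add cls_scalar free_scalar_carrier intro!: sum.cong, simp add: cls_mult)
  moreover have "cls q N (YXR q N X Y i j k l a b) = (\<Sum>m=1..N. \<Sum>p=1..N. (y k p b * x i m (a - 1)) * sc (Rmat q 1 0 m j p l)
            + (y k p (b - 1) * x i m a) * sc (Rmat q 0 1 m j p l))"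
    unfolding YXR_def x_def y_def using X Y V
    by (subst cls_finsum2) (auto simp: cls_add cls_scalar free_scalar_carrier intro!: sum.cong, simp add: cls_mult)
  ultimately show ?thesis by simp
qed

section \<open>Formal series\<close>

unbundle fps_syntax

text \<open>The summation bounds may be any lower bounds of the supports, so that products with
  different subdegrees can be compared over one common range.\<close>

lemma fls_times_nth_lower:
  fixes f g :: "'b::ring_1 fls"
  assumes f: "\<And>i. i < A \<Longrightarrow> f $$ i = 0" and g: "\<And>i. i < B \<Longrightarrow> g $$ i = 0"
  shows "(f * g) $$ n = (\<Sum>i=A..n - B. f $$ i * g $$ (n - i))"
proof (cases "f = 0 \<or> g = 0")
  case False
  have df: "A \<le> fls_subdegree f" "B \<le> fls_subdegree g"
    using False f g by (auto intro!: fls_subdegree_geI)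
  show ?thesis
    unfolding fls_times_nth(2)
  proof (rule sum.mono_neutral_left)
    show "\<forall>i\<in>{A..n - B} - {fls_subdegree f..n - fls_subdegree g}. f $$ i * g $$ (n - i) = 0"
    proof
      fix i assume "i \<in> {A..n - B} - {fls_subdegree f..n - fls_subdegree g}"
      then have "i < fls_subdegree f \<or> n - i < fls_subdegree g" by auto
      then show "f $$ i * g $$ (n - i) = 0" by auto
    qed
  qed (use df in auto)
qed auto

lemma fls_times_nth_lower':
  fixes f g :: "'b::ring_1 fls"
  assumes f: "\<And>i. i < A \<Longrightarrow> f $$ i = 0" and g: "\<And>i. i < B \<Longrightarrow> g $$ i = 0"
  shows "(f * g) $$ n = (\<Sum>i=B..n - A. f $$ (n - i) * g $$ i)"
proof -
  have "(f * g) $$ n = (\<Sum>i=A..n - B. f $$ i * g $$ (n - i))"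
    by (rule fls_times_nth_lower) (fact f g)+
  also have "\<dots> = (\<Sum>i=B..n - A. f $$ (n - i) * g $$ i)"
    by (rule sum.reindex_bij_witness[of _ "\<lambda>i. n - i" "\<lambda>i. n - i"]) auto
  finally show ?thesis .
qed

lemma nth_Abs_fls_lower: "(\<And>n. n < A \<Longrightarrow> f n = 0) \<Longrightarrow> Abs_fls f $$ n = f n"
  by (rule nth_Abs_fls_lower_bound) auto

text \<open>The formal variable of all Laurent series stands for u^-1.\<close>

definition iota :: "complex fls \<Rightarrow> uqs fls" where
  "iota f = Abs_fls (\<lambda>n. sc (f $$ n))"

lemma iota_nth: "iota f $$ n = sc (f $$ n)"
  unfolding iota_def by (rule nth_Abs_fls_lower[of "fls_subdegree f"]) (simp add: sc_zero)

interpretation iota: scalar_embedding iota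
proof
  fix c d :: "complex fls" and x :: "uqs fls"
  show "iota (c + d) = iota c + iota d" by (rule fls_eqI) (simp add: iota_nth sc_add)
  show "iota 1 = 1" by (rule fls_eqI) (simp add: iota_nth sc_zero sc_one)
  show "iota (c * d) = iota c * iota d"
  proof (rule fls_eqI)
    fix n
    have "(iota c * iota d) $$ n = (\<Sum>i=fls_subdegree c..n - fls_subdegree d. iota c $$ i * iota d $$ (n - i))"
      by (rule fls_times_nth_lower) (simp_all add: iota_nth sc_zero)
    then show "iota (c * d) $$ n = (iota c * iota d) $$ n"
      by (simp add: iota_nth fls_times_nth(2) sc_sum sc_mult)
  qed
  show "iota c * x = x * iota c"
  proof (rule fls_eqI)
    fix n
    have "(iota c * x) $$ n = (\<Sum>i=fls_subdegree c..n - fls_subdegree x. iota c $$ i * x $$ (n - i))"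
      by (rule fls_times_nth_lower) (simp_all add: iota_nth sc_zero)
    also have "\<dots> = (\<Sum>i=fls_subdegree c..n - fls_subdegree x. x $$ (n - i) * iota c $$ i)"
      by (simp add: iota_nth sc_central)
    also have "\<dots> = (x * iota c) $$ n"
      by (rule fls_times_nth_lower'[symmetric]) (simp_all add: iota_nth sc_zero)
    finally show "(iota c * x) $$ n = (x * iota c) $$ n" .
  qed
qed

text \<open>A monomial in the formal variable u^-1; in particular \<open>umon (-1) c\<close> is c
  u.\<close>

definition umon :: "int \<Rightarrow> complex \<Rightarrow> complex fls" where
  "umon \<alpha> c = fls_shift (- \<alpha>) (fls_const c)"

lemma umon_nth: "umon \<alpha> c $$ n = (if n = \<alpha> then c else 0)"
  by (auto simp: umon_def)

lemma umon_mult_nth: "(iota (umon \<alpha> c) * x) $$ n = sc c * x $$ (n - \<alpha>)"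
proof -
  have "(iota (umon \<alpha> c) * x) $$ n = (\<Sum>i=\<alpha>..n - min (fls_subdegree x) (n - \<alpha>). iota (umon \<alpha> c) $$ i * x $$ (n - i))"
    by (rule fls_times_nth_lower) (auto simp: iota_nth umon_nth sc_zero)
  also have "\<dots> = (\<Sum>i\<in>{\<alpha>}. iota (umon \<alpha> c) $$ i * x $$ (n - i))"
    by (rule sum.mono_neutral_right) (auto simp: iota_nth umon_nth sc_zero)
  finally show ?thesis by (simp add: iota_nth umon_nth)
qed

lemma iota_const_mult_nth: "(iota (fls_const c) * x) $$ n = sc c * x $$ n"
  using umon_mult_nth[of 0 c x n] by (simp add: umon_def)

lemma inverse_umon: "c \<noteq> 0 \<Longrightarrow> 1 / umon \<alpha> c = umon (- \<alpha>) (1 / c)"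
proof -
  assume "c \<noteq> 0"
  have "umon \<alpha> c * umon (- \<alpha>) (1 / c) = 1"
    using \<open>c \<noteq> 0\<close> by (intro fls_eqI) (simp add: umon_def fls_shifted_times_simps)
  then show ?thesis by (metis nonzero_mult_div_cancel_left mult_zero_left zero_neq_one)
qed

lemma umon_nonzero: "c \<noteq> 0 \<Longrightarrow> umon \<alpha> c \<noteq> 0"
  using umon_nth[of \<alpha> c \<alpha>] by auto

lemma Rm_linear: "Rm q x y i j k l = Rm q 1 0 i j k l * x + Rm q 0 1 i j k l * y"
  by (simp add: Rm_def rdiag_def rexch_def algebra_simps)

lemma Rmat_eq_Rm: "Rmat q u v i j k l = Rm q u v i j k l"
  by (auto simp: Rmat_def Rm_def rdiag_def rexch_def divide_inverse)

lemma Rm_const: "Rm (fls_const q) (fls_const x) (fls_const y) i j k l = fls_const (Rm q x y i j k l)"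
proof -
  have b: "(of_bool b :: complex fls) = fls_const (of_bool b)" for b by simp
  have "rdiag (fls_const q) (fls_const x) (fls_const y) i k = fls_const (rdiag q x y i k)"
    by (simp add: rdiag_def fls_const_divide_const fls_minus_const)
  moreover have "rexch (fls_const q) (fls_const x) (fls_const y) i k = fls_const (rexch q x y i k)"
    unfolding rexch_def fls_const_1[symmetric] fls_const_divide_const by (simp add: fls_minus_const)
  ultimately show ?thesis unfolding Rm_def b by (simp add: fls_plus_const)
qed

lemma Rm_const':
  "Rm (fls_const q) 1 0 i j k l = fls_const (Rmat q 1 0 i j k l)"
  "Rm (fls_const q) 0 1 i j k l = fls_const (Rmat q 0 1 i j k l)"
  using Rm_const[of q 1 0 i j k l] Rm_const[of q 0 1 i j k l] by (simp_all add: Rmat_eq_Rm)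

definition one_sided :: "int \<Rightarrow> (int \<Rightarrow> uqs) \<Rightarrow> bool" where
  "one_sided \<alpha> F \<longleftrightarrow> (\<forall>n<0. F (\<alpha> * n) = 0)"

text \<open>Substitution of the monomial \<open>umon \<alpha> c\<close> for the variable of F, for
  \<open>\<alpha>\<close> equal to 1 or -1; F is indexed by the exponents of its own variable.
  One-sidedness makes the result a power series.\<close>

definition ev :: "int \<Rightarrow> complex \<Rightarrow> (int \<Rightarrow> uqs) \<Rightarrow> uqs fls" where
  "ev \<alpha> c F = Abs_fls (\<lambda>n. sc (c powi (\<alpha> * n)) * F (\<alpha> * n))"

lemma ev_nth:
  assumes "one_sided \<alpha> F"
  shows "ev \<alpha> c F $$ n = sc (c powi (\<alpha> * n)) * F (\<alpha> * n)"
  unfolding ev_def by (rule nth_Abs_fls_lower[of 0]) (use assms in \<open>simp add: one_sided_def\<close>)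

lemma umon_ev_nth:
  assumes "one_sided \<alpha> F" "\<alpha> * \<alpha> = 1" "c \<noteq> 0"
  shows "(iota (umon \<alpha> c) * ev \<alpha> c F) $$ n = sc (c powi (\<alpha> * n)) * F (\<alpha> * n - 1)"
proof -
  have "c * c powi (\<alpha> * n - 1) = c powi (\<alpha> * n)"
    using assms(3) by (simp add: power_int_diff)
  then show ?thesis
    using assms(2) by (simp add: umon_mult_nth ev_nth[OF assms(1)] right_diff_distrib mult.assoc[symmetric] sc_mult[symmetric])
qed

text \<open>Both spectral variables become monomials in one variable. Each coefficient of the
  specialized relation is a finite scalar combination of the coefficients (a, b) of the two-variable
  relation with a = \<open>\<alpha> * t\<close> and b = \<open>\<beta> * (n - t)\<close>.\<close>

lemma series_relation:
  fixes X Y :: "nat \<Rightarrow> nat \<Rightarrow> int \<Rightarrow> uqs"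
  assumes rel: "\<And>a b. (\<Sum>m=1..N. \<Sum>p=1..N. sc (Rmat q 1 0 i m k p) * (X m j (a - 1) * Y p l b)
            + sc (Rmat q 0 1 i m k p) * (X m j a * Y p l (b - 1)))
       = (\<Sum>m=1..N. \<Sum>p=1..N. (Y k p b * X i m (a - 1)) * sc (Rmat q 1 0 m j p l)
            + (Y k p (b - 1) * X i m a) * sc (Rmat q 0 1 m j p l))"
    and X: "\<And>i j. one_sided \<alpha> (X i j)" and Y: "\<And>i j. one_sided \<beta> (Y i j)"
    and \<alpha>: "\<alpha> * \<alpha> = 1" and \<beta>: "\<beta> * \<beta> = 1" and cd: "c \<noteq> 0" "d \<noteq> 0"
  shows "(\<Sum>m=1..N. \<Sum>p=1..N. iota (Rm (fls_const q) (umon \<alpha> c) (umon \<beta> d) i m k p) * (ev \<alpha> c (X m j) * ev \<beta> d (Y p l)))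
      = (\<Sum>m=1..N. \<Sum>p=1..N. (ev \<beta> d (Y k p) * ev \<alpha> c (X i m)) * iota (Rm (fls_const q) (umon \<alpha> c) (umon \<beta> d) m j p l))"
proof (rule fls_eqI)
  fix n :: int
  let ?C = "\<lambda>i. c powi (\<alpha> * i)" and ?D = "\<lambda>i. d powi (\<beta> * i)"
  let ?x = "\<lambda>i j. ev \<alpha> c (X i j)" and ?y = "\<lambda>i j. ev \<beta> d (Y i j)"
  have x0: "?x i j $$ t = 0" if "t < -1" for i j t using that X[of i j] by (simp add: ev_nth X one_sided_def)
  have y0: "?y i j $$ t = 0" if "t < -1" for i j t using that Y[of i j] by (simp add: ev_nth Y one_sided_def)
  have mp: "\<alpha> \<le> 1" "- 1 \<le> \<alpha>" "\<beta> \<le> 1" "- 1 \<le> \<beta>"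
    using \<alpha> \<beta> by (auto simp: zmult_eq_1_iff)
  have x1: "(iota (umon \<alpha> c) * ?x i j) $$ t = 0" if "t < -1" for i j t
    using that mp X[of i j] by (simp add: umon_mult_nth ev_nth X one_sided_def)
  have y1: "(iota (umon \<beta> d) * ?y i j) $$ t = 0" if "t < -1" for i j t
    using that mp Y[of i j] by (simp add: umon_mult_nth ev_nth Y one_sided_def)
  \<comment> \<open>Multiplication by \<open>umon\<close> can lower the order by one, so -1 is a
    common lower bound for all factors.\<close>
  let ?S = "{-1..n - -1}"
  have L: "(iota (Rm (fls_const q) (umon \<alpha> c) (umon \<beta> d) i m k p) * (?x m j * ?y p l)) $$ n
      = (\<Sum>t\<in>?S. sc (?C t * ?D (n - t)) * (sc (Rmat q 1 0 i m k p) * (X m j (\<alpha> * t - 1) * Y p l (\<beta> * (n - t)))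
          + sc (Rmat q 0 1 i m k p) * (X m j (\<alpha> * t) * Y p l (\<beta> * (n - t) - 1))))" for m p
  proof -
    have e: "iota (Rm (fls_const q) (umon \<alpha> c) (umon \<beta> d) i m k p) * (?x m j * ?y p l)
      = iota (fls_const (Rmat q 1 0 i m k p)) * ((iota (umon \<alpha> c) * ?x m j) * ?y p l)
      + iota (fls_const (Rmat q 0 1 i m k p)) * (?x m j * (iota (umon \<beta> d) * ?y p l))"
      by (subst Rm_linear) (simp only: Rm_const' iota.\<iota>_add iota.\<iota>_mult distrib_right mult.assoc
          iota.\<iota>_left_commute[of "?x m j"])
    have "(iota (Rm (fls_const q) (umon \<alpha> c) (umon \<beta> d) i m k p) * (?x m j * ?y p l)) $$ n = sc (Rmat q 1 0 i m k p) * (\<Sum>t\<in>?S. (iota (umon \<alpha> c) * ?x m j) $$ t * ?y p l $$ (n - t))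
       + sc (Rmat q 0 1 i m k p) * (\<Sum>t\<in>?S. ?x m j $$ t * (iota (umon \<beta> d) * ?y p l) $$ (n - t))"
      unfolding e by (simp only: fls_plus_nth iota_const_mult_nth fls_times_nth_lower[OF x1 y0] fls_times_nth_lower[OF x0 y1])
    also have "\<dots> = (\<Sum>t\<in>?S. sc (Rmat q 1 0 i m k p) * ((sc (?C t) * X m j (\<alpha> * t - 1)) * (sc (?D (n - t)) * Y p l (\<beta> * (n - t))))
          + sc (Rmat q 0 1 i m k p) * ((sc (?C t) * X m j (\<alpha> * t)) * (sc (?D (n - t)) * Y p l (\<beta> * (n - t) - 1))))"
      by (simp only: sum_distrib_left sum.distrib umon_ev_nth[OF X \<alpha> cd(1)] umon_ev_nth[OF Y \<beta> cd(2)] ev_nth[OF X] ev_nth[OF Y])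
    also have "\<dots> = (\<Sum>t\<in>?S. sc (?C t * ?D (n - t)) * (sc (Rmat q 1 0 i m k p) * (X m j (\<alpha> * t - 1) * Y p l (\<beta> * (n - t)))
          + sc (Rmat q 0 1 i m k p) * (X m j (\<alpha> * t) * Y p l (\<beta> * (n - t) - 1))))"
    proof -
      have "sc r * ((sc a * A) * (sc b * B)) = sc (a * b) * (sc r * (A * B))" for r a b A B
        by (metis sc_mult sc_central mult.assoc)
      then show ?thesis by (simp only: distrib_left)
    qed
    finally show ?thesis .
  qed
  have Rr: "((?y k p * ?x i m) * iota (Rm (fls_const q) (umon \<alpha> c) (umon \<beta> d) m j p l)) $$ n
      = (\<Sum>t\<in>?S. sc (?C t * ?D (n - t)) * ((Y k p (\<beta> * (n - t)) * X i m (\<alpha> * t - 1)) * sc (Rmat q 1 0 m j p l)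
          + (Y k p (\<beta> * (n - t) - 1) * X i m (\<alpha> * t)) * sc (Rmat q 0 1 m j p l)))" for m p
  proof -
    have e: "(?y k p * ?x i m) * iota (Rm (fls_const q) (umon \<alpha> c) (umon \<beta> d) m j p l)
      = iota (fls_const (Rmat q 1 0 m j p l)) * (?y k p * (iota (umon \<alpha> c) * ?x i m))
      + iota (fls_const (Rmat q 0 1 m j p l)) * ((iota (umon \<beta> d) * ?y k p) * ?x i m)"
      by (subst Rm_linear, subst iota.\<iota>_central[symmetric]) (simp only: Rm_const' iota.\<iota>_add iota.\<iota>_mult distrib_right mult.assoc
          iota.\<iota>_left_commute[of "?y k p"])
    have "((?y k p * ?x i m) * iota (Rm (fls_const q) (umon \<alpha> c) (umon \<beta> d) m j p l)) $$ n = sc (Rmat q 1 0 m j p l) * (\<Sum>t\<in>?S. ?y k p $$ (n - t) * (iota (umon \<alpha> c) * ?x i m) $$ t)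
       + sc (Rmat q 0 1 m j p l) * (\<Sum>t\<in>?S. (iota (umon \<beta> d) * ?y k p) $$ (n - t) * ?x i m $$ t)"
      unfolding e by (simp only: fls_plus_nth iota_const_mult_nth fls_times_nth_lower'[OF y0 x1] fls_times_nth_lower'[OF y1 x0])
    also have "\<dots> = (\<Sum>t\<in>?S. sc (Rmat q 1 0 m j p l) * ((sc (?D (n - t)) * Y k p (\<beta> * (n - t))) * (sc (?C t) * X i m (\<alpha> * t - 1)))
          + sc (Rmat q 0 1 m j p l) * ((sc (?D (n - t)) * Y k p (\<beta> * (n - t) - 1)) * (sc (?C t) * X i m (\<alpha> * t))))"
      by (simp only: sum_distrib_left sum.distrib umon_ev_nth[OF X \<alpha> cd(1)] umon_ev_nth[OF Y \<beta> cd(2)] ev_nth[OF X] ev_nth[OF Y])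
    also have "\<dots> = (\<Sum>t\<in>?S. sc (?C t * ?D (n - t)) * ((Y k p (\<beta> * (n - t)) * X i m (\<alpha> * t - 1)) * sc (Rmat q 1 0 m j p l)
          + (Y k p (\<beta> * (n - t) - 1) * X i m (\<alpha> * t)) * sc (Rmat q 0 1 m j p l)))"
    proof -
      have "sc r * ((sc a * A) * (sc b * B)) = sc (b * a) * ((A * B) * sc r)" for r a b A B
        by (metis sc_mult sc_central mult.assoc mult.commute[of a b])
      then show ?thesis by (simp only: distrib_left)
    qed
    finally show ?thesis .
  qed
  have "(\<Sum>m=1..N. \<Sum>p=1..N. iota (Rm (fls_const q) (umon \<alpha> c) (umon \<beta> d) i m k p) * (?x m j * ?y p l)) $$ n
     = (\<Sum>t\<in>?S. sc (?C t * ?D (n - t)) * (\<Sum>m=1..N. \<Sum>p=1..N. sc (Rmat q 1 0 i m k p) * (X m j (\<alpha> * t - 1) * Y p l (\<beta> * (n - t)))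
          + sc (Rmat q 0 1 i m k p) * (X m j (\<alpha> * t) * Y p l (\<beta> * (n - t) - 1))))"
    unfolding fls_nth_sum L sum_distrib_left unfolding sum.cartesian_product
    by (rule sum.reindex_bij_witness[of _ "\<lambda>(t, m, p). (m, p, t)" "\<lambda>(m, p, t). (t, m, p)"]) auto
  also have "\<dots> = (\<Sum>t\<in>?S. sc (?C t * ?D (n - t)) * (\<Sum>m=1..N. \<Sum>p=1..N. (Y k p (\<beta> * (n - t)) * X i m (\<alpha> * t - 1)) * sc (Rmat q 1 0 m j p l)
          + (Y k p (\<beta> * (n - t) - 1) * X i m (\<alpha> * t)) * sc (Rmat q 0 1 m j p l)))"
    by (simp only: rel)
  also have "\<dots> = (\<Sum>m=1..N. \<Sum>p=1..N. (?y k p * ?x i m) * iota (Rm (fls_const q) (umon \<alpha> c) (umon \<beta> d) m j p l)) $$ n"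
    unfolding fls_nth_sum Rr sum_distrib_left unfolding sum.cartesian_product
    by (rule sum.reindex_bij_witness[of _ "\<lambda>(m, p, t). (t, m, p)" "\<lambda>(t, m, p). (m, p, t)"]) auto
  finally show "(\<Sum>m=1..N. \<Sum>p=1..N. iota (Rm (fls_const q) (umon \<alpha> c) (umon \<beta> d) i m k p) * (?x m j * ?y p l)) $$ n
      = (\<Sum>m=1..N. \<Sum>p=1..N. (?y k p * ?x i m) * iota (Rm (fls_const q) (umon \<alpha> c) (umon \<beta> d) m j p l)) $$ n" .
qed

text \<open>Only scalars are divided by. Comparing p(2w) with 2^(M+1) p(w) cancels the top
  coefficient and multiplies the j-th one by 2^j - 2^(M+1), which is nonzero for j \<le> M; this
  lowers the degree bound.\<close>

lemma sc_polynomial_zero: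
  assumes "finite E" "\<And>w. w \<notin> E \<Longrightarrow> (\<Sum>j\<le>M. sc (w ^ j) * a j) = 0" "j \<le> M"
  shows "a j = 0"
  using assms
proof (induction M arbitrary: a E j)
  case 0
  obtain w where "w \<notin> E" using ex_new_if_finite[OF infinite_UNIV_char_0 0(1)] by blast
  then show ?case using 0 by (simp add: sc_one)
next
  case (Suc M)
  have low: "a j = 0" if "j \<le> M" for j
  proof -
    define b where "b j = sc (2 ^ j - 2 ^ Suc M) * a j" for j
    have "b j = 0"
    \<comment> \<open>The exceptional set is enlarged so that both w and 2w avoid E.\<close>
    proof (rule Suc.IH[of "E \<union> (\<lambda>w. w / 2) ` E" b])
      fix w assume w: "w \<notin> E \<union> (\<lambda>w. w / 2) ` E"
      then have "2 * w \<notin> E" by (auto simp: image_iff mult.commute)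
      then have "(\<Sum>j\<le>Suc M. sc ((2 * w) ^ j) * a j) = 0" by (rule Suc.prems(2))
      moreover have "(\<Sum>j\<le>Suc M. sc (2 ^ Suc M * w ^ j) * a j) = sc (2 ^ Suc M) * (\<Sum>j\<le>Suc M. sc (w ^ j) * a j)"
        unfolding sum_distrib_left by (simp only: sc_mult mult.assoc)
      moreover have "(\<Sum>j\<le>Suc M. sc (w ^ j) * a j) = 0" using w by (intro Suc.prems(2)) auto
      ultimately have "0 = (\<Sum>j\<le>Suc M. sc ((2 * w) ^ j) * a j) - (\<Sum>j\<le>Suc M. sc (2 ^ Suc M * w ^ j) * a j)" by simp
      also have "\<dots> = (\<Sum>j\<le>Suc M. sc (w ^ j) * b j)"
      proof -
        have "sc ((2 * w) ^ j) * a j - sc (2 ^ Suc M * w ^ j) * a j = sc (w ^ j) * b j" for j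
        proof -
          have "sc ((2 * w) ^ j) = sc (w ^ j * (2 ^ j - 2 ^ Suc M)) + sc (2 ^ Suc M * w ^ j)"
            unfolding sc_add[symmetric] by (simp add: algebra_simps power_mult_distrib)
          then show ?thesis unfolding b_def by (simp add: sc_mult distrib_right mult.assoc)
        qed
        then show ?thesis by (simp only: sum_subtractf[symmetric])
      qed
      finally show "(\<Sum>j\<le>M. sc (w ^ j) * b j) = 0" by (simp add: b_def sc_zero)
    qed (use Suc.prems(1) that in auto)
    moreover have "(2::complex) ^ j \<noteq> 2 ^ Suc M"
    proof
      assume "(2::complex) ^ j = 2 ^ Suc M"
      then have "cmod (2 ^ j) = cmod (2 ^ Suc M)" by simp
      then have "(2::real) ^ j = 2 ^ Suc M" by (simp add: norm_power norm_mult)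
      then show False using that by (simp only: power_inject_exp)
    qed
    moreover have "sc (1 / (2 ^ j - 2 ^ Suc M)) * b j = sc (1 / (2 ^ j - 2 ^ Suc M) * (2 ^ j - 2 ^ Suc M)) * a j"
      unfolding b_def sc_mult mult.assoc ..
    ultimately show ?thesis by (simp add: sc_one)
  qed
  obtain w where w: "w \<notin> insert 0 E" using ex_new_if_finite[OF infinite_UNIV_char_0, of "insert 0 E"] Suc.prems(1) by blast
  have "sc (w ^ Suc M) * a (Suc M) = 0"
    using Suc.prems(2)[of w] w low by simp
  then have "sc (1 / w ^ Suc M * w ^ Suc M) * a (Suc M) = 0" unfolding sc_mult mult.assoc by simp
  then have "a (Suc M) = 0" using w by (simp add: sc_one)
  then show ?case using low Suc.prems(3) by (cases "j = Suc M") auto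
qed

lemma chain_cong:
  assumes "\<And>a. a \<in> set xs \<Longrightarrow> S a = S' a" "\<And>a b. a \<in> set xs \<Longrightarrow> b \<in> set xs \<Longrightarrow> Q a b = Q' a b"
  shows "chain S Q xs = chain S' Q' xs"
proof
  fix v
  show "chain S Q xs v = chain S' Q' xs v"
    using assms
  proof (induction xs arbitrary: v)
    case (Cons a xs)
    have "foldr (Q a) xs w = foldr (Q' a) xs w" for w
      using Cons.prems(2) by (intro foldr_cong) auto
    with Cons show ?case by simp
  qed simp
qed

section \<open>Specialized generating series and commutation of coefficients\<close>

locale twisted_setup =
  fixes q :: complex and N :: nat and ty :: twist
  assumes q_nz: "q \<noteq> 0" and q_root: "\<And>m::nat. m > 0 \<Longrightarrow> q ^ m \<noteq> 1"
    and N_pos: "N \<ge> 1" and N_even: "ty = Symplectic \<longrightarrow> even N"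
begin

abbreviation "K \<equiv> fls_const q"
abbreviation "tt i j \<equiv> \<lambda>a. cls q N (t_free i j a)"
abbreviation "tb i j \<equiv> \<lambda>a. cls q N (tbar_free i j a)"

text \<open>\<open>Tm c\<close>, \<open>Bm c\<close> and \<open>Sm c\<close> are T(c u), the barred
  matrix at 1/(c u), and S(c u), all as series in u^-1.\<close>

definition Tm :: "complex \<Rightarrow> nat \<Rightarrow> nat \<Rightarrow> uqs fls" where
  "Tm c i j = ev (-1) c (tt i j)"

definition Bm :: "complex \<Rightarrow> nat \<Rightarrow> nat \<Rightarrow> uqs fls" where
  "Bm c i j = ev 1 (1 / c) (tb i j)"

definition Sm :: "complex \<Rightarrow> nat \<Rightarrow> nat \<Rightarrow> uqs fls" where
  "Sm c i j = (\<Sum>m=1..N. \<Sum>p=1..N. Tm c i m * iota (Gm ty K m p) * Bm c j p)"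

lemma one_sided_t: "one_sided (-1) (tt i j)" "one_sided 1 (tb i j)"
  by (auto simp: one_sided_def t_free_def tbar_free_def cls_zero)

lemma relators: "RXY_relators q N t_free t_free \<subseteq> uq_relators q N"
  "RXY_relators q N tbar_free tbar_free \<subseteq> uq_relators q N"
  "RXY_relators q N tbar_free t_free \<subseteq> uq_relators q N"
  unfolding uq_relators_def by blast+

lemma TT_relation:
  assumes "c \<noteq> 0" "d \<noteq> 0" and V: "i \<in> {1..N}" "j \<in> {1..N}" "k \<in> {1..N}" "l \<in> {1..N}"
  shows "(\<Sum>m=1..N. \<Sum>p=1..N. iota (Rm K (umon (-1) c) (umon (-1) d) i m k p) * (Tm c m j * Tm d p l))
      = (\<Sum>m=1..N. \<Sum>p=1..N. (Tm d k p * Tm c i m) * iota (Rm K (umon (-1) c) (umon (-1) d) m j p l))"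
  unfolding Tm_def
proof (rule series_relation[where X = "\<lambda>i j a. cls q N (t_free i j a)" and Y = "\<lambda>i j a. cls q N (t_free i j a)"], goal_cases)
  case (1 a b)
  show ?case by (rule RXY_relation) (use t_free_carrier relators V in blast)+
qed (use one_sided_t assms in auto)

lemma BB_relation:
  assumes "c \<noteq> 0" "d \<noteq> 0" and V: "i \<in> {1..N}" "j \<in> {1..N}" "k \<in> {1..N}" "l \<in> {1..N}"
  shows "(\<Sum>m=1..N. \<Sum>p=1..N. iota (Rm K (1 / umon (-1) c) (1 / umon (-1) d) i m k p) * (Bm c m j * Bm d p l))
      = (\<Sum>m=1..N. \<Sum>p=1..N. (Bm d k p * Bm c i m) * iota (Rm K (1 / umon (-1) c) (1 / umon (-1) d) m j p l))"
  unfolding Bm_def inverse_umon[OF assms(1)] inverse_umon[OF assms(2)] minus_minus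
proof (rule series_relation[where X = "\<lambda>i j a. cls q N (tbar_free i j a)" and Y = "\<lambda>i j a. cls q N (tbar_free i j a)"], goal_cases)
  case (1 a b)
  show ?case by (rule RXY_relation) (use t_free_carrier relators V in blast)+
qed (use one_sided_t assms in auto)

lemma BT_relation:
  assumes "c \<noteq> 0" "d \<noteq> 0" and V: "i \<in> {1..N}" "j \<in> {1..N}" "k \<in> {1..N}" "l \<in> {1..N}"
  shows "(\<Sum>m=1..N. \<Sum>p=1..N. iota (Rm K (1 / umon (-1) c) (umon (-1) d) i m k p) * (Bm c m j * Tm d p l))
      = (\<Sum>m=1..N. \<Sum>p=1..N. (Tm d k p * Bm c i m) * iota (Rm K (1 / umon (-1) c) (umon (-1) d) m j p l))"
  unfolding Bm_def Tm_def inverse_umon[OF assms(1)] minus_minus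
proof (rule series_relation[where X = "\<lambda>i j a. cls q N (tbar_free i j a)" and Y = "\<lambda>i j a. cls q N (t_free i j a)"], goal_cases)
  case (1 a b)
  show ?case by (rule RXY_relation) (use t_free_carrier relators V in blast)+
qed (use one_sided_t assms in auto)

lemma reflection_algebra_instance:
  assumes c0: "\<And>a. a \<le> N \<Longrightarrow> c a \<noteq> 0" and c_Suc: "\<And>i. 1 \<le> i \<Longrightarrow> i < N \<Longrightarrow> c (Suc i) = c i / (q * q)"
  shows "reflection_algebra iota N K (\<lambda>a. umon (-1) (c a)) (\<lambda>a. Sm (c a))"
proof unfold_locales
  show "K \<noteq> 0" using q_nz by simp
  show "1 \<le> N" by (rule N_pos)
  show "K * K \<noteq> 1" using q_root[of 2] by (simp add: power2_eq_square)
  show "umon (-1) (c a) \<noteq> 0" if "a \<le> N" for a using c0[OF that] by (rule umon_nonzero)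
  show "umon (-1) (c (Suc i)) = umon (-1) (c i) / (K * K)" if "1 \<le> i" "i < N" for i
  proof -
    have "umon (-1) (c (Suc i)) * (K * K) = umon (-1) (c i)"
      using q_nz by (intro fls_eqI) (simp add: c_Suc[OF that] umon_nth)
    moreover have "K * K \<noteq> 0" using q_nz by simp
    ultimately show ?thesis by (metis nonzero_mult_div_cancel_right)
  qed
  fix a b and v :: "(nat \<Rightarrow> nat) \<Rightarrow> uqs fls"
  assume ab: "a \<le> N" "b \<le> N" "a \<noteq> b"
  show "op2 N a b (\<lambda>i j k l. iota (Rm K (umon (-1) (c a)) (umon (-1) (c b)) i j k l)) (op1 N a (Sm (c a))
        (op2 N a b (\<lambda>i j k l. iota (Rt K (1 / umon (-1) (c a)) (umon (-1) (c b)) i j k l)) (op1 N b (Sm (c b)) v)))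
    = op1 N b (Sm (c b)) (op2 N a b (\<lambda>i j k l. iota (Rt K (1 / umon (-1) (c a)) (umon (-1) (c b)) i j k l))
        (op1 N a (Sm (c a)) (op2 N a b (\<lambda>i j k l. iota (Rm K (umon (-1) (c a)) (umon (-1) (c b)) i j k l)) v)))"
  proof (rule iota.reflection_equation[where T = "\<lambda>a. Tm (c a)" and B = "\<lambda>a. Bm (c a)" and S = "\<lambda>a. Sm (c a)"
        and u = "\<lambda>a. umon (-1) (c a)" and ty = ty])
    fix e d i j k l assume "{e, d} = {a, b}" and V: "i \<in> {1..N}" "j \<in> {1..N}" "k \<in> {1..N}" "l \<in> {1..N}"
    then have "e \<le> N" "d \<le> N" using ab by (auto simp: doubleton_eq_iff)
    then show "(\<Sum>m=1..N. \<Sum>p=1..N. iota (Rm K (1 / umon (-1) (c e)) (umon (-1) (c d)) i m k p) * (Bm (c e) m j * Tm (c d) p l))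
      = (\<Sum>m=1..N. \<Sum>p=1..N. (Tm (c d) k p * Bm (c e) i m) * iota (Rm K (1 / umon (-1) (c e)) (umon (-1) (c d)) m j p l))"
      by (intro BT_relation c0 V)
  next
    fix i j k l assume V: "i \<in> {1..N}" "j \<in> {1..N}" "k \<in> {1..N}" "l \<in> {1..N}"
    show "(\<Sum>m=1..N. \<Sum>p=1..N. iota (Rm K (umon (-1) (c a)) (umon (-1) (c b)) i m k p) * (Tm (c a) m j * Tm (c b) p l))
      = (\<Sum>m=1..N. \<Sum>p=1..N. (Tm (c b) k p * Tm (c a) i m) * iota (Rm K (umon (-1) (c a)) (umon (-1) (c b)) m j p l))"
      by (intro TT_relation c0 ab V)
    show "(\<Sum>m=1..N. \<Sum>p=1..N. iota (Rm K (1 / umon (-1) (c b)) (1 / umon (-1) (c a)) i m k p) * (Bm (c b) m j * Bm (c a) p l))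
      = (\<Sum>m=1..N. \<Sum>p=1..N. (Bm (c a) k p * Bm (c b) i m) * iota (Rm K (1 / umon (-1) (c b)) (1 / umon (-1) (c a)) m j p l))"
      by (intro BB_relation c0 ab V)
  next
    show "ty = Symplectic \<longrightarrow> even N" by (rule N_even)
  qed (use ab c0 q_nz in \<open>auto intro!: umon_nonzero simp: Sm_def\<close>)
qed

lemma Tm_nth: "Tm c i m $$ t = sc (c powi (- t)) * tt i m (- t)"
  unfolding Tm_def by (subst ev_nth) (simp_all add: one_sided_t)

lemma Bm_nth: "Bm c i m $$ t = sc (c powi (- t)) * tb i m t"
  unfolding Bm_def by (subst ev_nth) (simp_all add: one_sided_t power_int_divide_distrib power_int_minus power_int_inverse divide_inverse)

lemma Tm_neg: "t < 0 \<Longrightarrow> Tm c i m $$ t = 0"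
  using one_sided_t(1)[of i m] by (simp add: Tm_nth one_sided_def)

lemma Bm_neg: "t < 0 \<Longrightarrow> Bm c i m $$ t = 0"
  using one_sided_t(2)[of i m] by (simp add: Bm_nth one_sided_def)

lemma TB_nth: "(Tm c i m * Bm c j p) $$ n = (\<Sum>t=0..n - 0. Tm c i m $$ t * Bm c j p $$ (n - t))"
  by (rule fls_times_nth_lower[OF Tm_neg Bm_neg])

lemma Gm_const: "Gm ty K m p = fls_const (Gm ty q m p)"
  by (cases ty) (auto simp: Gm_def)

lemma Sm_nth_sum: "Sm c i j $$ n = (\<Sum>m=1..N. \<Sum>p=1..N. sc (Gm ty q m p) * (Tm c i m * Bm c j p) $$ n)"
proof -
  have e: "Tm c i m * iota (Gm ty K m p) * Bm c j p = iota (fls_const (Gm ty q m p)) * (Tm c i m * Bm c j p)" for m p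
    unfolding Gm_const by (simp only: iota.\<iota>_central mult.assoc)
  show ?thesis unfolding Sm_def e fls_nth_sum iota_const_mult_nth ..
qed

text \<open>In both T(c u) and the barred series at 1/(c u) the coefficient of u^-t is scaled by
  c^-t, hence also in their product.\<close>

lemma Sm_nth:
  assumes "c \<noteq> 0"
  shows "Sm c i j $$ n = sc (c powi (- n)) * Sm 1 i j $$ n"
proof -
  have TB: "(Tm c i m * Bm c j p) $$ n = sc (c powi (- n)) * (Tm 1 i m * Bm 1 j p) $$ n" for m p
    unfolding TB_nth sum_distrib_left
  proof (intro sum.cong refl)
    fix t
    have "c powi (- t) * c powi (- (n - t)) = c powi (- n)"
      using assms by (simp add: power_int_add[symmetric])
    moreover have "(sc a * x) * (sc b * y) = sc (a * b) * (x * y)" for a b x y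
      by (metis sc_mult sc_central mult.assoc)
    ultimately show "Tm c i m $$ t * Bm c j p $$ (n - t) = sc (c powi (- n)) * (Tm 1 i m $$ t * Bm 1 j p $$ (n - t))"
      unfolding Tm_nth Bm_nth by (simp add: sc_one)
  qed
  have sw: "sc g * (sc d * x) = sc d * (sc g * x)" for g d x
    by (metis sc_central mult.assoc)
  show ?thesis
    unfolding Sm_nth_sum TB sum_distrib_left by (intro sum.cong refl sw)
qed

lemma Sm_neg: "n < 0 \<Longrightarrow> Sm c i j $$ n = 0"
  unfolding Sm_nth_sum TB_nth by simp

definition cz :: "complex \<Rightarrow> nat \<Rightarrow> complex" where
  "cz z a = (if a = 0 then z else shift q a)"

lemma shift_nz: "shift q a \<noteq> 0"
  using q_nz by (simp add: shift_def)

lemma reflection_z: "z \<noteq> 0 \<Longrightarrow> reflection_algebra iota N K (\<lambda>a. umon (-1) (cz z a)) (\<lambda>a. Sm (cz z a))"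
proof (rule reflection_algebra_instance)
  fix i :: nat assume "1 \<le> i" "i < N"
  have "shift q (Suc i) = shift q i / (q * q)"
  proof -
    have "- 2 * int (Suc i) + 2 = (- 2 * int i + 2) - 2" by simp
    then show ?thesis using q_nz unfolding shift_def by (simp add: power_int_diff power_int_minus power2_eq_square field_simps)
  qed
  then show "cz z (Suc i) = cz z i / (q * q)" using \<open>1 \<le> i\<close> by (simp add: cz_def)
qed (auto simp: cz_def shift_nz)

definition Qs :: "nat \<Rightarrow> nat \<Rightarrow> ((nat \<Rightarrow> nat) \<Rightarrow> uqs fls) \<Rightarrow> (nat \<Rightarrow> nat) \<Rightarrow> uqs fls" where
  "Qs a b = op2 N a b (\<lambda>i j k l. iota (Rt K (1 / umon (-1) (shift q a)) (umon (-1) (shift q b)) i j k l))"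

definition Ss :: "nat \<Rightarrow> ((nat \<Rightarrow> nat) \<Rightarrow> uqs fls) \<Rightarrow> (nat \<Rightarrow> nat) \<Rightarrow> uqs fls" where
  "Ss a = op1 N a (Sm (shift q a))"

sublocale anti: antisymmetrizer iota N K
  by unfold_locales (use q_nz N_pos in auto)

text \<open>Only spaces 1..N occur in the ordered product, so one and the same \<open>f\<close>
  serves every \<open>z\<close>.\<close>

lemma chain_z:
  assumes "z \<noteq> 0"
  shows "chain (reflection_algebra.S1 N (\<lambda>a. Sm (cz z a))) (reflection_algebra.Q iota N K (\<lambda>a. umon (-1) (cz z a))) [1..<Suc N]
    = chain Ss Qs [1..<Suc N]"
proof -
  interpret r: reflection_algebra iota N K "\<lambda>a. umon (-1) (cz z a)" "\<lambda>a. Sm (cz z a)"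
    by (rule reflection_z[OF assms])
  show ?thesis
  proof (rule chain_cong)
    fix a b assume "a \<in> set [1..<Suc N]"
    then have a: "cz z a = shift q a" by (auto simp: cz_def)
    then show "r.S1 a = Ss a" unfolding r.S1_def Ss_def by simp
    assume "b \<in> set [1..<Suc N]"
    then have "cz z b = shift q b" by (auto simp: cz_def)
    with a show "r.Q a b = Qs a b" unfolding r.Q_def Qs_def by simp
  qed
qed

lemma ex_sdet: "\<exists>f. \<forall>v. anti.A (chain Ss Qs [1..<Suc N] v) = (\<lambda>I. f * anti.A v I)"
proof -
  interpret r: reflection_algebra iota N K "\<lambda>a. umon (-1) (cz 1 a)" "\<lambda>a. Sm (cz 1 a)"
    by (rule reflection_z) simp
  show ?thesis using r.chain_scalar chain_z[of 1] by simp
qed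

text \<open>The excluded nonzero z are the zeros of the factors of \<open>R_scalar\<close>. No
  factor of \<open>Q_scalar\<close> vanishes: it is a multiple of u^-1 minus a nonzero multiple of
  u.\<close>

lemma series_commute:
  assumes f: "\<And>v. anti.A (chain Ss Qs [1..<Suc N] v) = (\<lambda>I. f * anti.A v I)"
    and z: "z \<noteq> 0" "z \<noteq> shift q N / (q * q)" "\<And>a. a \<in> {1..<N} \<Longrightarrow> z \<noteq> shift q a"
    and ij: "i \<in> {1..N}" "j \<in> {1..N}"
  shows "f * Sm z i j = Sm z i j * f"
proof -
  interpret r: reflection_algebra iota N K "\<lambda>a. umon (-1) (cz z a)" "\<lambda>a. Sm (cz z a)"
    by (rule reflection_z) fact
  have "r.R_scalar \<noteq> 0"
  proof -
    have "(umon (-1) (cz z N) / K - K * umon (-1) (cz z 0)) $$ (-1) \<noteq> 0"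
    proof -
      have "umon (-1) (cz z N) / K = umon (-1) (cz z N / q)"
      proof -
        have "umon (-1) (cz z N / q) * K = umon (-1) (cz z N)"
          using q_nz by (intro fls_eqI) (simp add: umon_nth)
        moreover have "K \<noteq> 0" using q_nz by simp
        ultimately show ?thesis by (metis nonzero_mult_div_cancel_right)
      qed
      then show ?thesis using z(2) N_pos q_nz by (simp add: umon_nth cz_def field_simps)
    qed
    then have "umon (-1) (cz z N) / K - K * umon (-1) (cz z 0) \<noteq> 0" by auto
    moreover have "umon (-1) (cz z a) - umon (-1) (cz z 0) \<noteq> 0" if "a \<in> {1..<N}" for a
    proof
      assume "umon (-1) (cz z a) - umon (-1) (cz z 0) = 0"
      then have "(umon (-1) (cz z a) - umon (-1) (cz z 0)) $$ (-1) = 0" by simp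
      then show False using z(3)[OF that] that by (simp add: umon_nth cz_def)
    qed
    ultimately show ?thesis by (simp add: r.R_scalar_def)
  qed
  moreover have "r.Q_scalar \<noteq> 0"
  proof -
    have "1 / umon (-1) (cz z 1) / K - K * umon (-1) (cz z 0) \<noteq> 0"
    proof
      assume "1 / umon (-1) (cz z 1) / K - K * umon (-1) (cz z 0) = 0"
      then have "1 / umon (-1) (cz z 1) / K * K = K * umon (-1) (cz z 0) * K" by simp
      then have "umon 1 (1 / cz z 1) = K * umon (-1) (cz z 0) * K"
        using q_nz inverse_umon[of "cz z 1" "-1"] by (simp add: cz_def shift_nz)
      then have "umon 1 (1 / cz z 1) $$ (-1) = (K * umon (-1) (cz z 0) * K) $$ (-1)" by simp
      then show False using q_nz z(1) by (simp add: umon_nth cz_def)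
    qed
    moreover have "1 / umon (-1) (cz z a) - umon (-1) (cz z 0) \<noteq> 0" if "a \<in> {1<..N}" for a
    proof
      assume "1 / umon (-1) (cz z a) - umon (-1) (cz z 0) = 0"
      then have "umon 1 (1 / cz z a) - umon (-1) (cz z 0) = 0"
        using inverse_umon[of "cz z a" "-1"] that by (simp add: cz_def shift_nz)
      then have "(umon 1 (1 / cz z a) - umon (-1) (cz z 0)) $$ (-1) = 0" by simp
      then show False using z(1) by (simp add: umon_nth cz_def)
    qed
    ultimately show ?thesis by (simp add: r.Q_scalar_def)
  qed
  ultimately have "f * Sm (cz z 0) i j = Sm (cz z 0) i j * f"
  proof (intro r.chain_scalar_commutes ij)
    show "anti.A (chain r.S1 r.Q [1..<Suc N] v) = (\<lambda>I. f * anti.A v I)" for v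
      unfolding chain_z[OF z(1)] by (rule f)
  qed
  then show ?thesis by (simp add: cz_def)
qed

text \<open>The coefficient of u^-n in f S(z u) - S(z u) f is a polynomial in w = 1/z whose k-th
  coefficient is a commutator of f_(n-k) with a coefficient s_k. It vanishes for all but finitely
  many w, hence identically.\<close>

theorem coefficients_commute:
  assumes f: "\<And>v. anti.A (chain Ss Qs [1..<Suc N] v) = (\<lambda>I. f * anti.A v I)"
    and ij: "i \<in> {1..N}" "j \<in> {1..N}"
  shows "f $$ s * Sm 1 i j $$ t = Sm 1 i j $$ t * f $$ s"
proof (cases "s < fls_subdegree f \<or> t < 0")
  case True
  then show ?thesis by (auto simp: Sm_neg)
next
  case False
  let ?d = "fls_subdegree f"
  define n where "n = s + t"
  define M where "M = nat (n - ?d)"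
  let ?S = "\<lambda>t. Sm 1 i j $$ t"
  define a where "a k = f $$ (n - int k) * ?S (int k) - ?S (int k) * f $$ (n - int k)" for k
  \<comment> \<open>Exceptional values of w; since \<open>inverse 0 = 0\<close>, the value w = 0 is
    among them.\<close>
  define E where "E = inverse ` ({0, shift q N / (q * q)} \<union> shift q ` {1..<N})"
  have "a (nat t) = 0"
  proof (rule sc_polynomial_zero)
    show "finite E" by (simp add: E_def)
    show "nat t \<le> M" unfolding M_def n_def using False by (intro nat_mono) auto
    fix w assume w: "w \<notin> E"
    define z where "z = inverse w"
    have "w = inverse z" by (simp add: z_def)
    then have zn: "z \<notin> {0, shift q N / (q * q)} \<union> shift q ` {1..<N}" using w unfolding E_def by blast
    have z0: "z \<noteq> 0" using zn by auto
    have c: "f * Sm z i j = Sm z i j * f"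
      using zn by (intro series_commute[OF f _ _ _ ij]) auto
    have S: "Sm z i j $$ int k = sc (w ^ k) * ?S (int k)" for k
      using z0 unfolding Sm_nth[OF z0] by (simp add: \<open>w = inverse z\<close> power_int_minus power_inverse)
    have f0: "f $$ k = 0" if "k < ?d" for k using that by simp
    have S0: "Sm z i j $$ k = 0" if "k < 0" for k using that by (rule Sm_neg)
    have "(f * Sm z i j) $$ n = (\<Sum>k=0..n - ?d. f $$ (n - k) * Sm z i j $$ k)"
      by (rule fls_times_nth_lower'[OF f0 S0])
    moreover have "(Sm z i j * f) $$ n = (\<Sum>k=0..n - ?d. Sm z i j $$ k * f $$ (n - k))"
      by (rule fls_times_nth_lower[OF S0 f0])
    ultimately have "0 = (\<Sum>k=0..n - ?d. f $$ (n - k) * Sm z i j $$ k - Sm z i j $$ k * f $$ (n - k))"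
      using c by (simp add: sum_subtractf)
    also have "\<dots> = (\<Sum>k\<le>M. f $$ (n - int k) * Sm z i j $$ int k - Sm z i j $$ int k * f $$ (n - int k))"
      unfolding M_def
      by (rule sum.reindex_bij_witness[of _ int nat]) (use False in \<open>auto simp: n_def\<close>)
    also have "\<dots> = (\<Sum>k\<le>M. sc (w ^ k) * a k)"
    proof (intro sum.cong refl)
      fix k
      have "x * (sc (w ^ k) * y) = sc (w ^ k) * (x * y)" for x y by (metis sc_central mult.assoc)
      then show "f $$ (n - int k) * Sm z i j $$ int k - Sm z i j $$ int k * f $$ (n - int k) = sc (w ^ k) * a k"
        unfolding S a_def by (simp add: right_diff_distrib mult.assoc)
    qed
    finally show "(\<Sum>k\<le>M. sc (w ^ k) * a k) = 0" ..
  qed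
  then show ?thesis using False by (simp add: a_def n_def)
qed

end

section \<open>Comparison with the matrices over the series ring\<close>

lemma laurent_simps:
  "carrier (laurent A) = {f. (\<forall>k. f k \<in> carrier A) \<and> (\<exists>d. \<forall>k>d. f k = \<zero>\<^bsub>A\<^esub>)}"
  "f \<otimes>\<^bsub>laurent A\<^esub> g = (\<lambda>k. \<Oplus>\<^bsub>A\<^esub> i \<in> {i. f i \<noteq> \<zero>\<^bsub>A\<^esub> \<and> g (k - i) \<noteq> \<zero>\<^bsub>A\<^esub>}. f i \<otimes>\<^bsub>A\<^esub> g (k - i))"
  "\<one>\<^bsub>laurent A\<^esub> = (\<lambda>k. if k = 0 then \<one>\<^bsub>A\<^esub> else \<zero>\<^bsub>A\<^esub>)"
  "\<zero>\<^bsub>laurent A\<^esub> = (\<lambda>k. \<zero>\<^bsub>A\<^esub>)"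
  "f \<oplus>\<^bsub>laurent A\<^esub> g = (\<lambda>k. f k \<oplus>\<^bsub>A\<^esub> g k)"
  by (simp_all add: laurent_def)

lemma laurent_abelian_monoid:
  assumes "ring A"
  shows "abelian_monoid (laurent A)"
proof -
  interpret ring A by fact
  show ?thesis
  proof (rule abelian_monoidI)
    fix f g assume "f \<in> carrier (laurent A)" "g \<in> carrier (laurent A)"
    moreover from this obtain d e where "\<forall>k>d. f k = \<zero>\<^bsub>A\<^esub>" "\<forall>k>e. g k = \<zero>\<^bsub>A\<^esub>" by (auto simp: laurent_simps)
    ultimately show "f \<oplus>\<^bsub>laurent A\<^esub> g \<in> carrier (laurent A)"
      by (auto simp: laurent_simps intro!: exI[of _ "max d e"])
  next
    fix f g assume "f \<in> carrier (laurent A)" "g \<in> carrier (laurent A)"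
    then have "f k \<oplus>\<^bsub>A\<^esub> g k = g k \<oplus>\<^bsub>A\<^esub> f k" for k by (intro a_comm) (simp_all add: laurent_simps)
    then show "f \<oplus>\<^bsub>laurent A\<^esub> g = g \<oplus>\<^bsub>laurent A\<^esub> f" by (simp add: laurent_simps)
  qed (auto simp: laurent_simps a_assoc)
qed

context twisted_setup
begin

abbreviation "U \<equiv> Uq q N"
abbreviation "L \<equiv> uq_series q N"

sublocale U: ring U by (rule Uq_ring)
sublocale L: abelian_monoid L by (rule laurent_abelian_monoid[OF Uq_ring])

text \<open>Passes from Laurent series over the product ring to the series ring of the definitions:
  one coordinate is kept, and the index changes sign because the formal variable is u^-1.\<close>

definition ser :: "uqs fls \<Rightarrow> int \<Rightarrow> uq" where
  "ser F = (\<lambda>k. coord q N (F $$ (- k)))"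

lemma ser_carrier [simp]: "ser F \<in> carrier L"
  unfolding laurent_simps by (auto simp: ser_def coord_simps intro!: exI[of _ "- fls_subdegree F"])

lemma ser_add: "ser (F + G) = ser F \<oplus>\<^bsub>L\<^esub> ser G"
  by (simp add: ser_def laurent_simps coord_simps)

lemma ser_zero: "ser 0 = \<zero>\<^bsub>L\<^esub>"
  by (simp add: ser_def laurent_simps coord_simps)

lemma ser_one: "ser 1 = \<one>\<^bsub>L\<^esub>"
proof
  show "ser 1 k = \<one>\<^bsub>L\<^esub> k" for k
    by (cases "k = 0") (simp_all add: ser_def laurent_simps coord_simps)
qed

lemma ser_mult: "ser (F * G) = ser F \<otimes>\<^bsub>L\<^esub> ser G"
proof
  fix k
  let ?d = "fls_subdegree F" and ?e = "fls_subdegree G"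
  let ?S = "{k + ?e..- ?d}"
  have "(F * G) $$ (- k) = (\<Sum>t=?d..- k - ?e. F $$ t * G $$ (- k - t))"
    by (rule fls_times_nth(2))
  also have "\<dots> = (\<Sum>i\<in>?S. F $$ (- i) * G $$ (- (k - i)))"
    by (rule sum.reindex_bij_witness[of _ uminus uminus]) auto
  finally have "ser (F * G) k = (\<Oplus>\<^bsub>U\<^esub> i\<in>?S. ser F i \<otimes>\<^bsub>U\<^esub> ser G (k - i))"
    by (simp add: ser_def coord_sum coord_simps)
  also have "\<dots> = (\<Oplus>\<^bsub>U\<^esub> i \<in> {i. ser F i \<noteq> \<zero>\<^bsub>U\<^esub> \<and> ser G (k - i) \<noteq> \<zero>\<^bsub>U\<^esub>}. ser F i \<otimes>\<^bsub>U\<^esub> ser G (k - i))"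
  \<comment> \<open>The product in \<open>laurent\<close> sums over the indices at which both
    entries are nonzero; they lie in the finite interval given by the two subdegrees.\<close>
  proof (rule U.add.finprod_mono_neutral_cong_right)
    show "{i. ser F i \<noteq> \<zero>\<^bsub>U\<^esub> \<and> ser G (k - i) \<noteq> \<zero>\<^bsub>U\<^esub>} \<subseteq> ?S"
    proof
      fix i assume "i \<in> {i. ser F i \<noteq> \<zero>\<^bsub>U\<^esub> \<and> ser G (k - i) \<noteq> \<zero>\<^bsub>U\<^esub>}"
      then have "F $$ (- i) \<noteq> 0" "G $$ (- (k - i)) \<noteq> 0" by (auto simp: ser_def coord_simps)
      then have "?d \<le> - i" "?e \<le> - (k - i)" by (auto intro: fls_subdegree_leI)
      then show "i \<in> ?S" by simp
    qed
    have c: "ser F i \<in> carrier U" "ser G i \<in> carrier U" for i by (simp_all add: ser_def)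
    show "ser F i \<otimes>\<^bsub>U\<^esub> ser G (k - i) = \<zero>\<^bsub>U\<^esub>"
      if "i \<in> ?S - {i. ser F i \<noteq> \<zero>\<^bsub>U\<^esub> \<and> ser G (k - i) \<noteq> \<zero>\<^bsub>U\<^esub>}" for i
    proof -
      have "ser F i = \<zero>\<^bsub>U\<^esub> \<or> ser G (k - i) = \<zero>\<^bsub>U\<^esub>" using that by blast
      then show ?thesis using U.l_null[OF c(2)] U.r_null[OF c(1)] by metis
    qed
    show "(\<lambda>i. ser F i \<otimes>\<^bsub>U\<^esub> ser G (k - i)) \<in> ?S \<rightarrow> carrier U"
      by (intro Pi_I U.m_closed c)
  qed (rule refl finite_atLeastAtMost_int)+
  also have "\<dots> = (ser F \<otimes>\<^bsub>L\<^esub> ser G) k" by (simp add: laurent_simps)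
  finally show "ser (F * G) k = (ser F \<otimes>\<^bsub>L\<^esub> ser G) k" .
qed

lemma ser_sum: "finite A \<Longrightarrow> ser (sum F A) = (\<Oplus>\<^bsub>L\<^esub> x\<in>A. ser (F x))"
  by (induction A rule: finite_induct) (simp_all add: ser_zero ser_add L.finsum_insert)

text \<open>Serves uniqueness of the determinant: a competing value is an arbitrary element of the
  series ring.\<close>

lemma ser_surj:
  assumes "g \<in> carrier L"
  shows "\<exists>F. g = ser F"
proof -
  obtain d where d: "\<And>k. k > d \<Longrightarrow> g k = \<zero>\<^bsub>U\<^esub>" and c: "\<And>k. g k \<in> carrier U"
    using assms by (auto simp: laurent_simps)
  define e where "e x = Abs_uqs (\<lambda>(q', N'). if (q', N') = (q, N) then x else \<zero>\<^bsub>Uq q' N'\<^esub>)" for x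
  have ce: "coord q' N' (e x) = (if (q', N') = (q, N) then x else \<zero>\<^bsub>Uq q' N'\<^esub>)" if "x \<in> carrier U" for x q' N'
    unfolding e_def by (rule coord_Abs) (use that ring.ring_simprules(2)[OF Uq_ring] in auto)
  have e0: "e \<zero>\<^bsub>U\<^esub> = 0" by (rule uqs_eqI) (auto simp: ce coord_simps)
  have "Abs_fls (\<lambda>n. e (g (- n))) $$ n = e (g (- n))" for n
    by (rule nth_Abs_fls_lower[of "- d"]) (simp add: d e0)
  then have "g = ser (Abs_fls (\<lambda>n. e (g (- n))))" by (simp add: ser_def ce c)
  then show ?thesis by blast
qed

lemma ser_const: "ser (iota (fls_const c)) = series_scalar q N c"
proof
  fix k
  have "uq_scalar q N 0 = \<zero>\<^bsub>U\<^esub>" using coord_sc[of q N 0] by (simp add: sc_zero coord_simps)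
  then show "ser (iota (fls_const c)) k = series_scalar q N c k"
    by (cases "k = 0") (simp_all add: ser_def iota_nth series_scalar_def coord_sc sc_zero coord_simps)
qed

abbreviation "idx \<equiv> tensor_idx N"

text \<open>The operators act on one more tensor factor, in position \<open>0\<close>.\<close>

definition ext :: "(nat \<Rightarrow> nat) \<Rightarrow> nat \<Rightarrow> nat" where
  "ext I = I(0 := 1)"

definition delta :: "(nat \<Rightarrow> nat) \<Rightarrow> (nat \<Rightarrow> nat) \<Rightarrow> uqs fls" where
  "delta J = (\<lambda>I. of_bool (I = ext J))"

lemma finite_idx: "finite idx"
  by (simp add: tensor_idx_def finite_PiE)

lemma ext_inj: "I \<in> idx \<Longrightarrow> J \<in> idx \<Longrightarrow> ext I = ext J \<longleftrightarrow> I = J"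
proof
  assume IJ: "I \<in> idx" "J \<in> idx" and e: "ext I = ext J"
  have "I 0 = J 0" using IJ PiE_arb[of I "{1..N}" "\<lambda>_. {1..N}" 0] PiE_arb[of J "{1..N}" "\<lambda>_. {1..N}" 0]
    by (simp add: tensor_idx_def)
  then show "I = J" using e unfolding ext_def by (metis fun_upd_triv fun_upd_upd)
qed simp

lemma idx_in: "I \<in> idx \<Longrightarrow> c \<in> {1..N} \<Longrightarrow> I c \<in> {1..N}"
  unfolding tensor_idx_def by (rule PiE_mem)

lemma grd_ext: "I \<in> idx \<Longrightarrow> grd N (ext I)"
  unfolding grd_def
proof (intro allI impI)
  fix c assume "I \<in> idx" "c \<le> N"
  then show "ext I c \<in> {1..N}" using idx_in[of I c] N_pos by (cases "c = 0") (simp_all add: ext_def)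
qed

text \<open>The second clause says that on the slice with index 1 in space 0 the values of g v
  depend only on v there; hence composition of operators matches multiplication of matrices.\<close>

definition rep :: "(int \<Rightarrow> uq) tensor_op \<Rightarrow> (((nat \<Rightarrow> nat) \<Rightarrow> uqs fls) \<Rightarrow> (nat \<Rightarrow> nat) \<Rightarrow> uqs fls) \<Rightarrow> bool" where
  "rep M g \<longleftrightarrow> (\<forall>I\<in>idx. \<forall>J\<in>idx. M I J = ser (g (delta J) (ext I)))
     \<and> (\<forall>v. \<forall>I\<in>idx. g v (ext I) = (\<Sum>K\<in>idx. g (delta K) (ext I) * v (ext K)))"

lemma repI:
  assumes "\<And>I J. I \<in> idx \<Longrightarrow> J \<in> idx \<Longrightarrow> M I J = ser (m I J)"
    and g: "\<And>v I. I \<in> idx \<Longrightarrow> g v (ext I) = (\<Sum>K\<in>idx. m I K * v (ext K))"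
  shows "rep M g"
proof -
  have "g (delta J) (ext I) = m I J" if I: "I \<in> idx" and J: "J \<in> idx" for I J
  proof -
    have "g (delta J) (ext I) = (\<Sum>K\<in>idx. if K = J then m I K else 0)"
      unfolding g[OF I] by (intro sum.cong refl) (auto simp: delta_def ext_inj J)
    then show ?thesis using J finite_idx by simp
  qed
  with assms show ?thesis by (simp add: rep_def)
qed

lemma rep_entry: "rep M g \<Longrightarrow> I \<in> idx \<Longrightarrow> J \<in> idx \<Longrightarrow> M I J = ser (g (delta J) (ext I))"
  and rep_sum: "rep M g \<Longrightarrow> I \<in> idx \<Longrightarrow> g v (ext I) = (\<Sum>K\<in>idx. g (delta K) (ext I) * v (ext K))"
  by (auto simp: rep_def)

lemma rep_cong:
  assumes "rep M g" "\<And>v I. I \<in> idx \<Longrightarrow> g' v (ext I) = g v (ext I)"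
  shows "rep M g'"
proof (rule repI)
  show "M I J = ser (g (delta J) (ext I))" if "I \<in> idx" "J \<in> idx" for I J
    using rep_entry[OF assms(1) that] .
  show "g' v (ext I) = (\<Sum>K\<in>idx. g (delta K) (ext I) * v (ext K))" if "I \<in> idx" for v I
    using assms(2)[OF that, of v] rep_sum[OF assms(1) that, of v] by (rule trans)
qed

lemma rep_one: "rep (op_one L) (\<lambda>v. v)"
proof (rule repI)
  show "op_one L I J = ser (of_bool (I = J))" for I J by (simp add: op_one_def ser_one ser_zero)
  show "v (ext I) = (\<Sum>K\<in>idx. of_bool (I = K) * v (ext K))" if "I \<in> idx" for v :: "(nat \<Rightarrow> nat) \<Rightarrow> uqs fls" and I
  proof -
    have "(\<Sum>K\<in>idx. of_bool (I = K) * v (ext K)) = (\<Sum>K\<in>idx. if K = I then v (ext K) else 0)"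
      by (intro sum.cong) auto
    then show ?thesis using that finite_idx by simp
  qed
qed

lemma rep_mult:
  assumes M: "rep M g" and M': "rep M' g'"
  shows "rep (op_mult L N M M') (\<lambda>v. g (g' v))"
proof (rule repI)
  fix I J assume I: "I \<in> idx" and J: "J \<in> idx"
  have "op_mult L N M M' I J = (\<Oplus>\<^bsub>L\<^esub> K\<in>idx. ser (g (delta K) (ext I) * g' (delta J) (ext K)))"
    unfolding op_mult_def by (rule L.finsum_cong') (auto simp: rep_entry[OF M] rep_entry[OF M'] I J simp flip: ser_mult)
  also have "\<dots> = ser (\<Sum>K\<in>idx. g (delta K) (ext I) * g' (delta J) (ext K))"
    by (rule ser_sum[symmetric, OF finite_idx])
  finally show "op_mult L N M M' I J = ser (\<Sum>K\<in>idx. g (delta K) (ext I) * g' (delta J) (ext K))" .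
next
  fix v I assume I: "I \<in> idx"
  have "g (g' v) (ext I) = (\<Sum>K\<in>idx. g (delta K) (ext I) * (\<Sum>J\<in>idx. g' (delta J) (ext K) * v (ext J)))"
    by (subst rep_sum[OF M I]) (intro sum.cong refl arg_cong2[where f = "(*)"] rep_sum[OF M'])
  also have "\<dots> = (\<Sum>J\<in>idx. (\<Sum>K\<in>idx. g (delta K) (ext I) * g' (delta J) (ext K)) * v (ext J))"
    unfolding sum_distrib_left sum_distrib_right mult.assoc by (rule sum.swap)
  finally show "g (g' v) (ext I) = (\<Sum>J\<in>idx. (\<Sum>K\<in>idx. g (delta K) (ext I) * g' (delta J) (ext K)) * v (ext J))" .
qed

lemma rep_foldr:
  assumes "rep M g" "\<And>x. x \<in> set xs \<Longrightarrow> rep (F x) (G x)"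
  shows "rep (foldr (op_mult L N) (map F xs) M) (\<lambda>v. foldr G xs (g v))"
  using assms(2)
proof (induction xs)
  case Nil
  then show ?case using assms(1) by simp
next
  case (Cons x xs)
  then show ?case using rep_mult[of "F x" "G x"] by simp
qed

lemma idx_upd: "I \<in> idx \<Longrightarrow> a \<in> {1..N} \<Longrightarrow> j \<in> {1..N} \<Longrightarrow> I(a := j) \<in> idx"
  unfolding tensor_idx_def by (auto simp: PiE_iff extensional_def)

lemma idx_eqI:
  assumes "I \<in> idx" "J \<in> idx" "\<And>c. c \<in> {1..N} \<Longrightarrow> I c = J c"
  shows "I = J"
  using assms unfolding tensor_idx_def by (intro PiE_ext[of I "{1..N}" "\<lambda>_. {1..N}" J]) auto

lemma ext_upd: "a \<noteq> 0 \<Longrightarrow> ext (I(a := j)) = (ext I)(a := j)"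
  by (auto simp: ext_def)

lemma rep_in_copy:
  assumes a: "a \<in> {1..N}" and M: "\<And>i j. i \<in> {1..N} \<Longrightarrow> j \<in> {1..N} \<Longrightarrow> M i j = ser (m i j)"
  shows "rep (in_copy L N a M) (op1 N a m)"
proof (rule repI)
  fix I J assume "I \<in> idx" "J \<in> idx"
  then show "in_copy L N a M I J = ser (if \<forall>c\<in>{1..N} - {a}. I c = J c then m (I a) (J a) else 0)"
    using idx_in[OF _ a] by (simp add: in_copy_def M ser_zero)
next
  fix v I assume I: "I \<in> idx"
  have a0: "a \<noteq> 0" using a by simp
  let ?agree = "\<lambda>K. \<forall>c\<in>{1..N} - {a}. I c = K c"
  have "(\<Sum>K\<in>idx. (if ?agree K then m (I a) (K a) else 0) * v (ext K))
     = (\<Sum>K\<in>{K \<in> idx. ?agree K}. m (I a) (K a) * v (ext K))"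
    by (rule sum.mono_neutral_cong_right) (auto simp: finite_idx)
  also have "\<dots> = (\<Sum>j=1..N. m (I a) j * v ((ext I)(a := j)))"
  proof (rule sum.reindex_bij_witness[of _ "\<lambda>j. I(a := j)" "\<lambda>K. K a"])
    fix K assume K: "K \<in> {K \<in> idx. ?agree K}"
    then show e: "I(a := K a) = K" using I a idx_in[of K a] by (intro idx_eqI idx_upd) auto
    show "K a \<in> {1..N}" using K a idx_in by blast
    show "m (I a) (K a) * v ((ext I)(a := K a)) = m (I a) (K a) * v (ext K)"
      by (simp only: ext_upd[OF a0, symmetric] e)
  qed (use I a idx_upd in auto)
  finally show "op1 N a m v (ext I) = (\<Sum>K\<in>idx. (if ?agree K then m (I a) (K a) else 0) * v (ext K))"
    using grd_ext[OF I] a0 by (simp add: op1_def ext_def)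
qed

lemma rep_in_copies:
  assumes a: "a \<in> {1..N}" and b: "b \<in> {1..N}" and ab: "a \<noteq> b"
    and M: "\<And>i j k l. i \<in> {1..N} \<Longrightarrow> j \<in> {1..N} \<Longrightarrow> k \<in> {1..N} \<Longrightarrow> l \<in> {1..N} \<Longrightarrow> M i j k l = ser (m i j k l)"
  shows "rep (in_copies L N a b M) (op2 N a b m)"
proof (rule repI)
  fix I J assume "I \<in> idx" "J \<in> idx"
  then show "in_copies L N a b M I J = ser (if \<forall>c\<in>{1..N} - {a, b}. I c = J c then m (I a) (J a) (I b) (J b) else 0)"
    using idx_in[OF _ a] idx_in[OF _ b] by (simp add: in_copies_def M ser_zero)
next
  fix v I assume I: "I \<in> idx"
  have a0: "a \<noteq> 0" and b0: "b \<noteq> 0" using a b by auto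
  let ?agree = "\<lambda>K. \<forall>c\<in>{1..N} - {a, b}. I c = K c"
  have "(\<Sum>K\<in>idx. (if ?agree K then m (I a) (K a) (I b) (K b) else 0) * v (ext K))
     = (\<Sum>K\<in>{K \<in> idx. ?agree K}. m (I a) (K a) (I b) (K b) * v (ext K))"
    by (rule sum.mono_neutral_cong_right) (auto simp: finite_idx)
  also have "\<dots> = (\<Sum>(j, l)\<in>{1..N} \<times> {1..N}. m (I a) j (I b) l * v ((ext I)(a := j, b := l)))"
  proof (rule sum.reindex_bij_witness[of _ "\<lambda>(j, l). I(a := j, b := l)" "\<lambda>K. (K a, K b)"])
    fix K assume K: "K \<in> {K \<in> idx. ?agree K}"
    then have e: "I(a := K a, b := K b) = K" using I a b ab idx_in[of K a] idx_in[of K b] by (intro idx_eqI idx_upd) auto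
    then show "(case (K a, K b) of (j, l) \<Rightarrow> I(a := j, b := l)) = K" by simp
    show "(K a, K b) \<in> {1..N} \<times> {1..N}" using K a b idx_in by blast
    show "(case (K a, K b) of (j, l) \<Rightarrow> m (I a) j (I b) l * v ((ext I)(a := j, b := l))) = m (I a) (K a) (I b) (K b) * v (ext K)"
      unfolding prod.case by (simp only: ext_upd[OF a0, symmetric] ext_upd[OF b0, symmetric] e)
  qed (use I a b ab idx_upd in \<open>auto split: if_splits\<close>)
  also have "\<dots> = (\<Sum>j=1..N. \<Sum>l=1..N. m (I a) j (I b) l * v ((ext I)(a := j, b := l)))"
    by (rule sum.cartesian_product[symmetric])
  finally show "op2 N a b m v (ext I) = (\<Sum>K\<in>idx. (if ?agree K then m (I a) (K a) (I b) (K b) else 0) * v (ext K))"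
    using grd_ext[OF I] a0 b0 by (simp add: op2_def ext_def)
qed

end

section \<open>Matrices of the antisymmetrizer and of the ordered product\<close>

context twisted_setup
begin

lemma adjacent_word_spec:
  assumes "\<sigma> permutes {1..N}"
  shows "set (adjacent_word N \<sigma>) \<subseteq> {1..<N}" "apply_adj_transps (adjacent_word N \<sigma>) = \<sigma>"
proof -
  have e: "foldr (\<lambda>i \<tau>. Transposition.transpose i (Suc i) \<circ> \<tau>) ws id = apply_adj_transps ws" for ws
    by (induction ws) simp_all
  have "\<exists>ws. set ws \<subseteq> {1..<N} \<and> foldr (\<lambda>i \<tau>. Transposition.transpose i (Suc i) \<circ> \<tau>) ws id = \<sigma>"
    using adjacent_factorization[OF assms] by (simp only: e)
  from someI_ex[OF this] show "set (adjacent_word N \<sigma>) \<subseteq> {1..<N}" "apply_adj_transps (adjacent_word N \<sigma>) = \<sigma>"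
    unfolding adjacent_word_def e by blast+
qed

text \<open>Any word for a permutation gives the same operator on the grid, so the choice made by
  \<open>adjacent_word\<close> is immaterial. The cutoff accounts for the empty word.\<close>

lemma P_word:
  assumes "set ws \<subseteq> {1..<N}"
  shows "cutoff N (foldr anti.P ws v) = anti.Pp (apply_adj_transps ws) v"
  using assms
proof (induction ws)
  case Nil
  have "cutoff N (foldr anti.P [] v) = cutoff N v" by simp
  also have "\<dots> = anti.Pp id v"
    by (rule HOL.ext) (simp add: anti.Pp_def cutoff_def iota.\<iota>_one)
  finally show ?case unfolding apply_adj_transps_Nil .
next
  case (Cons i ws)
  then have i: "1 \<le> i" "i < N" by auto
  have o: "oper N (anti.P i)" unfolding anti.P_def by (rule oper_op2)
  have "cutoff N (foldr anti.P (i # ws) v) = anti.P i (cutoff N (foldr anti.P ws v))"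
    by (simp add: oper_cutoff[OF o])
  also have "\<dots> = anti.Pp (adj i) (anti.Pp (apply_adj_transps ws) v)"
    using Cons by (simp add: anti.P_eq_Pp[OF i])
  also have "\<dots> = anti.Pp (apply_adj_transps (i # ws)) v"
    by (simp add: anti.Pp_comp[OF permutes_adj[OF i]])
  finally show ?case .
qed

lemma Pq_eq: "Pq q i j k l = Pm q i j k l"
  by (auto simp: Pq_def Pm_def Pcoef_def)

lemma Pm_const: "Pm K i j k l = fls_const (Pm q i j k l)"
proof -
  have "inverse K = fls_const (inverse q)" by (simp add: fls_inverse_const)
  then show ?thesis by (auto simp: Pm_def Pcoef_def)
qed

lemma rep_Pq_perm:
  assumes "\<sigma> permutes {1..N}"
  shows "rep (Pq_perm q N \<sigma>) (anti.Pp \<sigma>)"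
proof -
  let ?ws = "adjacent_word N \<sigma>"
  note ws = adjacent_word_spec[OF assms]
  have "rep (Pq_perm q N \<sigma>) (\<lambda>v. foldr anti.P ?ws v)"
    unfolding Pq_perm_def op_prod_def
  proof (rule rep_foldr[OF rep_one])
    fix i assume "i \<in> set ?ws"
    then have i: "i \<in> {1..N}" "Suc i \<in> {1..N}" "i \<noteq> Suc i" using ws(1) by auto
    show "rep (in_copies L N i (Suc i) (\<lambda>a b c d. series_scalar q N (Pq q a b c d))) (anti.P i)"
      unfolding anti.P_def by (rule rep_in_copies[OF i]) (simp only: Pm_const ser_const Pq_eq)
  qed
  then show ?thesis
  proof (rule rep_cong)
    fix v I assume "I \<in> idx"
    then have "grd N (ext I)" by (rule grd_ext)
    moreover have "cutoff N (foldr anti.P ?ws v) (ext I) = anti.Pp \<sigma> v (ext I)"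
      using P_word[OF ws(1), of v] ws(2) by simp
    ultimately show "anti.Pp \<sigma> v (ext I) = foldr anti.P ?ws v (ext I)" by (simp add: cutoff_def)
  qed
qed

lemma rep_Aq: "rep (Aq q N) anti.A"
proof (rule repI)
  let ?S = "{\<sigma>. \<sigma> permutes {1..N}}"
  have fin: "finite ?S" by (simp add: finite_permutations)
  let ?m = "\<lambda>I J. \<Sum>\<sigma>\<in>?S. iota (of_int (sign \<sigma>)) * anti.Pp \<sigma> (delta J) (ext I)"
  fix I assume I: "I \<in> idx"
  show "Aq q N I J = ser (?m I J)" if J: "J \<in> idx" for J
  proof -
    have "Aq q N I J = (\<Oplus>\<^bsub>L\<^esub> \<sigma>\<in>?S. ser (iota (of_int (sign \<sigma>)) * anti.Pp \<sigma> (delta J) (ext I)))"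
      unfolding Aq_def
    proof (rule L.finsum_cong')
      fix \<sigma> assume "\<sigma> \<in> ?S"
      then show "series_scalar q N (of_int (sign \<sigma>)) \<otimes>\<^bsub>L\<^esub> Pq_perm q N \<sigma> I J
          = ser (iota (of_int (sign \<sigma>)) * anti.Pp \<sigma> (delta J) (ext I))"
        using rep_entry[OF rep_Pq_perm I J, of \<sigma>] by (simp add: ser_mult ser_const[symmetric] fls_of_int)
    qed simp_all
    then show ?thesis by (simp only: ser_sum[OF fin])
  qed
  show "anti.A v (ext I) = (\<Sum>J\<in>idx. ?m I J * v (ext J))" for v
  proof -
    have "anti.A v (ext I) = (\<Sum>\<sigma>\<in>?S. iota (of_int (sign \<sigma>)) * (\<Sum>J\<in>idx. anti.Pp \<sigma> (delta J) (ext I) * v (ext J)))"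
      unfolding anti.A_def
      by (intro sum.cong refl arg_cong2[where f = "(*)"] rep_sum[OF rep_Pq_perm I]) simp
    also have "\<dots> = (\<Sum>J\<in>idx. ?m I J * v (ext J))"
      unfolding sum_distrib_left sum_distrib_right mult.assoc by (rule sum.swap)
    finally show ?thesis .
  qed
qed

lemma Gm_eq: "m \<ge> 1 \<Longrightarrow> Gm ty q m p = Gmat ty q m p"
  by (cases ty) (auto simp: Gm_def)

lemma ser_Tm: "i \<in> {1..N} \<Longrightarrow> j \<in> {1..N} \<Longrightarrow> ser (Tm 1 i j) = T_ser q N i j"
  unfolding ser_def T_ser_def Tm_def
  by (simp add: ev_nth one_sided_t sc_one coord_cls t_free_carrier)

lemma ser_Bm: "i \<in> {1..N} \<Longrightarrow> j \<in> {1..N} \<Longrightarrow> ser (Bm 1 i j) = (\<lambda>k. Tbar_ser q N i j (- k))"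
  unfolding ser_def Tbar_ser_def Bm_def
  by (simp add: ev_nth one_sided_t sc_one coord_cls t_free_carrier)

lemma ser_Sm:
  assumes "i \<in> {1..N}" "j \<in> {1..N}"
  shows "ser (Sm 1 i j) = S_ser ty q N i j"
proof -
  have "S_ser ty q N i j = (\<Oplus>\<^bsub>L\<^esub> a\<in>{1..N}. \<Oplus>\<^bsub>L\<^esub> b\<in>{1..N}. ser (Tm 1 i a * iota (Gm ty K a b) * Bm 1 j b))"
    unfolding S_ser_def
  proof (intro L.finsum_cong' refl)
    fix a b assume ab: "a \<in> {1..N}" "b \<in> {1..N}"
    show "T_ser q N i a \<otimes>\<^bsub>L\<^esub> series_scalar q N (Gmat ty q a b) \<otimes>\<^bsub>L\<^esub> (\<lambda>k. Tbar_ser q N j b (- k))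
        = ser (Tm 1 i a * iota (Gm ty K a b) * Bm 1 j b)"
      using ab assms by (simp add: ser_mult ser_Tm ser_Bm Gm_const ser_const Gm_eq)
  qed (auto intro!: L.finsum_closed)
  also have "\<dots> = (\<Oplus>\<^bsub>L\<^esub> a\<in>{1..N}. ser (\<Sum>b=1..N. Tm 1 i a * iota (Gm ty K a b) * Bm 1 j b))"
    by (simp add: ser_sum)
  also have "\<dots> = ser (Sm 1 i j)" by (simp add: ser_sum Sm_def)
  finally show ?thesis ..
qed

lemma ser_Sm_shift:
  assumes "i \<in> {1..N}" "j \<in> {1..N}"
  shows "S_shifted ty q N a i j = ser (Sm (shift q a) i j)"
  unfolding S_shifted_def ser_Sm[OF assms, symmetric]
  by (auto simp: ser_def Sm_nth[OF shift_nz] coord_simps coord_sc)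

lemma ser_Rt: "Rt_shifted q N a b i j k l = ser (iota (Rt K (1 / umon (-1) (shift q a)) (umon (-1) (shift q b)) i j k l))"
proof
  fix m
  have z: "uq_scalar q N 0 = \<zero>\<^bsub>U\<^esub>" using coord_sc[of q N 0] by (simp add: sc_zero coord_simps)
  have e: "Rt K (1 / umon (-1) (shift q a)) (umon (-1) (shift q b)) i j k l $$ (- m)
     = Rmat q 1 0 j i k l * (umon 1 (1 / shift q a) $$ (- m)) + Rmat q 0 1 j i k l * (umon (-1) (shift q b) $$ (- m))"
    unfolding Rt_def inverse_umon[OF shift_nz] minus_minus
    by (subst Rm_linear) (simp only: Rm_const' fls_plus_nth fls_mult_const_nth)
  have "Rmat_t q (inverse (shift q a)) 0 i j k l = Rmat q 1 0 j i k l * (1 / shift q a)"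
    "Rmat_t q 0 (shift q b) i j k l = Rmat q 0 1 j i k l * shift q b"
    unfolding Rmat_t_def Rmat_eq_Rm
    using Rm_linear[of q "inverse (shift q a)" 0 j i k l] Rm_linear[of q 0 "shift q b" j i k l] by (simp_all add: divide_inverse)
  then show "Rt_shifted q N a b i j k l m = ser (iota (Rt K (1 / umon (-1) (shift q a)) (umon (-1) (shift q b)) i j k l)) m"
    unfolding ser_def iota_nth e coord_sc Rt_shifted_def by (auto simp: umon_nth z)
qed

text \<open>Downward induction on the first space: tails of the list of factors correspond to tails
  of \<open>chain\<close>, beginning with the identity.\<close>

lemma rep_factors: "rep (op_prod L N (sdet_factors ty q N)) (chain Ss Qs [1..<Suc N])"
proof -
  let ?blk = "\<lambda>a. in_copy L N a (S_shifted ty q N a)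
        # map (\<lambda>b. in_copies L N a b (Rt_shifted q N a b)) [Suc a..<Suc N]"
  have "rep (foldr (op_mult L N) (concat (map ?blk [a..<Suc N])) (op_one L)) (chain Ss Qs [a..<Suc N])"
    if "a \<ge> 1" "a \<le> Suc N" for a
    using that(2,1)
  proof (induction rule: inc_induct)
    case base
    have "chain Ss Qs [] = (\<lambda>v. v)" by (rule HOL.ext) simp
    then show ?case using rep_one by simp
  next
    case (step a)
    then have a: "a \<in> {1..N}" by auto
    have sp: "[a..<Suc N] = a # [Suc a..<Suc N]" using step by (simp add: upt_conv_Cons)
    have "rep (foldr (op_mult L N) (map (\<lambda>b. in_copies L N a b (Rt_shifted q N a b)) [Suc a..<Suc N])
        (foldr (op_mult L N) (concat (map ?blk [Suc a..<Suc N])) (op_one L)))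
        (\<lambda>v. foldr (Qs a) [Suc a..<Suc N] (chain Ss Qs [Suc a..<Suc N] v))"
    proof (rule rep_foldr)
      show "rep (foldr (op_mult L N) (concat (map ?blk [Suc a..<Suc N])) (op_one L)) (chain Ss Qs [Suc a..<Suc N])"
        using step by simp
      fix b assume "b \<in> set [Suc a..<Suc N]"
      then have b: "b \<in> {1..N}" "a \<noteq> b" by auto
      show "rep (in_copies L N a b (Rt_shifted q N a b)) (Qs a b)"
        unfolding Qs_def by (rule rep_in_copies[OF a b]) (rule ser_Rt)
    qed
    moreover have "rep (in_copy L N a (S_shifted ty q N a)) (Ss a)"
      unfolding Ss_def by (rule rep_in_copy[OF a]) (rule ser_Sm_shift)
    ultimately have "rep (op_mult L N (in_copy L N a (S_shifted ty q N a))
        (foldr (op_mult L N) (map (\<lambda>b. in_copies L N a b (Rt_shifted q N a b)) [Suc a..<Suc N])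
          (foldr (op_mult L N) (concat (map ?blk [Suc a..<Suc N])) (op_one L))))
        (\<lambda>v. Ss a (foldr (Qs a) [Suc a..<Suc N] (chain Ss Qs [Suc a..<Suc N] v)))"
      using rep_mult by blast
    moreover have "chain Ss Qs [a..<Suc N] = (\<lambda>v. Ss a (foldr (Qs a) [Suc a..<Suc N] (chain Ss Qs [Suc a..<Suc N] v)))"
      unfolding sp by (rule HOL.ext) (rule chain.simps(2))
    ultimately show ?case unfolding sp by (simp only: list.map concat.simps foldr_append foldr.simps append_Cons comp_apply)
  qed
  from this[of 1] show ?thesis unfolding op_prod_def sdet_factors_def by simp
qed

text \<open>The scalar f stands to the left of \<open>A\<close> in \<open>ex_sdet\<close> but to the
  right in the definition of \<open>sdet\<close>. On basis vectors both agree, since the entries of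
  \<open>A\<close> are central scalars.\<close>

lemma A_left_const: "x * anti.A (delta J) I = anti.A (delta J) I * x"
proof -
  have "x * anti.A v I = anti.A (\<lambda>J. x * v J) I" for v
    unfolding anti.A_def anti.Pp_def sum_distrib_left
    by (intro sum.cong refl) (simp add: iota.\<iota>_left_commute[of x])
  moreover have "(\<lambda>I. x * delta J I) = (\<lambda>I. delta J I * x)" by (auto simp: delta_def)
  ultimately show ?thesis by (simp only: oper_scale[OF anti.oper_A])
qed

definition idx0 :: "nat \<Rightarrow> nat" where
  "idx0 = restrict id {1..N}"

lemma idx0: "idx0 \<in> idx" "anti.A (delta idx0) (ext idx0) = 1"
proof -
  show i: "idx0 \<in> idx" unfolding idx0_def tensor_idx_def by auto
  have "inj_on (ext idx0) {1..N}" by (auto simp: inj_on_def ext_def idx0_def)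
  then show "anti.A (delta idx0) (ext idx0) = 1"
    unfolding delta_def by (rule anti.A_delta[OF grd_ext[OF i]])
qed

text \<open>Existence is the scalar equation for A X; uniqueness comes from the entry of
  \<open>A\<close> at the identity word, which is 1.\<close>

lemma sdet_eq:
  assumes f: "\<And>v. anti.A (chain Ss Qs [1..<Suc N] v) = (\<lambda>I. f * anti.A v I)"
  shows "sdet ty q N = ser f"
  unfolding sdet_def
proof (rule the_equality)
  have R: "rep (op_prod L N (Aq q N # sdet_factors ty q N)) (\<lambda>v. anti.A (chain Ss Qs [1..<Suc N] v))"
    using rep_mult[OF rep_Aq rep_factors] by (simp add: op_prod_def)
  have eq: "op_prod L N (Aq q N # sdet_factors ty q N) I J = Aq q N I J \<otimes>\<^bsub>L\<^esub> ser f"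
    if "I \<in> idx" "J \<in> idx" for I J
    unfolding rep_entry[OF R that] rep_entry[OF rep_Aq that] f A_left_const ser_mult ..
  then show "ser f \<in> carrier L \<and> (\<forall>I\<in>idx. \<forall>J\<in>idx. op_prod L N (Aq q N # sdet_factors ty q N) I J = Aq q N I J \<otimes>\<^bsub>L\<^esub> ser f)"
    by simp
  fix g assume g: "g \<in> carrier L \<and> (\<forall>I\<in>idx. \<forall>J\<in>idx. op_prod L N (Aq q N # sdet_factors ty q N) I J = Aq q N I J \<otimes>\<^bsub>L\<^esub> g)"
  then obtain G where G: "g = ser G" using ser_surj by blast
  have "Aq q N idx0 idx0 \<otimes>\<^bsub>L\<^esub> g = Aq q N idx0 idx0 \<otimes>\<^bsub>L\<^esub> ser f"
    using g eq[OF idx0(1) idx0(1)] idx0(1) by metis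
  then have "ser (1 * G) = ser (1 * f)"
    unfolding rep_entry[OF rep_Aq idx0(1) idx0(1)] idx0(2) G ser_mult .
  then show "g = ser f" by (simp add: G)
qed

section \<open>Membership in the twisted q-Yangian and centrality\<close>

abbreviation "Y \<equiv> generate_ring U (range (uq_scalar q N) \<union> Ytw_gens ty q N)"

lemma s_coeff_eq: "i \<in> {1..N} \<Longrightarrow> j \<in> {1..N} \<Longrightarrow> s_coeff ty q N i j r = coord q N (Sm 1 i j $$ int r)"
  unfolding s_coeff_def by (simp add: ser_Sm[symmetric] ser_def)

definition YF :: "uqs fls set" where
  "YF = {F. \<forall>n. coord q N (F $$ n) \<in> Y}"

lemma Y_zero: "\<zero>\<^bsub>U\<^esub> \<in> Y"
  by (rule U.zero_in_generate)

lemma Y_sum: "finite A \<Longrightarrow> (\<And>x. x \<in> A \<Longrightarrow> coord q N (f x) \<in> Y) \<Longrightarrow> coord q N (sum f A) \<in> Y"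
proof (induction A rule: finite_induct)
  case empty
  show ?case using Y_zero by (simp add: coord_simps)
next
  case (insert x A)
  then show ?case by (simp add: coord_simps generate_ring.eng_add)
qed

lemma YF_add: "F \<in> YF \<Longrightarrow> G \<in> YF \<Longrightarrow> F + G \<in> YF"
  unfolding YF_def by (auto simp: coord_simps intro: generate_ring.eng_add)

lemma YF_mult: "F \<in> YF \<Longrightarrow> G \<in> YF \<Longrightarrow> F * G \<in> YF"
  unfolding YF_def mem_Collect_eq fls_times_nth(2) by (auto intro!: Y_sum generate_ring.eng_mult simp: coord_simps)

lemma YF_0: "0 \<in> YF"
  unfolding YF_def using Y_zero by (auto simp: coord_simps)

lemma YF_sum: "(\<And>x. x \<in> A \<Longrightarrow> F x \<in> YF) \<Longrightarrow> sum F A \<in> YF"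
  by (induction A rule: infinite_finite_induct) (auto intro: YF_0 YF_add)

lemma YF_iota: "iota c \<in> YF"
  unfolding YF_def by (auto simp: iota_nth coord_sc intro: generate_ring.incl)

lemma YF_Sm:
  assumes "i \<in> {1..N}" "j \<in> {1..N}" "c \<noteq> 0"
  shows "Sm c i j \<in> YF"
proof -
  have "coord q N (Sm 1 i j $$ n) \<in> Y" for n
  proof (cases "n < 0")
    case False
    then have "coord q N (Sm 1 i j $$ n) = s_coeff ty q N i j (nat n)" using assms by (simp add: s_coeff_eq)
    moreover have "s_coeff ty q N i j (nat n) \<in> Ytw_gens ty q N" using assms unfolding Ytw_gens_def by blast
    ultimately show ?thesis by (simp add: generate_ring.incl)
  qed (simp add: Sm_neg coord_simps Y_zero)
  moreover have "coord q N (sc d) \<in> Y" for d by (simp add: coord_sc generate_ring.incl)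
  ultimately show ?thesis
    unfolding YF_def mem_Collect_eq Sm_nth[OF assms(3)] by (simp add: coord_simps generate_ring.eng_mult)
qed

definition YV :: "((nat \<Rightarrow> nat) \<Rightarrow> uqs fls) \<Rightarrow> bool" where
  "YV v \<longleftrightarrow> (\<forall>I. v I \<in> YF)"

lemma YV_Ss: "a \<in> {1..N} \<Longrightarrow> YV v \<Longrightarrow> YV (Ss a v)"
  unfolding YV_def Ss_def op1_def
  using grdD[of N _ a] by (auto intro!: YF_0 YF_sum YF_mult YF_Sm shift_nz)

lemma YV_Qs: "YV v \<Longrightarrow> YV (Qs a b v)"
  unfolding YV_def Qs_def op2_def by (auto intro!: YF_0 YF_sum YF_mult YF_iota)

lemma YV_A: "YV v \<Longrightarrow> YV (anti.A v)"
  unfolding YV_def anti.A_def anti.Pp_def by (auto intro!: YF_0 YF_sum YF_mult YF_iota)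

lemma YV_chain: "set xs \<subseteq> {1..N} \<Longrightarrow> YV v \<Longrightarrow> YV (chain Ss Qs xs v)"
proof (induction xs)
  case (Cons a xs)
  have "YV (foldr (Qs a) ys w)" if "YV w" for ys w
    using that by (induction ys) (simp_all add: YV_Qs)
  with Cons show ?case by (simp add: YV_Ss)
qed simp

text \<open>At the identity word the entry of A X is f times 1, and all operators in the product
  have coefficients in the subalgebra.\<close>

lemma sdet_in_YF:
  assumes f: "\<And>v. anti.A (chain Ss Qs [1..<Suc N] v) = (\<lambda>I. f * anti.A v I)"
  shows "f \<in> YF"
proof -
  have "YV (delta idx0)"
    unfolding YV_def delta_def using YF_iota[of 1] YF_0 by (auto simp: iota.\<iota>_one)
  then have "YV (anti.A (chain Ss Qs [1..<Suc N] (delta idx0)))" by (intro YV_A YV_chain) auto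
  then have "f * anti.A (delta idx0) (ext idx0) \<in> YF" unfolding f YV_def by blast
  then show ?thesis by (simp add: idx0)
qed

lemma cls_relator: "g \<in> uq_relators q N \<Longrightarrow> cls q N g = 0"
proof -
  assume g: "g \<in> uq_relators q N"
  interpret F: ring "uq_free N" by (rule free_algebra_ring)
  have gc: "g \<in> carrier (uq_free N)" using g uq_relators_carrier by blast
  have "g \<ominus>\<^bsub>uq_free N\<^esub> \<zero>\<^bsub>uq_free N\<^esub> = g" using gc by algebra
  then have "uq_class q N g = uq_class q N \<zero>\<^bsub>uq_free N\<^esub>"
    using g gc by (intro uq_class_eqI) auto
  then have "cls q N g = cls q N \<zero>\<^bsub>uq_free N\<^esub>" by (simp only: cls_def)
  then show ?thesis by (simp only: free_algebra_simps(4) cls_zero)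
qed

lemma T_unit:
  assumes i: "i \<in> {1..N}"
  shows "coord q N (tt i i 0) \<in> Units U" "coord q N (tb i i 0) \<in> Units U"
proof -
  let ?F = "uq_free N"
  interpret F: ring ?F by (rule free_algebra_ring)
  let ?t = "free_gen (Tgen i i 0)" and ?b = "free_gen (Tbargen i i 0)"
  have c: "?t \<in> carrier ?F" "?b \<in> carrier ?F" using i by (auto simp: uq_gens_def intro!: free_gen_carrier)
  have "?t \<otimes>\<^bsub>?F\<^esub> ?b \<ominus>\<^bsub>?F\<^esub> \<one>\<^bsub>?F\<^esub> \<in> uq_relators q N" "?b \<otimes>\<^bsub>?F\<^esub> ?t \<ominus>\<^bsub>?F\<^esub> \<one>\<^bsub>?F\<^esub> \<in> uq_relators q N"
    using i unfolding uq_relators_def by blast+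
  then have e: "uq_class q N (?t \<otimes>\<^bsub>?F\<^esub> ?b) = \<one>\<^bsub>U\<^esub>" "uq_class q N (?b \<otimes>\<^bsub>?F\<^esub> ?t) = \<one>\<^bsub>U\<^esub>"
    using c uq_class_eqI[where g = "\<one>\<^bsub>?F\<^esub>" and N = N and q = q] uq_class_one[of q N] by auto
  have "uq_class q N ?t \<in> Units U" "uq_class q N ?b \<in> Units U"
    unfolding Units_def using c e by (auto simp: uq_class_mult uq_class_carrier)
  then show "coord q N (tt i i 0) \<in> Units U" "coord q N (tb i i 0) \<in> Units U"
    using c by (simp_all add: coord_cls t_free_def tbar_free_def)
qed

text \<open>By triangularity of the zero modes of T and of the barred matrix, the sum reduces to q
  times the product of the diagonal zero modes t at 2k-1 and tbar at 2k, all of them units. This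
  gives meaning to the inverses among the generators.\<close>

lemma s_unit:
  assumes ty: "ty = Symplectic" and k: "1 \<le> k" "2 * k \<le> N"
  shows "s_coeff ty q N (2 * k - 1) (2 * k) 0 \<in> Units U"
proof -
  let ?i = "2 * k - 1" and ?j = "2 * k"
  have V: "?i \<in> {1..N}" "?j \<in> {1..N}" using k by auto
  have TB: "(Tm 1 i m * Bm 1 j p) $$ 0 = tt i m 0 * tb j p 0" for i m j p
    unfolding TB_nth Tm_nth Bm_nth by (simp add: sc_one)
  have t0: "tt i m 0 = 0" if "i \<in> {1..N}" "m \<in> {1..N}" "i < m" for i m
  proof -
    have "free_gen (Tgen i m 0) \<in> uq_relators q N" using that unfolding uq_relators_def by blast
    then show ?thesis using cls_relator by (simp add: t_free_def)
  qed
  have b0: "tb j p 0 = 0" if "j \<in> {1..N}" "p \<in> {1..N}" "p < j" for j p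
  proof -
    have "free_gen (Tbargen j p 0) \<in> uq_relators q N" using that unfolding uq_relators_def by blast
    then show ?thesis using cls_relator by (simp add: tbar_free_def)
  qed
  have "Sm 1 ?i ?j $$ 0 = (\<Sum>m=1..N. \<Sum>p=1..N. sc (Gm ty q m p) * (tt ?i m 0 * tb ?j p 0))"
    unfolding Sm_nth_sum TB ..
  also have "\<dots> = (\<Sum>m=1..N. \<Sum>p=1..N. if m = ?i then if p = ?j then sc q * (tt ?i ?i 0 * tb ?j ?j 0) else 0 else 0)"
  proof (intro sum.cong refl)
    fix m p assume mp: "m \<in> {1..N}" "p \<in> {1..N}"
    show "sc (Gm ty q m p) * (tt ?i m 0 * tb ?j p 0) = (if m = ?i then if p = ?j then sc q * (tt ?i ?i 0 * tb ?j ?j 0) else 0 else 0)"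
    proof (cases "m = ?i \<and> p = ?j")
      case True
      moreover have "Gm ty q ?i ?j = q" using k by (simp add: Gm_def ty)
      ultimately show ?thesis using k by simp
    next
      case False
      \<comment> \<open>The zero modes vanish for m > 2k-1 and for p < 2k, while G links m only to p
        \<le> m + 1; this leaves m = 2k-1, p = 2k.\<close>
      have "Gm ty q m p = 0 \<or> ?i < m \<or> p < ?j"
      proof (rule ccontr)
        assume "\<not> ?thesis"
        then have g: "Gm ty q m p \<noteq> 0" and m: "m \<le> ?i" and p: "?j \<le> p" by auto
        have "p = gpart Symplectic m" using g by (auto simp: Gm_def ty)
        then have "p \<le> m + 1" by (auto split: if_splits)
        then show False using False m p k by auto
      qed
      then have "sc (Gm ty q m p) * (tt ?i m 0 * tb ?j p 0) = 0"
        using t0[OF V(1) mp(1)] b0[OF V(2) mp(2)] by (auto simp: sc_zero)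
      then show ?thesis using False by auto
    qed
  qed
  also have "\<dots> = sc q * (tt ?i ?i 0 * tb ?j ?j 0)"
  proof -
    have "(\<Sum>p=1..N. if m = ?i then if p = ?j then x else 0 else 0) = (if m = ?i then x else 0)" for m and x :: uqs
      using V(2) by (auto simp: sum.delta)
    then show ?thesis using V(1) by (simp add: sum.delta)
  qed
  finally have "s_coeff ty q N ?i ?j 0 = uq_scalar q N q \<otimes>\<^bsub>U\<^esub> (coord q N (tt ?i ?i 0) \<otimes>\<^bsub>U\<^esub> coord q N (tb ?j ?j 0))"
    using s_coeff_eq[OF V, of 0] by (simp add: coord_simps coord_sc)
  moreover have "uq_scalar q N q \<in> Units U"
  proof -
    have "uq_scalar q N (1 / q) \<otimes>\<^bsub>U\<^esub> uq_scalar q N q = \<one>\<^bsub>U\<^esub>" "uq_scalar q N q \<otimes>\<^bsub>U\<^esub> uq_scalar q N (1 / q) = \<one>\<^bsub>U\<^esub>"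
      using q_nz by (simp_all add: uq_scalar_mult[symmetric] uq_scalar_one)
    then show ?thesis unfolding Units_def using uq_scalar_carrier by blast
  qed
  ultimately show ?thesis using T_unit[OF V(1)] T_unit[OF V(2)] by (simp add: U.Units_m_closed)
qed

lemma gens_carrier: "range (uq_scalar q N) \<union> Ytw_gens ty q N \<subseteq> carrier U"
proof -
  have "s_coeff ty q N i j r \<in> carrier U" if "i \<in> {1..N}" "j \<in> {1..N}" for i j r
    using s_coeff_eq[OF that] by simp
  moreover have "inv\<^bsub>U\<^esub> (s_coeff ty q N (2 * k - 1) (2 * k) 0) \<in> carrier U" if "ty = Symplectic" "1 \<le> k" "2 * k \<le> N" for k
    using s_unit[OF that] by (rule U.Units_inv_closed)
  ultimately show ?thesis
    unfolding Ytw_gens_def using uq_scalar_carrier by (auto split: twist.splits)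
qed

text \<open>Commuting with the coefficients of S is enough: scalars are central, an element
  commuting with a unit commutes with its inverse, and a commutant is closed under the operations
  generating the subalgebra.\<close>

theorem sdet_central: "sdet ty q N k \<in> ring_center (Ytw ty q N)"
proof -
  obtain f where f: "\<And>v. anti.A (chain Ss Qs [1..<Suc N] v) = (\<lambda>I. f * anti.A v I)"
    using ex_sdet by blast
  define z where "z = coord q N (f $$ (- k))"
  have sz: "sdet ty q N k = z" using sdet_eq[OF f] by (simp add: ser_def z_def)
  have zc: "z \<in> carrier U" by (simp add: z_def)
  have zY: "z \<in> Y" using sdet_in_YF[OF f] by (simp add: YF_def z_def)
  have comm_s: "z \<otimes>\<^bsub>U\<^esub> s_coeff ty q N i j r = s_coeff ty q N i j r \<otimes>\<^bsub>U\<^esub> z" if "i \<in> {1..N}" "j \<in> {1..N}" for i j r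
    using arg_cong[OF coefficients_commute[OF f that, of "- k" "int r"], of "coord q N"]
    by (simp add: s_coeff_eq[OF that] z_def coord_simps)
  have comm_inv: "z \<otimes>\<^bsub>U\<^esub> inv\<^bsub>U\<^esub> s = inv\<^bsub>U\<^esub> s \<otimes>\<^bsub>U\<^esub> z" if s: "s \<in> Units U" and zs: "z \<otimes>\<^bsub>U\<^esub> s = s \<otimes>\<^bsub>U\<^esub> z" for s
  proof -
    have c: "s \<in> carrier U" "inv\<^bsub>U\<^esub> s \<in> carrier U" using s by auto
    have "inv\<^bsub>U\<^esub> s \<otimes>\<^bsub>U\<^esub> z = inv\<^bsub>U\<^esub> s \<otimes>\<^bsub>U\<^esub> (z \<otimes>\<^bsub>U\<^esub> s \<otimes>\<^bsub>U\<^esub> inv\<^bsub>U\<^esub> s)"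
      using c zc s by (simp add: U.m_assoc)
    also have "\<dots> = inv\<^bsub>U\<^esub> s \<otimes>\<^bsub>U\<^esub> s \<otimes>\<^bsub>U\<^esub> (z \<otimes>\<^bsub>U\<^esub> inv\<^bsub>U\<^esub> s)"
      unfolding zs using c zc by (simp add: U.m_assoc del: U.Units_l_inv)
    also have "\<dots> = z \<otimes>\<^bsub>U\<^esub> inv\<^bsub>U\<^esub> s" using c zc s by simp
    finally show ?thesis ..
  qed
  have gen: "z \<otimes>\<^bsub>U\<^esub> y = y \<otimes>\<^bsub>U\<^esub> z" if "y \<in> range (uq_scalar q N) \<union> Ytw_gens ty q N" for y
    using that
  proof
    assume "y \<in> range (uq_scalar q N)"
    then show ?thesis using uq_scalar_central[OF zc] by auto
  next
    assume "y \<in> Ytw_gens ty q N"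
    then consider i j r where "i \<in> {1..N}" "j \<in> {1..N}" "y = s_coeff ty q N i j r"
      | k where "ty = Symplectic" "1 \<le> k" "2 * k \<le> N" "y = inv\<^bsub>U\<^esub> (s_coeff ty q N (2 * k - 1) (2 * k) 0)"
      unfolding Ytw_gens_def by (auto split: twist.splits)
    then show ?thesis
    proof cases
      case 1
      then show ?thesis using comm_s by simp
    next
      case 2
      have V: "2 * k - 1 \<in> {1..N}" "2 * k \<in> {1..N}" using 2 by auto
      show ?thesis using comm_inv[OF s_unit[OF 2(1-3)] comm_s[OF V]] 2(4) by simp
    qed
  qed
  have "z \<otimes>\<^bsub>U\<^esub> y = y \<otimes>\<^bsub>U\<^esub> z" if "y \<in> Y" for y
    using that
  proof (induction rule: generate_ring.induct)
    case one
    show ?case using zc by simp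
  next
    case (incl h)
    then show ?case by (rule gen)
  next
    case (a_inv h)
    moreover have "h \<in> carrier U" using U.generate_ring_in_carrier[OF gens_carrier a_inv(1)] .
    ultimately show ?case using zc by (simp add: U.r_minus U.l_minus)
  next
    case (eng_add h1 h2)
    moreover have "h1 \<in> carrier U" "h2 \<in> carrier U" using U.generate_ring_in_carrier[OF gens_carrier] eng_add by auto
    ultimately show ?case using zc by (simp add: U.r_distr U.l_distr)
  next
    case (eng_mult h1 h2)
    moreover have "h1 \<in> carrier U" "h2 \<in> carrier U" using U.generate_ring_in_carrier[OF gens_carrier] eng_mult by auto
    ultimately show ?case using zc by (metis U.m_assoc)
  qed
  then show ?thesis unfolding sz ring_center_def Ytw_def using zY by simp
qed

end

theorem corollary4p3:
  fixes q :: complex and N :: nat and ty :: twist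
  assumes "q \<noteq> 0"
    and "\<forall>m::nat. m > 0 \<longrightarrow> q ^ m \<noteq> 1"
    and "N \<ge> 1"
    and "ty = Symplectic \<longrightarrow> even N"
  shows "\<forall>k. sdet ty q N k \<in> ring_center (Ytw ty q N)"
proof -
  interpret twisted_setup q N ty
    by unfold_locales (use assms in auto)
  show ?thesis using sdet_central by blast
qed

end
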